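(* Let $\varphi$ be a Finsler norm in $\mathbb{R}^d$ that possesses a shielding norm $\psi$, and let $\overline{F},\underline{F}:\mathbb{R}^d\times\mathcal{S}^d\to\mathbb{R}$ be such that (1) $\overline{F}(p,X+Y)\ge\overline{F}(p,X)$ and $\underline{F}(p,X+Y)\ge\underline{F}(p,X)$ for all $p\in\mathbb{R}^d$, $X,Y\in\mathcal{S}^d$ with $Y\ge 0$; (2) $\overline{F}$ is upper semicontinuous and $\underline{F}$ is lower semicontinuous on $\mathbb{R}^d\times\mathcal{S}^d$; (3) the pair $(\overline{F},\underline{F})$ is compatible with $\varphi$. Let $T>0$ and let $w\in USC(\mathbb{R}^d\times[0,T))$ and $v\in LSC(\mathbb{R}^d\times[0,T))$ be bounded and satisfy, in the viscosity sense, $$w_t-\overline{F}(Dw,D^2w)\le 0\ \text{ in }\ \mathbb{R}^d\times(0,T),\qquad v_t-\underline{F}(Dv,D^2v)\ge 0\ \text{ in }\ \mathbb{R}^d\times(0,T),$$ and $$\lim_{\delta\to0^+}\sup\{w(x,0)-v(y,0)\,:\,x,y\in\mathbb{R}^d,\ \|x-y\|\le\delta\}\le 0.$$ Then $w\le v$ in $\mathbb{R}^d\times[0,T)$.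
   Context: $\mathcal{S}^d$ is the space of real symmetric $d\times d$ matrices with its usual order ($X\le Y$ iff $Y-X$ is positive semidefinite); $\langle\cdot,\cdot\rangle$ and $\|\cdot\|$ are the Euclidean inner product and norm. $USC$ and $LSC$ denote upper and lower semicontinuous functions. A Finsler norm is a function $\varphi:\mathbb{R}^d\to[0,\infty)$ with $\varphi(\lambda q)=\lambda\varphi(q)$ for $\lambda>0$, $\varphi(q_1+q_2)\le\varphi(q_1)+\varphi(q_2)$, and $\min_{q\neq0}\varphi(q)/\|q\|>0$ (symmetry is not required). Its dual norm is $\varphi^*(p)=\max_{q\ne0}\langle p,q\rangle/\varphi(q)$, and $\partial\varphi^*(p)$ is the usual convex subdifferential of $\varphi^*$ at $p$. For $p\in\mathbb{R}^d$ let $\mathcal{T}(p,\varphi)=\{v\in\mathbb{R}^d:\langle v,q\rangle=0\ \text{for all}\ q\in\partial\varphi^*(p)\}$. For a linear subspace $V\subseteq\mathbb{R}^d$ let $\pi_V$ be the orthogonal projection onto $V$ and $\mathcal{S}_V=\{X\in\mathcal{S}^d:\pi_V X\pi_V=X\}$. Set $\mathcal{S}(p,\varphi)=\mathcal{S}_{\langle p\rangle\oplus\mathcal{T}(p,\varphi)}$, where $\langle p\rangle$ is the linear span of $p$. The pair $(\overline F,\underline F)$ is compatible with $\varphi$ if $\overline{F}(p,X)=\underline{F}(p,X)$ for all $p\in\mathbb{R}^d$ and $X\in\mathcal{S}(p,\varphi)$. A Finsler norm $\psi$ is a shielding norm for $\varphi$ if $\psi\in C^2(\mathbb{R}^d\setminus\{0\})$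 and $D^2\psi(q)\in\mathcal{S}(D\psi(q),\varphi)$ for every $q\in\mathbb{R}^d\setminus\{0\}$. Viscosity sense: $w_t-\overline F(Dw,D^2w)\le0$ means that whenever a smooth function $\phi$ is such that $w-\phi$ has a local maximum at $(x_0,t_0)\in\mathbb{R}^d\times(0,T)$, then $\phi_t(x_0,t_0)-\overline F(D\phi(x_0,t_0),D^2\phi(x_0,t_0))\le0$; the inequality for $v$ is defined analogously with local minima and $\underline F$, with $\ge 0$. *)

theory Defs
  imports "HOL-Analysis.Analysis"
begin

section \<open>Semicontinuity and smoothness\<close>

definition usc_on :: "'a::topological_space set \<Rightarrow> ('a \<Rightarrow> real) \<Rightarrow> bool" where
  "usc_on S f \<longleftrightarrow> (\<forall>x\<in>S. \<forall>a. f x < a \<longrightarrow> eventually (\<lambda>y. f y < a) (at x within S))"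

definition lsc_on :: "'a::topological_space set \<Rightarrow> ('a \<Rightarrow> real) \<Rightarrow> bool" where
  "lsc_on S f \<longleftrightarrow> (\<forall>x\<in>S. \<forall>a. a < f x \<longrightarrow> eventually (\<lambda>y. a < f y) (at x within S))"

text \<open>The following two predicates are meant for open sets: derivatives are taken at full
  neighbourhoods of the points of the set.\<close>

primrec Ck_on :: "nat \<Rightarrow> 'a::real_normed_vector set \<Rightarrow> ('a \<Rightarrow> real) \<Rightarrow> bool" where
  "Ck_on 0 S f \<longleftrightarrow> continuous_on S f"
| "Ck_on (Suc k) S f \<longleftrightarrow>
     (\<forall>x\<in>S. f differentiable (at x)) \<and>
     (\<forall>h. Ck_on k S (\<lambda>x. frechet_derivative f (at x) h))"

definition smooth_on :: "'a::real_normed_vector set \<Rightarrow> ('a \<Rightarrow> real) \<Rightarrow> bool" where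
  "smooth_on S f \<longleftrightarrow> (\<forall>k. Ck_on k S f)"

definition grad :: "('a::real_inner \<Rightarrow> real) \<Rightarrow> 'a \<Rightarrow> 'a" where
  "grad f x = (THE g. GDERIV f x :> g)"

definition hess :: "(real^'n \<Rightarrow> real) \<Rightarrow> real^'n \<Rightarrow> real^'n^'n" where
  "hess f x = jacobian (grad f) (at x)"

section \<open>Symmetric matrices\<close>

definition sym_matrices :: "(real^'n^'n) set" where
  "sym_matrices = {X. transpose X = X}"

text \<open>The order on symmetric matrices is the Loewner order, so \<open>Y \<ge> 0\<close> is \<open>psd Y\<close>.
  It is unrelated to the componentwise order that the type \<open>real^'n^'n\<close> carries.\<close>

definition psd :: "real^'n^'n \<Rightarrow> bool" where
  "psd X \<longleftrightarrow> X \<in> sym_matrices \<and> (\<forall>x. 0 \<le> x \<bullet> (X *v x))"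

definition orth_proj :: "(real^'n) set \<Rightarrow> real^'n^'n" where
  "orth_proj V = matrix (\<lambda>x. THE y. y \<in> V \<and> (\<forall>z\<in>V. orthogonal (x - y) z))"

definition sym_sub :: "(real^'n) set \<Rightarrow> (real^'n^'n) set" where
  "sym_sub V = {X \<in> sym_matrices. orth_proj V ** X ** orth_proj V = X}"

section \<open>Finsler norms\<close>

text \<open>The last conjunct says that \<open>\<phi> q / norm q\<close> attains a positive minimum
  over \<open>q \<noteq> 0\<close>.\<close>

definition finsler_norm :: "(real^'n \<Rightarrow> real) \<Rightarrow> bool" where
  "finsler_norm \<phi> \<longleftrightarrow>
     (\<forall>q. 0 \<le> \<phi> q) \<and>
     (\<forall>l q. 0 < l \<longrightarrow> \<phi> (l *\<^sub>R q) = l * \<phi> q) \<and>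
     (\<forall>q1 q2. \<phi> (q1 + q2) \<le> \<phi> q1 + \<phi> q2) \<and>
     (\<exists>q0. q0 \<noteq> 0 \<and> (\<forall>q. q \<noteq> 0 \<longrightarrow> \<phi> q0 / norm q0 \<le> \<phi> q / norm q) \<and> 0 < \<phi> q0 / norm q0)"

text \<open>For a Finsler norm the supremum below is a maximum, since the quotient is continuous and
  invariant under positive scaling of \<open>q\<close>.\<close>

definition dual_norm :: "(real^'n \<Rightarrow> real) \<Rightarrow> real^'n \<Rightarrow> real" where
  "dual_norm \<phi> p = (SUP q\<in>{q. q \<noteq> 0}. (p \<bullet> q) / \<phi> q)"

definition subdifferential :: "('a::real_inner \<Rightarrow> real) \<Rightarrow> 'a \<Rightarrow> 'a set" where
  "subdifferential f p = {q. \<forall>p'. f p + q \<bullet> (p' - p) \<le> f p'}"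

definition tang :: "real^'n \<Rightarrow> (real^'n \<Rightarrow> real) \<Rightarrow> (real^'n) set" where
  "tang p \<phi> = {v. \<forall>q\<in>subdifferential (dual_norm \<phi>) p. v \<bullet> q = 0}"

definition sym_tang :: "real^'n \<Rightarrow> (real^'n \<Rightarrow> real) \<Rightarrow> (real^'n^'n) set" where
  "sym_tang p \<phi> = sym_sub {a + b |a b. a \<in> span {p} \<and> b \<in> tang p \<phi>}"

definition compatible ::
  "(real^'n \<Rightarrow> real^'n^'n \<Rightarrow> real) \<Rightarrow> (real^'n \<Rightarrow> real^'n^'n \<Rightarrow> real) \<Rightarrow> (real^'n \<Rightarrow> real) \<Rightarrow> bool" where
  "compatible F G \<phi> \<longleftrightarrow> (\<forall>p. \<forall>X\<in>sym_tang p \<phi>. F p X = G p X)"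

definition shielding_norm :: "(real^'n \<Rightarrow> real) \<Rightarrow> (real^'n \<Rightarrow> real) \<Rightarrow> bool" where
  "shielding_norm \<psi> \<phi> \<longleftrightarrow>
     finsler_norm \<psi> \<and> Ck_on 2 (- {0}) \<psi> \<and>
     (\<forall>q. q \<noteq> 0 \<longrightarrow> hess \<psi> q \<in> sym_tang (grad \<psi> q) \<phi>)"

section \<open>Viscosity inequalities\<close>

text \<open>Functions of space and time are functions on pairs \<open>(x, t)\<close>. Since \<open>t0\<close> lies in the open
  interval, a local extremum relative to \<open>UNIV \<times> {0<..<T}\<close> is the same as one relative to the
  filter \<open>nhds (x0, t0)\<close>.\<close>

definition visc_sub :: "real \<Rightarrow> (real^'n \<Rightarrow> real^'n^'n \<Rightarrow> real) \<Rightarrow> ((real^'n) \<times> real \<Rightarrow> real) \<Rightarrow> bool" where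
  "visc_sub T F w \<longleftrightarrow>
     (\<forall>\<phi> x0 t0. smooth_on (UNIV \<times> {0<..<T}) \<phi> \<longrightarrow> t0 \<in> {0<..<T} \<longrightarrow>
        eventually (\<lambda>z. w z - \<phi> z \<le> w (x0, t0) - \<phi> (x0, t0)) (nhds (x0, t0)) \<longrightarrow>
        deriv (\<lambda>t. \<phi> (x0, t)) t0
          - F (grad (\<lambda>x. \<phi> (x, t0)) x0) (hess (\<lambda>x. \<phi> (x, t0)) x0) \<le> 0)"

definition visc_super :: "real \<Rightarrow> (real^'n \<Rightarrow> real^'n^'n \<Rightarrow> real) \<Rightarrow> ((real^'n) \<times> real \<Rightarrow> real) \<Rightarrow> bool" where
  "visc_super T F v \<longleftrightarrow>
     (\<forall>\<phi> x0 t0. smooth_on (UNIV \<times> {0<..<T}) \<phi> \<longrightarrow> t0 \<in> {0<..<T} \<longrightarrow>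
        eventually (\<lambda>z. v z - \<phi> z \<ge> v (x0, t0) - \<phi> (x0, t0)) (nhds (x0, t0)) \<longrightarrow>
        deriv (\<lambda>t. \<phi> (x0, t)) t0
          - F (grad (\<lambda>x. \<phi> (x, t0)) x0) (hess (\<lambda>x. \<phi> (x, t0)) x0) \<ge> 0)"

end

theory Submission
  imports Defs
begin

text \<open>
  The comparison principle is proved by doubling variables with a kernel that is adapted to \<open>\<phi>\<close>. Suppose
  that \<open>w > v\<close> at some point. One maximises
  \<open>w (x, t) - v (y, s) - \<theta> (x - y) - (t - s)\<^sup>2 / (2 \<sigma>\<^sup>2)\<close> minus penalties
  \<open>\<alpha> (|x|\<^sup>2 + |y|\<^sup>2) + \<gamma> / (T - t) + \<gamma> / (T - s)\<close>, and compares the two viscosity inequalities at the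
  maximum. The difficulty is that the two operators agree only on matrices in \<open>S(p, \<phi>)\<close>, while the
  theorem on sums produces two matrices \<open>X\<close> and \<open>Y\<close>, about which it says only that
  \<open>h \<bullet> X h - k \<bullet> Y k \<le> (h - k) \<bullet> (H + H\<^sup>2) (h - k)\<close> up to a small error, where \<open>H\<close> is the Hessian of \<open>\<theta>\<close> at
  \<open>x - y\<close>.

  The kernel \<open>\<theta> = c \<psi>\<^sup>4\<close> is built from the shielding norm (\<open>shielding_quartic\<close>). It is of class \<open>C\<^sup>2\<close>
  everywhere, and at each point its Hessian lies in \<open>S(p, \<phi>)\<close> for \<open>p\<close> the gradient at the same point. Thus
  \<open>H\<close> kills the orthogonal complement \<open>W\<close> of the space generated by \<open>p\<close> and the tangent space, and the right-hand side
  vanishes when \<open>h - k\<close> is in \<open>W\<close>. By successive Schur complements such an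
  inequality yields a matrix \<open>Z\<close> with \<open>X \<le> Z \<le> Y\<close> that kills \<open>W\<close> as well
  (\<open>interpolating_matrix\<close>), that is, \<open>Z\<close> lies in \<open>S(p, \<phi>)\<close>. There the operators
  agree, and monotonicity gives \<open>Fup p X \<le> Flo p Y\<close> (\<open>F_le_of_form_inequality\<close>), whereas the viscosity
  inequalities give \<open>Fup p X - Flo p Y \<ge> \<gamma> / T\<^sup>2 > 0\<close>.

  Compatibility needs this inequality exactly and not just approximately, so all errors must vanish in the limit
  with \<open>\<theta>\<close> fixed. Therefore \<open>c\<close> is chosen once, large enough for the initial condition, and
  only \<open>\<alpha>\<close> tends to zero; bounds on \<open>X\<close>, \<open>Y\<close> and \<open>x - y\<close> that do not depend on \<open>\<alpha>\<close> and \<open>\<sigma>\<close> give convergent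
  subsequences (\<open>no_persistent_gap\<close>). For each \<open>\<alpha>\<close> the parameter \<open>\<sigma>\<close> is taken so small that the maximum is not at
  the initial time (\<open>doubled_maximum\<close>); measuring time in units of \<open>\<sigma>\<close> keeps the bounds uniform
  (\<open>doubling_jets\<close>).

  The theorem on sums (\<open>theorem_on_sums\<close>) is derived from Rademacher's theorem. The functions
  are regularised by a sup-convolution followed by an inf-convolution with a larger constant, which gives functions
  with Lipschitz continuous gradient. These gradients are differentiable almost everywhere, and a
  perturbation by small linear functions produces a set of maximum points that is not null. Rademacher's theorem itself
  follows from the differentiability of Lipschitz functions of one variable, Tonelli's theorem, and
  the fact that porous sets are null.
\<close>

section \<open>Null sets from shrinking covers, and porosity\<close>

text \<open>Covering arguments of Vitali type show that a set is null by replacing every open cover with one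
  whose measure is smaller by a fixed factor \<open>c < 1\<close>. The infimum \<open>m\<close> of the measures of open covers
  is finite for a bounded set and then satisfies \<open>m \<le> c * m\<close>. The covers \<open>W\<close> produced by such
  arguments are not open, so each is enlarged to an open set by an arbitrarily small amount.\<close>
lemma negligible_if_covers_shrink:
  fixes E :: "'a::euclidean_space set"
  assumes "bounded E" "0 < c" "c < 1"
    and shrink: "\<And>U. open U \<Longrightarrow> E \<subseteq> U \<Longrightarrow>
      \<exists>W\<in>sets lebesgue. E \<subseteq> W \<and> emeasure lebesgue W \<le> ennreal c * emeasure lebesgue U"
  shows "negligible E"
proof -
  define \<U> where "\<U> = {U. open U \<and> E \<subseteq> U}"
  define m where "m = (INF U\<in>\<U>. emeasure lebesgue U)"
  obtain R where "E \<subseteq> ball 0 R"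
    using \<open>bounded E\<close> bounded_subset_ballD by blast
  then have "m \<le> emeasure lebesgue (ball (0::'a) R)"
    unfolding m_def by (intro INF_lower) (auto simp: \<U>_def)
  also have "\<dots> < \<infinity>"
    using emeasure_bounded_finite[of "ball (0::'a) R"] by simp
  finally obtain r where r: "0 \<le> r" "m = ennreal r"
    by (cases m) auto
  have step: "m \<le> ennreal c * emeasure lebesgue U" if "U \<in> \<U>" for U
  proof (rule ennreal_le_epsilon)
    fix e :: real
    assume "0 < e"
    obtain W where W: "W \<in> sets lebesgue" "E \<subseteq> W"
        "emeasure lebesgue W \<le> ennreal c * emeasure lebesgue U"
      using shrink \<open>U \<in> \<U>\<close> unfolding \<U>_def by blast
    obtain V where V: "open V" "W \<subseteq> V" "V - W \<in> lmeasurable" "emeasure lebesgue (V - W) < ennreal e"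
      using sets_lebesgue_outer_open[OF W(1) \<open>0 < e\<close>] by blast
    have "m \<le> emeasure lebesgue V"
      unfolding m_def using W V by (intro INF_lower) (auto simp: \<U>_def)
    also have "\<dots> \<le> emeasure lebesgue W + emeasure lebesgue (V - W)"
      using emeasure_subadditive[OF W(1), of "V - W"] V by (simp add: Un_absorb1)
    also have "\<dots> \<le> ennreal c * emeasure lebesgue U + ennreal e"
      using W V by (intro add_mono) auto
    finally show "m \<le> ennreal c * emeasure lebesgue U + ennreal e" .
  qed
  have "m = 0"
  proof (rule ccontr)
    assume "m \<noteq> 0"
    then have "0 < r" using r by (auto simp: less_le)
    then have "m < ennreal (r / c)"
      using assms r by (simp add: ennreal_less_iff field_simps)
    then obtain U where U: "U \<in> \<U>" "emeasure lebesgue U < ennreal (r / c)"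
      unfolding m_def INF_less_iff by blast
    have "ennreal c * emeasure lebesgue U < ennreal c * ennreal (r / c)"
      using U \<open>0 < c\<close> by (intro ennreal_mult_strict_left_mono) auto
    also have "\<dots> = m" using assms r by (simp add: ennreal_mult'[symmetric])
    finally show False using step[OF U(1)] by simp
  qed
  show ?thesis
    unfolding negligible_outer
  proof (intro allI impI)
    fix e :: real
    assume "0 < e"
    then have "m < ennreal e" using \<open>m = 0\<close> by simp
    then obtain U where U: "U \<in> \<U>" "emeasure lebesgue U < ennreal e"
      unfolding m_def INF_less_iff by blast
    then have "U \<in> lmeasurable"
      by (auto simp: \<U>_def fmeasurable_def intro: order.strict_trans)
    with U show "\<exists>T. E \<subseteq> T \<and> T \<in> lmeasurable \<and> measure lebesgue T < e"
      using \<open>0 < e\<close> by (intro exI[of _ U]) (auto simp: \<U>_def emeasure_eq_measure2 ennreal_less_iff)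
  qed
qed

lemma emeasure_UN_le_scaled:
  assumes "countable I" "disjoint_family_on X I" "disjoint_family_on Y I"
    and "\<And>i. i \<in> I \<Longrightarrow> X i \<in> sets M" "\<And>i. i \<in> I \<Longrightarrow> Y i \<in> sets N"
    and "\<And>i. i \<in> I \<Longrightarrow> emeasure N (Y i) \<le> c * emeasure M (X i)"
  shows "emeasure N (\<Union>i\<in>I. Y i) \<le> c * emeasure M (\<Union>i\<in>I. X i)"
proof -
  have "emeasure N (\<Union>i\<in>I. Y i) = (\<integral>\<^sup>+i. emeasure N (Y i) \<partial>count_space I)"
    by (intro emeasure_UN_countable) (use assms in auto)
  also have "\<dots> \<le> (\<integral>\<^sup>+i. c * emeasure M (X i) \<partial>count_space I)"
    by (intro nn_integral_mono) (use assms in auto)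
  also have "\<dots> = c * (\<integral>\<^sup>+i. emeasure M (X i) \<partial>count_space I)"
    by (rule nn_integral_cmult) simp
  also have "(\<integral>\<^sup>+i. emeasure M (X i) \<partial>count_space I) = emeasure M (\<Union>i\<in>I. X i)"
    by (intro emeasure_UN_countable[symmetric]) (use assms in auto)
  finally show ?thesis .
qed

lemma emeasure_lebesgue_ball:
  "0 \<le> r \<Longrightarrow> emeasure lebesgue (ball (c::'a::euclidean_space) r) = ennreal (unit_ball_vol DIM('a) * r ^ DIM('a))"
  using emeasure_ball[of r c] by simp

text \<open>A point of \<open>A\<close> is porous when holes of \<open>A\<close> occur arbitrarily close to it with radius comparable to
  their distance from it.\<close>
definition porous_part :: "real \<Rightarrow> 'a::euclidean_space set \<Rightarrow> 'a set" where
  "porous_part \<eta> A = {x\<in>A. \<forall>d>0. \<exists>h. 0 < norm h \<and> norm h < d \<and> ball (x + h) (\<eta> * norm h) \<inter> A = {}}"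

text \<open>A ball of radius \<open>2 * norm h\<close> around a porous point contains the hole at distance \<open>norm h\<close>, which
  takes up the share \<open>(\<eta> / 2) ^ n\<close> of its volume. Removing the holes from the balls of a Vitali covering
  uncovers no point of \<open>A\<close>, so every cover can be shrunk by the factor \<open>1 - (\<eta> / 2) ^ n\<close>.\<close>
lemma negligible_porous_part:
  fixes A :: "'a::euclidean_space set"
  assumes \<eta>: "0 < \<eta>" "\<eta> < 1"
  shows "negligible (porous_part \<eta> A)"
proof -
  define n where "n = DIM('a)"
  have n: "n > 0" by (simp add: n_def)
  define c where "c = 1 - (\<eta> / 2) ^ n"
  have "0 < (\<eta> / 2) ^ n" "(\<eta> / 2) ^ n < 1"
    using \<eta> n by (auto intro: power_Suc_less_one simp: power_less_one_iff)
  then have c: "0 < c" "c < 1" by (auto simp: c_def)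
  have bdd: "negligible (porous_part \<eta> A \<inter> ball 0 R)" (is "negligible ?E") for R
  proof (rule negligible_if_covers_shrink[OF _ c])
    show "bounded ?E" by (meson bounded_ball bounded_subset inf_le2)
    fix U assume U: "open U" "?E \<subseteq> U"
    define K where "K = {i. 0 < norm (snd i) \<and> ball (fst i) (2 * norm (snd i)) \<subseteq> U
       \<and> ball (fst i + snd i) (\<eta> * norm (snd i)) \<inter> A = {}}"
    have fine: "\<exists>i. i \<in> K \<and> x \<in> ball (fst i) (2 * norm (snd i)) \<and> 2 * norm (snd i) < d"
      if "x \<in> ?E" "0 < d" for x d
    proof -
      have "x \<in> U" using U(2) that by blast
      then obtain d' where d': "d' > 0" "ball x d' \<subseteq> U"
        using open_contains_ball_eq[OF U(1), of x] by auto
      have "0 < min d d' / 2" using d' that by auto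
      moreover have "\<forall>d>0. \<exists>h. 0 < norm h \<and> norm h < d \<and> ball (x + h) (\<eta> * norm h) \<inter> A = {}"
        using that by (simp add: porous_part_def)
      ultimately obtain h where h: "0 < norm h" "norm h < min d d' / 2" "ball (x + h) (\<eta> * norm h) \<inter> A = {}"
        by meson
      have "ball x (2 * norm h) \<subseteq> U"
        using h d' by (auto simp: subset_iff)
      then show ?thesis
        using h by (intro exI[of _ "(x, h)"]) (auto simp: K_def)
    qed
    obtain C where C: "countable C" "C \<subseteq> K"
      "pairwise (\<lambda>i j. disjnt (ball (fst i) (2 * norm (snd i))) (ball (fst j) (2 * norm (snd j)))) C"
      "negligible (?E - (\<Union>i\<in>C. ball (fst i) (2 * norm (snd i))))"
      by (rule Vitali_covering_theorem_balls[of ?E K fst "\<lambda>i. 2 * norm (snd i)", OF fine], assumption, assumption, rule that)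
    define X where "X = (\<lambda>i::'a \<times> 'a. ball (fst i) (2 * norm (snd i)))"
    define H where "H = (\<lambda>i::'a \<times> 'a. ball (fst i + snd i) (\<eta> * norm (snd i)))"
    define N where "N = ?E - (\<Union>i\<in>C. X i)"
    have N: "negligible N" using C by (simp add: N_def X_def)
    have XU: "X i \<subseteq> U" "H i \<inter> A = {}" if "i \<in> C" for i
      using C that by (auto simp: K_def X_def H_def)
    have HX: "H i \<subseteq> X i" for i
    proof
      fix y assume "y \<in> H i"
      then have "dist (fst i + snd i) y < \<eta> * norm (snd i)" by (simp add: H_def)
      moreover have "\<eta> * norm (snd i) \<le> norm (snd i)"
        using \<eta> by (simp add: mult_left_le_one_le)
      moreover have "dist (fst i) y \<le> dist (fst i) (fst i + snd i) + dist (fst i + snd i) y"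
        by (rule dist_triangle)
      ultimately show "y \<in> X i" by (simp add: X_def dist_norm)
    qed
    have disX: "disjoint_family_on X C"
      using C(3) by (auto simp: disjoint_family_on_def pairwise_def disjnt_def X_def)
    then have disY: "disjoint_family_on (\<lambda>i. X i - H i) C"
      by (rule disjoint_family_on_bisimulation) auto
    have em: "emeasure lebesgue (X i - H i) \<le> ennreal c * emeasure lebesgue (X i)" for i
    proof -
      define v where "v = unit_ball_vol (real n)"
      define s where "s = norm (snd i)"
      have "0 \<le> v" "0 \<le> s" by (auto simp: v_def s_def)
      have "0 \<le> \<eta> * s" using \<eta> \<open>0 \<le> s\<close> by simp
      have emX: "emeasure lebesgue (X i) = ennreal (v * (2 * s) ^ n)"
        unfolding X_def s_def[symmetric] v_def n_def using \<open>0 \<le> s\<close> by (subst emeasure_lebesgue_ball) auto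
      have emH: "emeasure lebesgue (H i) = ennreal (v * (\<eta> * s) ^ n)"
        unfolding H_def s_def[symmetric] v_def n_def using \<open>0 \<le> \<eta> * s\<close> by (subst emeasure_lebesgue_ball) auto
      have fin: "emeasure lebesgue (H i) \<noteq> \<infinity>" by (simp add: emH)
      have "emeasure lebesgue (X i - H i) = emeasure lebesgue (X i) - emeasure lebesgue (H i)"
        by (rule emeasure_Diff[OF fin _ _ HX]) (auto simp: X_def H_def)
      also have "\<dots> = ennreal (v * (2 * s) ^ n) - ennreal (v * (\<eta> * s) ^ n)"
        by (simp only: emX emH)
      also have "\<dots> = ennreal (v * (2 * s) ^ n - v * (\<eta> * s) ^ n)"
        using \<eta> \<open>0 \<le> v\<close> by (intro ennreal_minus) (auto simp: s_def)
      also have "v * (2 * s) ^ n - v * (\<eta> * s) ^ n = c * (v * (2 * s) ^ n)"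
        by (simp add: c_def power_mult_distrib power_divide algebra_simps)
      also have "ennreal (c * (v * (2 * s) ^ n)) = ennreal c * emeasure lebesgue (X i)"
        unfolding emX using c \<open>0 \<le> v\<close> \<open>0 \<le> s\<close> by (intro ennreal_mult) auto
      finally show ?thesis by simp
    qed
    define W where "W = N \<union> (\<Union>i\<in>C. X i - H i)"
    have sets: "(\<Union>i\<in>C. X i - H i) \<in> sets lebesgue"
      by (intro sets.countable_UN'' C) (auto simp: X_def H_def)
    have "?E \<subseteq> W"
    proof
      fix x assume x: "x \<in> ?E"
      then have "x \<in> A" by (simp add: porous_part_def)
      then have "x \<notin> H i" if "i \<in> C" for i using XU(2)[OF that] by blast
      then show "x \<in> W" using x by (auto simp: W_def N_def)
    qed
    moreover have "W \<in> sets lebesgue"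
      using sets N by (auto simp: W_def intro!: sets.Un dest: negligible_imp_sets)
    moreover have "emeasure lebesgue W \<le> ennreal c * emeasure lebesgue U"
    proof -
      have "emeasure lebesgue W = emeasure lebesgue (\<Union>i\<in>C. X i - H i)"
        unfolding W_def using N sets by (subst Un_commute, intro emeasure_Un_null_set) (auto simp: negligible_iff_null_sets)
      also have "\<dots> \<le> ennreal c * emeasure lebesgue (\<Union>i\<in>C. X i)"
        by (rule emeasure_UN_le_scaled[OF C(1) disX disY _ _ em]) (auto simp: X_def H_def)
      also have "\<dots> \<le> ennreal c * emeasure lebesgue U"
        using XU U by (intro mult_left_mono emeasure_mono) auto
      finally show ?thesis .
    qed
    ultimately show "\<exists>W\<in>sets lebesgue. ?E \<subseteq> W \<and> emeasure lebesgue W \<le> ennreal c * emeasure lebesgue U"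
      by blast
  qed
  have "porous_part \<eta> A = (\<Union>k::nat. porous_part \<eta> A \<inter> ball 0 (real k))"
    by (auto simp: reals_Archimedean2)
  then show ?thesis
    using bdd by (metis negligible_Union_nat)
qed

section \<open>Lipschitz functions of one variable\<close>

text \<open>The interval with centre \<open>c\<close> and radius \<open>r\<close> contains \<open>x\<close>, but \<open>x\<close> may be any of its points: this is
  the family of balls from which a Vitali covering is selected.\<close>
definition steep_points :: "(real \<Rightarrow> real) \<Rightarrow> (real \<Rightarrow> bool) \<Rightarrow> real set" where
  "steep_points f P = {x. \<forall>d>0. \<exists>c r. 0 < r \<and> r < d \<and> x \<in> cball c r \<and> P ((f (c + r) - f (c - r)) / (2 * r))}"

text \<open>A monotone function maps disjoint intervals to disjoint intervals, so its increments over the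
  covering intervals add up to at most \<open>f q - f p\<close>; on each of them the increment is at least \<open>b\<close> times the length.\<close>
lemma emeasure_steep_intervals_le:
  fixes f :: "real \<Rightarrow> real"
  assumes "mono f" "0 < b" "countable C"
    and disj: "pairwise (\<lambda>i j. disjnt (cball (fst i) (snd i)) (cball (fst j) (snd j))) C"
    and C: "\<And>i. i \<in> C \<Longrightarrow> 0 < snd i \<and> cball (fst i) (snd i) \<subseteq> {p..q} \<and>
        b * (2 * snd i) \<le> f (fst i + snd i) - f (fst i - snd i)"
    and "p \<le> q"
  shows "emeasure lebesgue (\<Union>i\<in>C. cball (fst i) (snd i)) \<le> ennreal ((f q - f p) / b)"
proof -
  define Y where "Y = (\<lambda>i::real \<times> real. cball (fst i) (snd i))"
  define X where "X = (\<lambda>i. {f (fst i - snd i)<..<f (fst i + snd i)})"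
  have Y_iv: "Y i = {fst i - snd i..fst i + snd i}" for i
    by (simp add: Y_def cball_eq_atLeastAtMost)
  have "disjoint_family_on Y C"
    using disj by (auto simp: disjoint_family_on_def pairwise_def disjnt_def Y_def)
  moreover have "disjoint_family_on X C"
    unfolding disjoint_family_on_def
  proof (intro ballI impI)
    fix i j assume ij: "i \<in> C" "j \<in> C" "i \<noteq> j"
    then have "Y i \<inter> Y j = {}"
      using disj by (auto simp: pairwise_def disjnt_def Y_def)
    then have "fst i + snd i \<le> fst j - snd j \<or> fst j + snd j \<le> fst i - snd i"
      using C[OF ij(1)] C[OF ij(2)] unfolding Y_iv by (auto simp: Int_atLeastAtMost)
    then have "f (fst i + snd i) \<le> f (fst j - snd j) \<or> f (fst j + snd j) \<le> f (fst i - snd i)"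
      using monoD[OF \<open>mono f\<close>] by blast
    then show "X i \<inter> X j = {}" unfolding X_def by auto
  qed
  moreover have "emeasure lebesgue (Y i) \<le> ennreal (1 / b) * emeasure lebesgue (X i)" if "i \<in> C" for i
  proof -
    have i: "0 < snd i" "b * (2 * snd i) \<le> f (fst i + snd i) - f (fst i - snd i)"
      using C[OF that] by auto
    have "f (fst i - snd i) \<le> f (fst i + snd i)"
      using i by (intro monoD[OF \<open>mono f\<close>]) simp
    then have "ennreal (1 / b) * emeasure lebesgue (X i) = ennreal (1 / b * (f (fst i + snd i) - f (fst i - snd i)))"
      using \<open>0 < b\<close> by (subst ennreal_mult) (auto simp: X_def)
    moreover have "emeasure lebesgue (Y i) = ennreal (2 * snd i)"
      using i unfolding Y_iv by simp
    ultimately show ?thesis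
      using i \<open>0 < b\<close> by (simp add: ennreal_leI field_simps)
  qed
  ultimately have "emeasure lebesgue (\<Union>i\<in>C. Y i) \<le> ennreal (1 / b) * emeasure lebesgue (\<Union>i\<in>C. X i)"
    by (intro emeasure_UN_le_scaled \<open>countable C\<close>) (auto simp: X_def Y_def)
  also have "\<dots> \<le> ennreal (1 / b) * emeasure lebesgue {f p..f q}"
  proof (intro mult_left_mono emeasure_mono UN_least)
    fix i assume "i \<in> C"
    then have "p \<le> fst i - snd i" "fst i + snd i \<le> q"
      using C[of i] unfolding Y_iv[unfolded Y_def] by auto
    then have "f p \<le> f (fst i - snd i)" "f (fst i + snd i) \<le> f q"
       by (simp_all add: monoD[OF \<open>mono f\<close>])
    then show "X i \<subseteq> {f p..f q}" by (auto simp: X_def)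
  qed auto
  also have "\<dots> = ennreal ((f q - f p) / b)"
    using \<open>0 < b\<close> monoD[OF \<open>mono f\<close> \<open>p \<le> q\<close>] by (simp add: ennreal_mult[symmetric] field_simps)
  finally show ?thesis by (simp add: Y_def)
qed

text \<open>Lebesgue's argument. The exceptional points in \<open>U\<close> are covered by disjoint intervals of mean slope at
  most \<open>a\<close>, and inside each of these again by disjoint intervals of mean slope at least \<open>b\<close>. By
  monotonicity the inner intervals have total length at most \<open>a / b\<close> times that of the outer ones.\<close>
lemma negligible_two_slopes_mono:
  fixes f :: "real \<Rightarrow> real"
  assumes "mono f" and ab: "0 < a" "a < b"
  shows "negligible (steep_points f (\<lambda>s. s \<le> a) \<inter> steep_points f (\<lambda>s. b \<le> s))"
    (is "negligible ?S")
proof -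
  have c: "0 < a / b" "a / b < 1" using ab by auto
  have bdd: "negligible (?S \<inter> ball 0 R)" (is "negligible ?E") for R
  proof (rule negligible_if_covers_shrink[OF _ c])
    show "bounded ?E" by (meson bounded_ball bounded_subset inf_le2)
    fix U assume U: "open U" "?E \<subseteq> U"
    define K where "K = {i. 0 < snd i \<and> cball (fst i) (snd i) \<subseteq> U
       \<and> f (fst i + snd i) - f (fst i - snd i) \<le> a * (2 * snd i)}"
    have fine: "\<exists>i. i \<in> K \<and> x \<in> cball (fst i) (snd i) \<and> snd i < d"
      if "x \<in> ?E" "0 < d" for x d
    proof -
      have "x \<in> U" using U(2) that by blast
      then obtain d' where d': "d' > 0" "ball x d' \<subseteq> U"
        using open_contains_ball_eq[OF U(1), of x] by auto
      have "0 < min d (d' / 2)" using d' that by auto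
      moreover have "\<forall>d>0. \<exists>c r. 0 < r \<and> r < d \<and> x \<in> cball c r \<and> (f (c + r) - f (c - r)) / (2 * r) \<le> a"
          using that by (simp add: steep_points_def)
        ultimately obtain c r where h: "0 < r" "r < min d (d' / 2)" "x \<in> cball c r" "(f (c + r) - f (c - r)) / (2 * r) \<le> a"
          by meson
      have "cball c r \<subseteq> ball x d'"
      proof
        fix y assume "y \<in> cball c r"
        then have "dist x y \<le> dist c x + dist c y" "dist c y \<le> r"
          by (auto intro: dist_triangle3)
        then show "y \<in> ball x d'" using h by auto
      qed
      then show ?thesis
        using h d' by (intro exI[of _ "(c, r)"]) (auto simp: K_def divide_le_eq)
    qed
    have pos: "0 < snd i" if "i \<in> K" for i using that by (simp add: K_def)
    obtain C where C: "countable C" "C \<subseteq> K"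
      "pairwise (\<lambda>i j. disjnt (cball (fst i) (snd i)) (cball (fst j) (snd j))) C"
      "negligible (?E - (\<Union>i\<in>C. cball (fst i) (snd i)))"
      by (rule Vitali_covering_theorem_cballs[of K snd ?E fst, OF pos fine], assumption, assumption, assumption, rule that)
    define Q where "Q i D \<longleftrightarrow> countable D \<and> (\<Union>j\<in>D. cball (fst j) (snd j)) \<subseteq> ball (fst i) (snd i) \<and>
        negligible (?E \<inter> ball (fst i) (snd i) - (\<Union>j\<in>D. cball (fst j) (snd j))) \<and>
        emeasure lebesgue (\<Union>j\<in>D. cball (fst j) (snd j)) \<le> ennreal (a / b) * emeasure lebesgue (cball (fst i) (snd i))" for i D
    have inner: "\<exists>D. Q i D" if "i \<in> C" for i
    proof -
      define B where "B = ball (fst i) (snd i)"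
      have i: "0 < snd i" "f (fst i + snd i) - f (fst i - snd i) \<le> a * (2 * snd i)"
        using that C by (auto simp: K_def)
      define K' where "K' = {j. 0 < snd j \<and> cball (fst j) (snd j) \<subseteq> B
         \<and> b * (2 * snd j) \<le> f (fst j + snd j) - f (fst j - snd j)}"
      have fine': "\<exists>j. j \<in> K' \<and> x \<in> cball (fst j) (snd j) \<and> snd j < d"
        if "x \<in> ?E \<inter> B" "0 < d" for x d
      proof -
        have "open B" by (simp add: B_def)
        have "x \<in> B" using that by blast
        then obtain d' where d': "d' > 0" "ball x d' \<subseteq> B"
          using open_contains_ball_eq[OF \<open>open B\<close>, of x] by auto
        have "0 < min d (d' / 2)" using d' that by auto
        moreover have "\<forall>d>0. \<exists>c r. 0 < r \<and> r < d \<and> x \<in> cball c r \<and> b \<le> (f (c + r) - f (c - r)) / (2 * r)"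
          using that by (simp add: steep_points_def)
        ultimately obtain c r where h: "0 < r" "r < min d (d' / 2)" "x \<in> cball c r" "b \<le> (f (c + r) - f (c - r)) / (2 * r)"
          by meson
        have "cball c r \<subseteq> ball x d'"
        proof
          fix y assume "y \<in> cball c r"
          then have "dist x y \<le> dist c x + dist c y" "dist c y \<le> r"
            by (auto intro: dist_triangle3)
          then show "y \<in> ball x d'" using h by auto
        qed
        then show ?thesis
          using h d' by (intro exI[of _ "(c, r)"]) (auto simp: K'_def le_divide_eq)
      qed
      have pos': "0 < snd i" if "i \<in> K'" for i using that by (simp add: K'_def)
      obtain D where D: "countable D" "D \<subseteq> K'"
        "pairwise (\<lambda>i j. disjnt (cball (fst i) (snd i)) (cball (fst j) (snd j))) D"
        "negligible (?E \<inter> B - (\<Union>i\<in>D. cball (fst i) (snd i)))"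
        by (rule Vitali_covering_theorem_cballs[of K' snd "?E \<inter> B" fst, OF pos' fine'], assumption, assumption, assumption, rule that)
      have B_sub: "B \<subseteq> {fst i - snd i..fst i + snd i}"
        by (auto simp: B_def dist_real_def)
      have "emeasure lebesgue (\<Union>j\<in>D. cball (fst j) (snd j))
          \<le> ennreal ((f (fst i + snd i) - f (fst i - snd i)) / b)"
        using D i ab B_sub by (intro emeasure_steep_intervals_le[OF \<open>mono f\<close>]) (auto simp: K'_def)
      also have "\<dots> \<le> ennreal (a / b * (2 * snd i))"
        using divide_right_mono[OF i(2), of b] ab by (intro ennreal_leI) simp
      also have "\<dots> = ennreal (a / b) * emeasure lebesgue (cball (fst i) (snd i))"
        using ab i by (subst ennreal_mult) (auto simp: cball_eq_atLeastAtMost)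
      finally show ?thesis
        using D unfolding Q_def B_def by (intro exI[of _ D]) (auto simp: K'_def B_def)
    qed
    obtain D where "\<And>i. i \<in> C \<Longrightarrow> Q i (D i)"
      using inner by metis
    note D = this[unfolded Q_def]
    define X where "X = (\<lambda>i::real \<times> real. cball (fst i) (snd i))"
    define Y where "Y = (\<lambda>i. \<Union>j\<in>D i. cball (fst j) (snd j))"
    \<comment> \<open>Points missed by the coverings; end points of outer intervals are included because the inner
      covering only looks at the open interval.\<close>
    define N where "N = (?E - (\<Union>i\<in>C. X i)) \<union> (\<Union>i\<in>C. sphere (fst i) (snd i))
        \<union> (\<Union>i\<in>C. ?E \<inter> ball (fst i) (snd i) - Y i)"
    have N: "negligible N"
      unfolding N_def
    proof (intro negligible_Un)
      show "negligible (?E - (\<Union>i\<in>C. X i))" using C(4) by (simp add: X_def)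
      show "negligible (\<Union>i\<in>C. sphere (fst i) (snd i))"
        by (intro negligible_countable_Union) (auto simp: C(1) negligible_sphere)
      show "negligible (\<Union>i\<in>C. ?E \<inter> ball (fst i) (snd i) - Y i)"
        by (intro negligible_countable_Union) (use C(1) D in \<open>auto simp: Y_def\<close>)
    qed
    have YX: "Y i \<subseteq> X i" if "i \<in> C" for i
      using D[OF that] ball_subset_cball by (auto simp: X_def Y_def)
    have setsY: "Y i \<in> sets lebesgue" if "i \<in> C" for i
      unfolding Y_def using D[OF that] by (intro sets.countable_UN'') auto
    have emY: "emeasure lebesgue (Y i) \<le> ennreal (a / b) * emeasure lebesgue (X i)" if "i \<in> C" for i
      using D[OF that] by (simp add: X_def Y_def)
    have disX: "disjoint_family_on X C"
      using C(3) by (auto simp: disjoint_family_on_def pairwise_def disjnt_def X_def)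
    then have disY: "disjoint_family_on Y C"
      using YX unfolding disjoint_family_on_def by blast
    define W where "W = N \<union> (\<Union>i\<in>C. Y i)"
    have sets: "(\<Union>i\<in>C. Y i) \<in> sets lebesgue"
      by (intro sets.countable_UN'' C) (auto simp: setsY)
    have "?E \<subseteq> W"
    proof
      fix x assume x: "x \<in> ?E"
      show "x \<in> W"
      proof (cases "x \<in> (\<Union>i\<in>C. X i)")
        case False
        then show ?thesis using x by (auto simp: W_def N_def)
      next
        case True
        then obtain i where i: "i \<in> C" "x \<in> cball (fst i) (snd i)" by (auto simp: X_def)
        then consider "x \<in> sphere (fst i) (snd i)" | "x \<in> ball (fst i) (snd i)"
          by (auto simp: order.order_iff_strict)
        then show ?thesis
          using x i by cases (auto simp: W_def N_def)
      qed
    qed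
    moreover have "W \<in> sets lebesgue"
      using sets N by (auto simp: W_def intro!: sets.Un dest: negligible_imp_sets)
    moreover have "emeasure lebesgue W \<le> ennreal (a / b) * emeasure lebesgue U"
    proof -
      have "emeasure lebesgue W = emeasure lebesgue (\<Union>i\<in>C. Y i)"
        unfolding W_def using N sets by (subst Un_commute, intro emeasure_Un_null_set) (auto simp: negligible_iff_null_sets)
      also have "\<dots> \<le> ennreal (a / b) * emeasure lebesgue (\<Union>i\<in>C. X i)"
        by (rule emeasure_UN_le_scaled[OF C(1) disX disY _ setsY emY]) (auto simp: X_def)
      also have "\<dots> \<le> ennreal (a / b) * emeasure lebesgue U"
        using C U by (intro mult_left_mono emeasure_mono) (auto simp: K_def X_def)
      finally show ?thesis .
    qed
    ultimately show "\<exists>W\<in>sets lebesgue. ?E \<subseteq> W \<and> emeasure lebesgue W \<le> ennreal (a / b) * emeasure lebesgue U"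
      by blast
  qed
  have "?S = (\<Union>k::nat. ?S \<inter> ball 0 (real k))"
    by (auto simp: reals_Archimedean2)
  then show ?thesis
    using bdd by (metis negligible_Union_nat)
qed

text \<open>Adding a steep linear function makes \<open>f\<close> increasing and shifts all slopes by the same amount. Hence
  for rational \<open>a < b\<close> almost no point sees both slopes below \<open>a\<close> and slopes above \<open>b\<close>; at all
  other points the difference quotients, which are bounded, converge.\<close>
lemma lipschitz_differentiable_ae_real:
  fixes f :: "real \<Rightarrow> real"
  assumes lip: "L-lipschitz_on UNIV f"
  shows "negligible {x. \<not> f differentiable (at x)}"
proof -
  have L: "0 \<le> L" "\<And>x y. \<bar>f x - f y\<bar> \<le> L * \<bar>x - y\<bar>"
    using lip by (auto simp: lipschitz_on_def dist_real_def)
  have neg: "negligible (steep_points f (\<lambda>s. s \<le> a) \<inter> steep_points f (\<lambda>s. b \<le> s))" if "a < b" for a b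
  proof -
    \<comment> \<open>Large enough for \<open>f x + k * x\<close> to increase and for \<open>a + k\<close> to be positive.\<close>
    define k where "k = L + \<bar>a\<bar> + 1"
    define g where "g = (\<lambda>x. f x + k * x)"
    have "mono g"
    proof
      fix x y :: real assume "x \<le> y"
      then have "f x - f y \<le> L * (y - x)" using L(2)[of x y] by simp
      also have "\<dots> \<le> k * (y - x)" using \<open>x \<le> y\<close> by (intro mult_right_mono) (auto simp: k_def)
      finally show "g x \<le> g y" by (simp add: g_def algebra_simps)
    qed
    moreover have slope: "(g (c + r) - g (c - r)) / (2 * r) = (f (c + r) - f (c - r)) / (2 * r) + k" if "0 < r" for c r
      using that by (simp add: g_def field_simps)
    have sub: "steep_points f P \<subseteq> steep_points g (\<lambda>s. P (s - k))" for P
      unfolding steep_points_def using slope by fastforce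
    ultimately have "negligible (steep_points g (\<lambda>s. s \<le> a + k) \<inter> steep_points g (\<lambda>s. b + k \<le> s))"
      using L that by (intro negligible_two_slopes_mono) (auto simp: k_def)
    moreover have "steep_points f (\<lambda>s. s \<le> a) \<subseteq> steep_points g (\<lambda>s. s \<le> a + k)"
      using sub[of "\<lambda>s. s \<le> a"] by (simp add: algebra_simps)
    moreover have "steep_points f (\<lambda>s. b \<le> s) \<subseteq> steep_points g (\<lambda>s. b + k \<le> s)"
      using sub[of "\<lambda>s. b \<le> s"] by (simp add: algebra_simps)
    ultimately show ?thesis
      by (meson Int_mono negligible_subset)
  qed
  define N where "N = (\<Union>(a, b)\<in>{(a, b). a \<in> \<rat> \<and> b \<in> \<rat> \<and> a < b}. steep_points f (\<lambda>s. s \<le> a) \<inter> steep_points f (\<lambda>s. b \<le> s))"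
  have "countable {(a::real, b::real). a \<in> \<rat> \<and> b \<in> \<rat> \<and> a < b}"
    by (rule countable_subset[of _ "\<rat> \<times> \<rat>"]) (auto intro: countable_rat)
  then have "negligible N"
    unfolding N_def using neg by (intro negligible_countable_Union) auto
  moreover have "f differentiable (at x)" if "x \<notin> N" for x
  proof -
    define q where "q = (\<lambda>t. (f (x + t) - f x) / t)"
    have qle: "\<bar>q t\<bar> \<le> L" if "t \<noteq> 0" for t
      using L(2)[of "x + t" x] that by (simp add: q_def abs_divide divide_le_eq)
    \<comment> \<open>The interval between \<open>x\<close> and \<open>x + t\<close> in terms of its centre and radius, for either sign of \<open>t\<close>.\<close>
    have iv: "(f (x + t / 2 + \<bar>t\<bar> / 2) - f (x + t / 2 - \<bar>t\<bar> / 2)) / (2 * (\<bar>t\<bar> / 2)) = q t" if "t \<noteq> 0" for t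
    proof (cases "t > 0")
      case True
      then have e: "x + t / 2 + \<bar>t\<bar> / 2 = x + t" "x + t / 2 - \<bar>t\<bar> / 2 = x" by (auto simp: field_simps)
      show ?thesis unfolding e using True by (simp add: q_def)
    next
      case False
      then have e: "x + t / 2 + \<bar>t\<bar> / 2 = x" "x + t / 2 - \<bar>t\<bar> / 2 = x + t" by (auto simp: field_simps)
      show ?thesis unfolding e using False that by (simp add: q_def divide_simps)
    qed
    have in_iv: "x \<in> cball (x + t / 2) (\<bar>t\<bar> / 2)" for t
      by (simp add: dist_real_def)
    have avoid: "\<exists>d>0. \<forall>t. 0 < \<bar>t\<bar> \<and> \<bar>t\<bar> < d \<longrightarrow> \<not> P (q t)" if nx: "x \<notin> steep_points f P" for P
    proof -
      obtain d where d: "d > 0" "\<And>c r. 0 < r \<Longrightarrow> r < d \<Longrightarrow> x \<in> cball c r \<Longrightarrow> \<not> P ((f (c + r) - f (c - r)) / (2 * r))"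
        using nx unfolding steep_points_def mem_Collect_eq by meson
      have "\<not> P (q t)" if "0 < \<bar>t\<bar> \<and> \<bar>t\<bar> < d" for t
        using d(2)[of "\<bar>t\<bar> / 2" "x + t / 2"] iv[of t] in_iv[of t] that by auto
      then show ?thesis using d by blast
    qed
    \<comment> \<open>The supremum of \<open>S\<close> is the lower limit of the difference quotients.\<close>
    define S where "S = {a. \<exists>d>0. \<forall>t. 0 < \<bar>t\<bar> \<and> \<bar>t\<bar> < d \<longrightarrow> a < q t}"
    have "- L - 1 \<in> S"
      unfolding S_def using qle by (auto intro!: exI[of _ 1] simp: abs_le_iff) (smt (verit) qle)
    have bddS: "a \<le> L" if a: "a \<in> S" for a
    proof -
      obtain d where "d > 0" "\<And>t. 0 < \<bar>t\<bar> \<and> \<bar>t\<bar> < d \<Longrightarrow> a < q t" using a by (auto simp: S_def)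
      then have "a < q (d / 2)" by simp
      then show ?thesis using qle[of "d / 2"] \<open>d > 0\<close> by simp
    qed
    define D where "D = Sup S"
    have bdd: "bdd_above S" using bddS by (auto simp: bdd_above_def)
    have "\<exists>d>0. \<forall>t. t \<noteq> 0 \<and> \<bar>t\<bar> < d \<longrightarrow> \<bar>q t - D\<bar> < \<epsilon>" if eps: "\<epsilon> > 0" for \<epsilon>
    proof -
      have "D - \<epsilon> < Sup S" using eps by (simp add: D_def)
      then obtain a where "a \<in> S" "D - \<epsilon> < a"
        using \<open>- L - 1 \<in> S\<close> by (subst (asm) less_cSup_iff) (auto simp: bdd)
      then obtain d1 where d1: "d1 > 0" "\<And>t. 0 < \<bar>t\<bar> \<and> \<bar>t\<bar> < d1 \<Longrightarrow> a < q t" by (auto simp: S_def)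
      obtain a' where a': "a' \<in> \<rat>" "D < a'" "a' < D + \<epsilon>" using Rats_dense_in_real[of D "D + \<epsilon>"] eps by auto
      obtain b' where b': "b' \<in> \<rat>" "a' < b'" "b' < D + \<epsilon>" using Rats_dense_in_real[of a' "D + \<epsilon>"] a' by auto
      have "a' \<notin> S" using cSup_upper[OF _ bdd, of a'] a' by (auto simp: D_def)
      moreover have "x \<notin> steep_points f (\<lambda>s. s \<le> a') \<or> x \<notin> steep_points f (\<lambda>s. b' \<le> s)"
        using \<open>x \<notin> N\<close> a' b' by (auto simp: N_def)
      ultimately have "x \<notin> steep_points f (\<lambda>s. b' \<le> s)"
        using avoid[of "\<lambda>s. s \<le> a'"] by (auto simp: S_def not_le)
      then obtain d2 where d2: "d2 > 0" "\<And>t. 0 < \<bar>t\<bar> \<and> \<bar>t\<bar> < d2 \<Longrightarrow> q t < b'"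
        using avoid[of "\<lambda>s. b' \<le> s"] by (auto simp: not_le)
      have "\<bar>q t - D\<bar> < \<epsilon>" if "t \<noteq> 0 \<and> \<bar>t\<bar> < min d1 d2" for t
        using d1(2)[of t] d2(2)[of t] that b' \<open>D - \<epsilon> < a\<close> by (auto simp: abs_less_iff)
      then show ?thesis using d1 d2 by (intro exI[of _ "min d1 d2"]) auto
    qed
    then have "(q \<longlongrightarrow> D) (at 0)"
      by (auto simp: LIM_def dist_real_def)
    then have "(f has_field_derivative D) (at x)"
      by (simp add: DERIV_def q_def)
    then show ?thesis
      using real_differentiable_def by blast
  qed
  ultimately show ?thesis
    by (elim negligible_subset) blast
qed

section \<open>Rademacher's theorem\<close>

text \<open>The points where the directional derivative of \<open>f\<close> along \<open>e\<close> exists. The Cauchy condition is spelled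
  out with countable operations on closed sets in order to have a Borel set for Tonelli's theorem.\<close>
definition dir_good :: "('a::real_normed_vector \<Rightarrow> real) \<Rightarrow> 'a \<Rightarrow> 'a set" where
  "dir_good f e = (\<Inter>m::nat. \<Union>k::nat. {x. \<forall>s t. 0 < \<bar>s\<bar> \<and> \<bar>s\<bar> < 1 / Suc k \<and> 0 < \<bar>t\<bar> \<and> \<bar>t\<bar> < 1 / Suc k \<longrightarrow>
     \<bar>(f (x + s *\<^sub>R e) - f x) / s - (f (x + t *\<^sub>R e) - f x) / t\<bar> \<le> 1 / Suc m})"

lemma dir_good_iff:
  "x \<in> dir_good f e \<longleftrightarrow> (\<exists>p. ((\<lambda>t. (f (x + t *\<^sub>R e) - f x) / t) \<longlongrightarrow> p) (at 0))"
proof -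
  define q where "q = (\<lambda>t. (f (x + t *\<^sub>R e) - f x) / t)"
  have good: "x \<in> dir_good f e \<longleftrightarrow>
      (\<forall>m. \<exists>k::nat. \<forall>s t. 0 < \<bar>s\<bar> \<and> \<bar>s\<bar> < 1 / Suc k \<and> 0 < \<bar>t\<bar> \<and> \<bar>t\<bar> < 1 / Suc k \<longrightarrow> \<bar>q s - q t\<bar> \<le> 1 / Suc m)"
    by (simp add: dir_good_def q_def)
  show ?thesis
    unfolding q_def[symmetric]
  proof
    assume g: "x \<in> dir_good f e"
    define t where "t = (\<lambda>n. 1 / real (Suc (Suc n)))"
    have small: "0 < \<bar>t n\<bar> \<and> \<bar>t n\<bar> < 1 / Suc k" if "k \<le> n" for n k
      using that by (auto simp: t_def frac_less2)
    have "Cauchy (\<lambda>n. q (t n))"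
    proof (rule metric_CauchyI)
      fix \<epsilon> :: real assume "\<epsilon> > 0"
      then obtain m where m: "1 / real (Suc m) < \<epsilon>" using nat_approx_posE by blast
      obtain k :: nat where k: "\<And>s t. 0 < \<bar>s\<bar> \<and> \<bar>s\<bar> < 1 / Suc k \<and> 0 < \<bar>t\<bar> \<and> \<bar>t\<bar> < 1 / Suc k \<Longrightarrow> \<bar>q s - q t\<bar> \<le> 1 / Suc m"
        using g good by blast
      show "\<exists>M. \<forall>i\<ge>M. \<forall>j\<ge>M. dist (q (t i)) (q (t j)) < \<epsilon>"
      proof (intro exI[of _ k] allI impI)
        fix i j assume "k \<le> i" "k \<le> j"
        then have "\<bar>q (t i) - q (t j)\<bar> \<le> 1 / Suc m" by (intro k) (use small in blast)
        then show "dist (q (t i)) (q (t j)) < \<epsilon>" using m by (simp add: dist_real_def)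
      qed
    qed
    then obtain p where p: "(\<lambda>n. q (t n)) \<longlonglongrightarrow> p" using Cauchy_convergent_iff convergent_def by blast
    have "(q \<longlongrightarrow> p) (at 0)"
      unfolding LIM_def
    proof (intro allI impI)
      fix \<epsilon> :: real assume "\<epsilon> > 0"
      then obtain m where m: "1 / real (Suc m) < \<epsilon>" using nat_approx_posE by blast
      obtain k :: nat where k: "\<And>s t. 0 < \<bar>s\<bar> \<and> \<bar>s\<bar> < 1 / Suc k \<and> 0 < \<bar>t\<bar> \<and> \<bar>t\<bar> < 1 / Suc k \<Longrightarrow> \<bar>q s - q t\<bar> \<le> 1 / Suc m"
        using g good by blast
      have "dist (q s) p < \<epsilon>" if "s \<noteq> 0" "dist s 0 < 1 / Suc k" for s
      proof -
        have "(\<lambda>n. \<bar>q s - q (t n)\<bar>) \<longlonglongrightarrow> \<bar>q s - p\<bar>" by (intro tendsto_intros p)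
        moreover have "\<forall>\<^sub>F n in sequentially. \<bar>q s - q (t n)\<bar> \<le> 1 / Suc m"
        proof (rule eventually_sequentiallyI[of k])
          fix n assume "k \<le> n"
          then show "\<bar>q s - q (t n)\<bar> \<le> 1 / Suc m"
            using small[of k n] that by (intro k) (auto simp: dist_real_def)
        qed
        ultimately have "\<bar>q s - p\<bar> \<le> 1 / Suc m" by (rule tendsto_upperbound) simp
        then show ?thesis using m by (simp add: dist_real_def)
      qed
      then show "\<exists>d>0. \<forall>s. s \<noteq> 0 \<and> dist s 0 < d \<longrightarrow> dist (q s) p < \<epsilon>"
        by (intro exI[of _ "1 / Suc k"]) auto
    qed
    then show "\<exists>p. (q \<longlongrightarrow> p) (at 0)" by blast
  next
    assume "\<exists>p. (q \<longlongrightarrow> p) (at 0)"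
    then obtain p where p: "(q \<longlongrightarrow> p) (at 0)" by blast
    show "x \<in> dir_good f e"
      unfolding good
    proof
      fix m :: nat
      have "0 < 1 / (2 * real (Suc m))" by simp
      then obtain d where d: "d > 0" "\<And>s. s \<noteq> 0 \<Longrightarrow> dist s 0 < d \<Longrightarrow> dist (q s) p < 1 / (2 * real (Suc m))"
        using p unfolding LIM_def by blast
      obtain k where k: "1 / real (Suc k) < d" using nat_approx_posE[OF d(1)] by blast
      have "\<bar>q s - q t\<bar> \<le> 1 / Suc m" if "0 < \<bar>s\<bar> \<and> \<bar>s\<bar> < 1 / Suc k \<and> 0 < \<bar>t\<bar> \<and> \<bar>t\<bar> < 1 / Suc k" for s t
      proof -
        define A where "A = 1 / (2 * real (Suc m))"
        have "\<bar>q s - p\<bar> < A" "\<bar>q t - p\<bar> < A"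
          using d(2)[of s] d(2)[of t] that k by (auto simp: dist_real_def A_def)
        moreover have "1 / real (Suc m) = A + A" by (simp add: A_def field_simps)
        ultimately show ?thesis by linarith
      qed
      then show "\<exists>k::nat. \<forall>s t. 0 < \<bar>s\<bar> \<and> \<bar>s\<bar> < 1 / Suc k \<and> 0 < \<bar>t\<bar> \<and> \<bar>t\<bar> < 1 / Suc k \<longrightarrow> \<bar>q s - q t\<bar> \<le> 1 / Suc m"
        by blast
    qed
  qed
qed

lemma borel_dir_good:
  assumes "continuous_on UNIV f"
  shows "dir_good f e \<in> sets borel"
proof -
  have f: "continuous_on UNIV (\<lambda>x. f (x + c))" for c
    by (rule continuous_on_compose2[OF assms]) (auto intro: continuous_intros)
  have cl: "closed {x. \<bar>(f (x + s *\<^sub>R e) - f x) / s - (f (x + t *\<^sub>R e) - f x) / t\<bar> \<le> 1 / Suc m}" for s t :: real and m :: nat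
    unfolding divide_inverse by (intro closed_Collect_le continuous_intros f assms)
  have "closed {x. \<forall>s t. 0 < \<bar>s\<bar> \<and> \<bar>s\<bar> < 1 / Suc k \<and> 0 < \<bar>t\<bar> \<and> \<bar>t\<bar> < 1 / Suc k \<longrightarrow>
     \<bar>(f (x + s *\<^sub>R e) - f x) / s - (f (x + t *\<^sub>R e) - f x) / t\<bar> \<le> 1 / Suc m}" for k m :: nat
    by (intro closed_Collect_all closed_Collect_imp open_Collect_const cl)
  then show ?thesis
    unfolding dir_good_def by (intro sets.countable_INT'' sets.countable_UN'') auto
qed

text \<open>On each line parallel to \<open>e\<close> almost every point is good. By Tonelli's theorem there is one \<open>t\<close>
  such that \<open>x + t *\<^sub>R e\<close> is good for almost every \<open>x\<close>, and Lebesgue measure is invariant under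
  translation by \<open>t *\<^sub>R e\<close>.\<close>
lemma negligible_not_dir_good:
  fixes f :: "'a::euclidean_space \<Rightarrow> real"
  assumes lip: "L-lipschitz_on UNIV f"
  shows "negligible (- dir_good f e)"
proof -
  have cont: "continuous_on UNIV f" using lip by (rule lipschitz_on_continuous_on)
  have meas: "{z \<in> space (lborel \<Otimes>\<^sub>M lborel). fst z + snd z *\<^sub>R e \<in> dir_good f e} \<in> sets (lborel \<Otimes>\<^sub>M lborel)"
  proof -
    have "(\<lambda>z::'a \<times> real. fst z + snd z *\<^sub>R e) \<in> borel_measurable borel"
      by (intro borel_measurable_continuous_onI continuous_intros)
    from measurable_sets[OF this borel_dir_good[OF cont, of e]] show ?thesis
      unfolding lborel_prod by (simp add: vimage_def)
  qed
  have "AE t in lborel. x + t *\<^sub>R e \<in> dir_good f e" for x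
  proof -
    define h where "h = (\<lambda>t. f (x + t *\<^sub>R e))"
    have "(L * norm e)-lipschitz_on UNIV h"
    proof (rule lipschitz_onI)
      fix s t :: real
      have "dist (h s) (h t) \<le> L * dist (x + s *\<^sub>R e) (x + t *\<^sub>R e)"
        unfolding h_def by (rule lipschitz_onD[OF lip]) auto
      also have "dist (x + s *\<^sub>R e) (x + t *\<^sub>R e) = norm e * dist s t"
        by (simp add: dist_norm scaleR_left_diff_distrib[symmetric])
      finally show "dist (h s) (h t) \<le> L * norm e * dist s t" by (simp add: mult.assoc)
    qed (use lip in \<open>auto simp: lipschitz_on_def\<close>)
    then have "negligible {t. \<not> h differentiable (at t)}" by (rule lipschitz_differentiable_ae_real)
    then have "AE t in lebesgue. h differentiable (at t)"
      by (auto simp: negligible_iff_null_sets intro!: AE_I')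
    then have "AE t in lborel. h differentiable (at t)"
      by (simp add: AE_completion_iff)
    then show ?thesis
    proof eventually_elim
      case (elim t)
      then obtain p where "(h has_field_derivative p) (at t)" using real_differentiable_def by blast
      then have "((\<lambda>s. (f ((x + t *\<^sub>R e) + s *\<^sub>R e) - f (x + t *\<^sub>R e)) / s) \<longlongrightarrow> p) (at 0)"
        by (simp add: DERIV_def h_def scaleR_left_distrib add.assoc)
      then show ?case unfolding dir_good_iff by blast
    qed
  qed
  then have "AE x in lborel. AE t in (lborel :: real measure). x + t *\<^sub>R e \<in> dir_good f e" by simp
  then have "AE t in (lborel :: real measure). AE x in lborel. x + t *\<^sub>R e \<in> dir_good f e"
    by (subst (asm) lborel_pair.AE_commute[OF meas])
  moreover have "ae_filter (lborel :: real measure) \<noteq> bot"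
    by (simp add: ae_filter_eq_bot_iff)
  ultimately obtain t :: real where "AE x in lborel. x + t *\<^sub>R e \<in> dir_good f e"
    using eventually_happens'[of "ae_filter (lborel :: real measure)"] by blast
  then have "AE x in distr lborel borel ((+) (t *\<^sub>R e)). x \<in> dir_good f e"
    using borel_dir_good[OF cont] by (subst AE_distr_iff) (auto simp: add.commute)
  then have "AE x in lborel. x \<in> dir_good f e"
    unfolding lborel_distr_plus .
  then have "AE x in lebesgue. x \<in> dir_good f e"
    by (rule AE_completion)
  then show ?thesis
    using borel_dir_good[OF cont] by (auto simp: negligible_iff_null_sets AE_iff_null_sets Compl_eq)
qed

text \<open>The partial derivatives are close to the components of \<open>y\<close>, with an error \<open>\<epsilon>\<close> and a scale \<open>d\<close> that
  are the same for all points of the set. Countably many such sets contain every point that has all partial derivatives.\<close>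
definition fits :: "('a::euclidean_space \<Rightarrow> real) \<Rightarrow> real \<Rightarrow> real \<Rightarrow> 'a \<Rightarrow> 'a set" where
  "fits f \<epsilon> d y = {x. \<forall>b\<in>Basis. \<forall>t. \<bar>t\<bar> < d \<longrightarrow> \<bar>f (x + t *\<^sub>R b) - f x - t * (y \<bullet> b)\<bar> \<le> \<epsilon> * \<bar>t\<bar>}"

text \<open>The increment from \<open>x\<close> to \<open>x + h\<close> is a sum of increments along coordinate axes, starting at points
  \<open>x + hh S\<close> where no partial derivative is controlled. Since \<open>x\<close> is not a porous point, a point
  \<open>a\<close> of the set lies within \<open>\<eta> * norm (hh S)\<close> of each of them, and replacing the starting point by
  \<open>a\<close> costs at most \<open>2 * L\<close> times that distance.\<close>
lemma fits_not_porous_imp_linear_approx: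
  fixes f :: "'a::euclidean_space \<Rightarrow> real" and L \<epsilon> \<eta> d :: real
  assumes lip: "L-lipschitz_on UNIV f" and "x \<in> fits f \<epsilon> d y" "x \<notin> porous_part \<eta> (fits f \<epsilon> d y)"
    and "0 < \<eta>" "0 < d" "0 \<le> \<epsilon>"
  shows "\<exists>r>0. \<forall>h. norm h < r \<longrightarrow> \<bar>f (x + h) - f x - y \<bullet> h\<bar> \<le> real DIM('a) * (\<epsilon> + 2 * L * \<eta> * real DIM('a)) * norm h"
proof -
  define n where "n = real DIM('a)"
  have "n \<ge> 1" using DIM_ge_Suc0[where 'a='a] by (simp add: n_def)
  have L: "0 \<le> L" "\<And>x y. \<bar>f x - f y\<bar> \<le> L * norm (x - y)"
    using lip by (auto simp: lipschitz_on_def dist_real_def dist_norm)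
  obtain d0 where d0: "d0 > 0" "\<And>h. 0 < norm h \<Longrightarrow> norm h < d0 \<Longrightarrow> ball (x + h) (\<eta> * norm h) \<inter> fits f \<epsilon> d y \<noteq> {}"
    using assms(2,3) unfolding porous_part_def by blast
  define r where "r = min d (d0 / n)"
  have "r > 0" using \<open>d > 0\<close> d0 \<open>n \<ge> 1\<close> by (simp add: r_def)
  moreover have "\<bar>f (x + h) - f x - y \<bullet> h\<bar> \<le> n * (\<epsilon> + 2 * L * \<eta> * n) * norm h" if h: "norm h < r" for h
  proof -
    have aux: "\<bar>V\<bar> \<le> c + e" if "\<bar>A\<bar> \<le> k" "\<bar>B\<bar> \<le> l" "\<bar>C\<bar> \<le> l" "\<bar>D\<bar> \<le> c" "e = k + 2 * l" "V = A - B + C + D"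
      for A B C D V c e k l :: real
      using that by linarith
    define hh where "hh = (\<lambda>S. \<Sum>b\<in>S. (h \<bullet> b) *\<^sub>R b)"
    have norm_hh: "norm (hh S) \<le> n * norm h" if "S \<subseteq> Basis" for S
    proof -
      have "norm (hh S) \<le> (\<Sum>b\<in>S. norm h)"
        unfolding hh_def using that by (intro sum_norm_le) (auto simp: Basis_le_norm)
      also have "\<dots> = card S * norm h" by simp
      also have "\<dots> \<le> n * norm h"
        using that by (intro mult_right_mono) (auto simp: n_def card_mono)
      finally show ?thesis .
    qed
    define E where "E = (\<epsilon> + 2 * L * \<eta> * n) * norm h"
    have claim: "\<bar>f (x + hh S) - f x - y \<bullet> hh S\<bar> \<le> card S * E" if "finite S" "S \<subseteq> Basis" for S
      using that
    proof (induction S rule: finite_induct)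
      case empty
      then show ?case by (simp add: hh_def)
    next
      case (insert b S)
      define t where "t = h \<bullet> b"
      have b: "b \<in> Basis" "S \<subseteq> Basis" using insert by auto
      have t: "\<bar>t\<bar> \<le> norm h" using Basis_le_norm[OF b(1), of h] by (simp add: t_def)
      have hh: "hh (insert b S) = hh S + t *\<^sub>R b" using insert by (simp add: hh_def t_def)
      have "\<exists>a\<in>fits f \<epsilon> d y. norm (x + hh S - a) \<le> \<eta> * (n * norm h)"
      proof (cases "hh S = 0")
        case True
        then show ?thesis using assms \<open>n \<ge> 1\<close> by (intro bexI[of _ x]) auto
      next
        case False
        have "norm (hh S) < d0"
        proof -
          have "n * norm h < n * (d0 / n)" using h \<open>n \<ge> 1\<close> by (intro mult_strict_left_mono) (auto simp: r_def)
          then show ?thesis using norm_hh[OF b(2)] \<open>n \<ge> 1\<close> by simp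
        qed
        then have "ball (x + hh S) (\<eta> * norm (hh S)) \<inter> fits f \<epsilon> d y \<noteq> {}"
          using d0(2)[of "hh S"] False by simp
        then obtain a where "a \<in> fits f \<epsilon> d y" "dist (x + hh S) a < \<eta> * norm (hh S)"
          by (auto simp: disjoint_iff)
        moreover have "\<eta> * norm (hh S) \<le> \<eta> * (n * norm h)"
          using norm_hh[OF b(2)] \<open>0 < \<eta>\<close> by (intro mult_left_mono) auto
        ultimately show ?thesis by (intro bexI[of _ a]) (auto simp: dist_norm)
      qed
      then obtain a where a: "a \<in> fits f \<epsilon> d y" "norm (x + hh S - a) \<le> \<eta> * (n * norm h)" by blast
      have "\<bar>f (a + t *\<^sub>R b) - f a - t * (y \<bullet> b)\<bar> \<le> \<epsilon> * \<bar>t\<bar>"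
        using a b t h by (auto simp: fits_def r_def)
      also have "\<dots> \<le> \<epsilon> * norm h" using t \<open>0 \<le> \<epsilon>\<close> by (intro mult_left_mono)
      finally have 1: "\<bar>f (a + t *\<^sub>R b) - f a - t * (y \<bullet> b)\<bar> \<le> \<epsilon> * norm h" .
      have La: "L * norm (x + hh S - a) \<le> L * (\<eta> * (n * norm h))"
        using a L by (intro mult_left_mono) auto
      have 2: "\<bar>f (x + hh S) - f a\<bar> \<le> L * (\<eta> * (n * norm h))"
        using L(2)[of "x + hh S" a] La by linarith
      have 3: "\<bar>f (x + hh S + t *\<^sub>R b) - f (a + t *\<^sub>R b)\<bar> \<le> L * (\<eta> * (n * norm h))"
        using L(2)[of "x + hh S + t *\<^sub>R b" "a + t *\<^sub>R b"] La by (simp add: algebra_simps)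
      have IH: "\<bar>f (x + hh S) - f x - y \<bullet> hh S\<bar> \<le> card S * E" using insert b by auto
      have E: "E = \<epsilon> * norm h + 2 * (L * (\<eta> * (n * norm h)))" by (simp add: E_def algebra_simps)
      have "real (card (insert b S)) * E = card S * E + E" using insert by (simp add: algebra_simps)
      moreover have "y \<bullet> hh (insert b S) = y \<bullet> hh S + t * (y \<bullet> b)" by (simp add: hh inner_right_distrib)
      moreover have "x + hh (insert b S) = x + hh S + t *\<^sub>R b" by (simp add: hh add.assoc)
      moreover have "\<bar>f (x + hh S + t *\<^sub>R b) - f x - (y \<bullet> hh S + t * (y \<bullet> b))\<bar> \<le> card S * E + E"
        by (rule aux[OF 1 2 3 IH E]) simp
      ultimately show ?case by (simp only:)
    qed
    have "hh Basis = h" by (simp add: hh_def euclidean_representation)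
    then show ?thesis using claim[of Basis] by (simp add: n_def E_def mult.assoc)
  qed
  ultimately show ?thesis unfolding n_def by blast
qed

text \<open>The argument of Nekvinda and Zajicek: almost every point has all partial derivatives and is not a
  porous point of any of the countably many sets \<open>fits f (\<epsilon> m) (1 / Suc k) y\<close> with \<open>y\<close> in a dense
  set. At such a point the partial derivatives give a total derivative, since the error of the linear
  approximation is a constant multiple of \<open>\<epsilon> m\<close> for every \<open>m\<close>.\<close>
lemma rademacher_real:
  fixes f :: "'a::euclidean_space \<Rightarrow> real"
  assumes lip: "L-lipschitz_on UNIV f"
  shows "negligible {x. \<not> f differentiable (at x)}"
proof -
  have "0 \<le> L" using lip by (auto simp: lipschitz_on_def)
  obtain Q :: "'a set" where Q: "countable Q" "\<And>X. open X \<Longrightarrow> X \<noteq> {} \<Longrightarrow> \<exists>d\<in>Q. d \<in> X"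
    using countable_dense_exists by blast
  \<comment> \<open>Used both as the error and as the porosity constant, which has to be less than one.\<close>
  define \<epsilon> where "\<epsilon> = (\<lambda>m::nat. 1 / real (Suc (Suc m)))"
  have \<epsilon>: "0 < \<epsilon> m" "\<epsilon> m < 1" for m by (auto simp: \<epsilon>_def)
  define N where "N = (\<Union>b\<in>Basis. - dir_good f b) \<union>
     (\<Union>m. \<Union>k::nat. \<Union>y\<in>Q. porous_part (\<epsilon> m) (fits f (\<epsilon> m) (1 / Suc k) y))"
  have "negligible N"
    unfolding N_def
  proof (intro negligible_Un)
    show "negligible (\<Union>b\<in>Basis. - dir_good f b)"
      by (intro negligible_countable_Union) (auto intro: negligible_not_dir_good[OF lip] countable_finite)
    have neg: "negligible (\<Union>y\<in>Q. porous_part (\<epsilon> m) (fits f (\<epsilon> m) (1 / Suc k) y))" for m k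
      using Q(1) \<epsilon> by (intro negligible_countable_Union) (auto intro: negligible_porous_part)
    show "negligible (\<Union>m. \<Union>k::nat. \<Union>y\<in>Q. porous_part (\<epsilon> m) (fits f (\<epsilon> m) (1 / Suc k) y))"
      by (intro negligible_Union_nat neg)
  qed
  moreover have "f differentiable (at x)" if "x \<notin> N" for x
  proof -
    have "\<forall>b\<in>Basis. \<exists>p. ((\<lambda>t. (f (x + t *\<^sub>R b) - f x) / t) \<longlongrightarrow> p) (at 0)"
      using that unfolding dir_good_iff[symmetric] by (simp add: N_def)
    then obtain p where p: "\<And>b. b \<in> Basis \<Longrightarrow> ((\<lambda>t. (f (x + t *\<^sub>R b) - f x) / t) \<longlongrightarrow> p b) (at 0)"
      unfolding bchoice_iff by blast
    define P where "P = (\<Sum>b\<in>Basis. p b *\<^sub>R b)"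
    have P: "P \<bullet> b = p b" if "b \<in> Basis" for b
      using that by (simp add: P_def)
    define n where "n = real DIM('a)"
    define K where "K = n * (1 + 2 * L * n) + 1"
    have "n \<ge> 0" by (simp add: n_def)
    then have "K > 0" using \<open>0 \<le> L\<close> by (simp add: K_def add_nonneg_pos)
    have approx: "\<exists>r>0. \<forall>h. norm h < r \<longrightarrow> \<bar>f (x + h) - f x - P \<bullet> h\<bar> \<le> K * \<epsilon> m * norm h" for m
    proof -
      have "\<forall>\<^sub>F t in at 0. \<forall>b\<in>Basis. dist ((f (x + t *\<^sub>R b) - f x) / t) (p b) < \<epsilon> m / 2"
        using \<epsilon>[of m] by (intro eventually_ball_finite ballI tendstoD[OF p]) auto
      then obtain d where d: "d > 0"
        "\<And>t b. t \<noteq> 0 \<Longrightarrow> dist t 0 < d \<Longrightarrow> b \<in> Basis \<Longrightarrow> dist ((f (x + t *\<^sub>R b) - f x) / t) (p b) < \<epsilon> m / 2"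
        unfolding eventually_at by blast
      obtain k where k: "1 / real (Suc k) < d" using nat_approx_posE[OF d(1)] by blast
      obtain y where y: "y \<in> Q" "norm (y - P) < \<epsilon> m / 2"
        using Q(2)[of "ball P (\<epsilon> m / 2)"] \<epsilon>[of m] by (auto simp: dist_norm norm_minus_commute)
      have fit: "x \<in> fits f (\<epsilon> m) (1 / Suc k) y"
        unfolding fits_def
      proof (intro CollectI ballI allI impI)
        fix b :: 'a and t :: real assume b: "b \<in> Basis" and t: "\<bar>t\<bar> < 1 / Suc k"
        show "\<bar>f (x + t *\<^sub>R b) - f x - t * (y \<bullet> b)\<bar> \<le> \<epsilon> m * \<bar>t\<bar>"
        proof (cases "t = 0")
          case False
          have "\<bar>(f (x + t *\<^sub>R b) - f x) / t - p b\<bar> < \<epsilon> m / 2"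
            using d(2)[OF False _ b] t k by (simp add: dist_real_def)
          moreover have "\<bar>p b - y \<bullet> b\<bar> < \<epsilon> m / 2"
            using Basis_le_norm[OF b, of "y - P"] y P[OF b] by (simp add: inner_diff_left abs_minus_commute)
          ultimately have "\<bar>(f (x + t *\<^sub>R b) - f x) / t - y \<bullet> b\<bar> \<le> \<epsilon> m" by linarith
          moreover have "f (x + t *\<^sub>R b) - f x - t * (y \<bullet> b) = t * ((f (x + t *\<^sub>R b) - f x) / t - y \<bullet> b)"
            using False by (simp add: field_simps)
          ultimately show ?thesis
            by (simp add: abs_mult mult.commute mult_left_mono)
        qed simp
      qed
      moreover have "x \<notin> porous_part (\<epsilon> m) (fits f (\<epsilon> m) (1 / Suc k) y)"
        using that y by (auto simp: N_def)
      ultimately obtain r where r: "r > 0"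
        "\<And>h. norm h < r \<Longrightarrow> \<bar>f (x + h) - f x - y \<bullet> h\<bar> \<le> n * (\<epsilon> m + 2 * L * \<epsilon> m * n) * norm h"
        using fits_not_porous_imp_linear_approx[OF lip, of x "\<epsilon> m" "1 / Suc k" y "\<epsilon> m"] \<epsilon>[of m] unfolding n_def by auto
      have "\<bar>f (x + h) - f x - P \<bullet> h\<bar> \<le> K * \<epsilon> m * norm h" if "norm h < r" for h
      proof -
        have "\<bar>(y - P) \<bullet> h\<bar> \<le> norm (y - P) * norm h" by (rule Cauchy_Schwarz_ineq2)
        also have "\<dots> \<le> \<epsilon> m * norm h" using y \<epsilon>[of m] by (intro mult_right_mono) auto
        finally have "\<bar>y \<bullet> h - P \<bullet> h\<bar> \<le> \<epsilon> m * norm h" by (simp add: inner_diff_left)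
        moreover have "K * \<epsilon> m * norm h = n * (\<epsilon> m + 2 * L * \<epsilon> m * n) * norm h + \<epsilon> m * norm h"
          by (simp add: K_def algebra_simps)
        ultimately show ?thesis using r(2)[OF that] by linarith
      qed
      then show ?thesis using r by blast
    qed
    have "(f has_derivative (\<lambda>h. P \<bullet> h)) (at x)"
      unfolding has_derivative_at_alt
    proof (intro conjI allI impI)
      show "bounded_linear (\<lambda>h. P \<bullet> h)" by (rule bounded_linear_inner_right)
      fix e :: real assume "e > 0"
      then have "0 < e / K" using \<open>K > 0\<close> by simp
      then obtain m where m: "1 / real (Suc m) < e / K" using nat_approx_posE by blast
      have "\<epsilon> m \<le> 1 / real (Suc m)" by (simp add: \<epsilon>_def frac_le)
      then have "\<epsilon> m \<le> e / K" using m by linarith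
      then have "K * \<epsilon> m \<le> e" using \<open>K > 0\<close> by (simp add: pos_le_divide_eq mult.commute)
      obtain r where r: "r > 0" "\<And>h. norm h < r \<Longrightarrow> \<bar>f (x + h) - f x - P \<bullet> h\<bar> \<le> K * \<epsilon> m * norm h"
        using approx by blast
      have "norm (f y - f x - P \<bullet> (y - x)) \<le> e * norm (y - x)" if "norm (y - x) < r" for y
        using r(2)[OF that] mult_right_mono[OF \<open>K * \<epsilon> m \<le> e\<close>, of "norm (y - x)"] by simp
      then show "\<exists>d>0. \<forall>y. norm (y - x) < d \<longrightarrow> norm (f y - f x - P \<bullet> (y - x)) \<le> e * norm (y - x)"
        using r by blast
    qed
    then show ?thesis unfolding differentiable_def by blast
  qed
  ultimately show ?thesis
    by (elim negligible_subset) blast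
qed

theorem rademacher:
  fixes f :: "'a::euclidean_space \<Rightarrow> 'b::euclidean_space"
  assumes lip: "L-lipschitz_on UNIV f"
  shows "negligible {x. \<not> f differentiable (at x)}"
proof -
  have L: "0 \<le> L" using lip by (auto simp: lipschitz_on_def)
  have "negligible {x. \<not> (\<lambda>x. f x \<bullet> b) differentiable (at x)}" if "b \<in> Basis" for b
  proof (rule rademacher_real)
    show "L-lipschitz_on UNIV (\<lambda>x. f x \<bullet> b)"
    proof (rule lipschitz_onI[OF _ L])
      fix x y
      have "dist (f x \<bullet> b) (f y \<bullet> b) \<le> dist (f x) (f y)"
        using Basis_le_norm[OF that, of "f x - f y"] by (simp add: dist_norm inner_diff_left)
      also have "\<dots> \<le> L * dist x y" using lip by (auto simp: lipschitz_on_def)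
      finally show "dist (f x \<bullet> b) (f y \<bullet> b) \<le> L * dist x y" .
    qed
  qed
  then have "negligible (\<Union>b\<in>Basis. {x. \<not> (\<lambda>x. f x \<bullet> b) differentiable (at x)})"
    by (intro negligible_countable_Union) (auto intro: countable_finite)
  then show ?thesis
    by (rule negligible_subset) (auto simp: differentiable_componentwise_within[of f])
qed

section \<open>Upper semicontinuous functions\<close>

lemma usc_onD:
  assumes "usc_on S f" "x \<in> S" "f x < a"
  shows "\<exists>U. open U \<and> x \<in> U \<and> (\<forall>y\<in>S \<inter> U. f y < a)"
proof -
  have "eventually (\<lambda>y. f y < a) (at x within S)"
    using assms unfolding usc_on_def by blast
  then obtain U where "open U" "x \<in> U" "\<And>y. y \<in> U \<Longrightarrow> y \<noteq> x \<Longrightarrow> y \<in> S \<Longrightarrow> f y < a"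
    unfolding eventually_at_topological by blast
  then show ?thesis using assms(3) by (intro exI[of _ U]) auto
qed

lemma usc_on_attains_max:
  assumes S: "compact S" "S \<noteq> {}" and f: "usc_on S f"
  shows "\<exists>x\<in>S. \<forall>y\<in>S. f y \<le> f x"
proof (rule ccontr)
  assume "\<not> (\<exists>x\<in>S. \<forall>y\<in>S. f y \<le> f x)"
  then have "\<forall>x\<in>S. \<exists>y\<in>S. f x < f y" by (auto simp: not_le)
  then obtain Y where Y: "\<And>x. x \<in> S \<Longrightarrow> Y x \<in> S" "\<And>x. x \<in> S \<Longrightarrow> f x < f (Y x)"
    by metis
  then have "\<forall>x\<in>S. \<exists>U. open U \<and> x \<in> U \<and> (\<forall>y\<in>S \<inter> U. f y < f (Y x))"
    using usc_onD[OF f] by blast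
  then obtain U where U: "\<And>x. x \<in> S \<Longrightarrow> open (U x)" "\<And>x. x \<in> S \<Longrightarrow> x \<in> U x"
      "\<And>x y. x \<in> S \<Longrightarrow> y \<in> S \<Longrightarrow> y \<in> U x \<Longrightarrow> f y < f (Y x)"
    unfolding bchoice_iff by blast
  obtain D where D: "D \<subseteq> S" "finite D" "S \<subseteq> (\<Union>x\<in>D. U x)"
    by (rule compactE_image[OF S(1), of S U]) (use U in auto)
  have "D \<noteq> {}" using D S by auto
  then have "Max ((\<lambda>x. f (Y x)) ` D) \<in> (\<lambda>x. f (Y x)) ` D" using D by (intro Max_in) auto
  then obtain x where x: "x \<in> D" "\<And>x'. x' \<in> D \<Longrightarrow> f (Y x') \<le> f (Y x)"
    using D by (auto simp: image_iff) (metis Max_ge finite_imageI imageI)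
  have "Y x \<in> S" using Y D x by blast
  then obtain x' where "x' \<in> D" "Y x \<in> U x'" using D by blast
  then have "f (Y x) < f (Y x')" using U(3)[of x' "Y x"] D \<open>Y x \<in> S\<close> by blast
  then show False using x(2)[OF \<open>x' \<in> D\<close>] by simp
qed

lemma usc_on_add:
  assumes f: "usc_on S f" and g: "usc_on S g"
  shows "usc_on S (\<lambda>x. f x + g x)"
  unfolding usc_on_def
proof (intro ballI allI impI)
  fix x a assume x: "x \<in> S" and a: "f x + g x < a"
  define e where "e = (a - (f x + g x)) / 2"
  have "e > 0" using a by (simp add: e_def)
  have "eventually (\<lambda>y. f y < f x + e) (at x within S)" "eventually (\<lambda>y. g y < g x + e) (at x within S)"
    using f g x \<open>e > 0\<close> unfolding usc_on_def by simp_all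
  then show "eventually (\<lambda>y. f y + g y < a) (at x within S)"
    by eventually_elim (simp add: e_def field_simps)
qed

lemma usc_on_add_continuous:
  assumes f: "usc_on S f" and g: "continuous_on S g"
  shows "usc_on S (\<lambda>x. f x + g x)"
proof (rule usc_on_add[OF f])
  show "usc_on S g"
    using g unfolding usc_on_def continuous_on_def by (blast intro: order_tendstoD(2))
qed

lemma usc_on_uminus_lsc: "lsc_on S f \<Longrightarrow> usc_on S (\<lambda>x. - f x)"
  unfolding usc_on_def lsc_on_def
proof (intro ballI allI impI)
  fix x b assume lsc: "\<forall>x\<in>S. \<forall>a<f x. \<forall>\<^sub>F y in at x within S. a < f y" and "x \<in> S" "- f x < b"
  then have "eventually (\<lambda>y. - b < f y) (at x within S)" by simp
  then show "eventually (\<lambda>y. - f y < b) (at x within S)" by eventually_elim simp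
qed

lemma usc_on_compose:
  assumes f: "usc_on S f" and g: "continuous_on T g" "g ` T \<subseteq> S"
  shows "usc_on T (\<lambda>x. f (g x))"
  unfolding usc_on_def
proof (intro ballI allI impI)
  fix x a assume x: "x \<in> T" and "f (g x) < a"
  have "g x \<in> S" using x g(2) by blast
  obtain U where U: "open U" "g x \<in> U" "\<forall>y\<in>S \<inter> U. f y < a"
    using usc_onD[OF f \<open>g x \<in> S\<close> \<open>f (g x) < a\<close>] by blast
  have "eventually (\<lambda>y. g y \<in> U) (at x within T)"
    using g(1) x U(1,2) unfolding continuous_on_def by (blast intro: topological_tendstoD)
  moreover have "eventually (\<lambda>y. y \<in> T) (at x within T)" by (auto simp: eventually_at_filter)
  ultimately show "eventually (\<lambda>y. f (g y) < a) (at x within T)"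
    by eventually_elim (use U(3) g(2) in blast)
qed

text \<open>The form in which semicontinuity passes to the limit in an inequality.\<close>
lemma usc_on_tendsto_le:
  assumes usc: "usc_on S f" and x: "x \<in> S" and lim: "(y \<longlongrightarrow> x) G" and ev: "eventually (\<lambda>k. y k \<in> S \<and> a \<le> f (y k)) G"
    and nb: "G \<noteq> bot"
  shows "a \<le> f x"
proof (rule ccontr)
  assume "\<not> a \<le> f x"
  then obtain U where U: "open U" "x \<in> U" "\<forall>z\<in>S \<inter> U. f z < a"
    using usc_onD[OF usc x, of a] by auto
  have "eventually (\<lambda>k. y k \<in> U) G" using topological_tendstoD[OF lim U(1,2)] .
  with ev have "eventually (\<lambda>k. False) G"
    by eventually_elim (use U(3) in force)
  then show False using nb by (simp add: eventually_False)
qed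

lemma lsc_on_tendsto_ge:
  assumes lsc: "lsc_on S f" and x: "x \<in> S" and lim: "(y \<longlongrightarrow> x) G" and ev: "eventually (\<lambda>k. y k \<in> S \<and> f (y k) \<le> a) G"
    and nb: "G \<noteq> bot"
  shows "f x \<le> a"
  using usc_on_tendsto_le[OF usc_on_uminus_lsc[OF lsc] x lim, of "- a"] ev nb by simp

lemma usc_on_subset: "usc_on S f \<Longrightarrow> T \<subseteq> S \<Longrightarrow> usc_on T f"
  unfolding usc_on_def by (meson subsetD at_le filter_leD)

section \<open>Superjets and second-order expansions\<close>

text \<open>The second-order superjet of viscosity theory. The second-order part is an operator that need not be
  symmetric, because it arises as the derivative of a gradient at a single point, where symmetry is not automatic.\<close>
definition superjet :: "('a::real_inner \<Rightarrow> real) \<Rightarrow> 'a \<Rightarrow> 'a \<Rightarrow> ('a \<Rightarrow> 'a) \<Rightarrow> bool" where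
  "superjet u x p X \<longleftrightarrow>
     (\<forall>\<epsilon>>0. \<exists>r>0. \<forall>h. norm h < r \<longrightarrow> u (x + h) \<le> u x + p \<bullet> h + X h \<bullet> h / 2 + \<epsilon> * (norm h)\<^sup>2)"

lemma superjet_add:
  assumes "superjet u x p X" "superjet v x q Y"
  shows "superjet (\<lambda>z. u z + v z) x (p + q) (\<lambda>h. X h + Y h)"
  unfolding superjet_def
proof (intro allI impI)
  fix \<epsilon> :: real assume "\<epsilon> > 0"
  then have "\<epsilon> / 2 > 0" by simp
  obtain r where r: "r > 0" "\<And>h. norm h < r \<Longrightarrow> u (x + h) \<le> u x + p \<bullet> h + X h \<bullet> h / 2 + \<epsilon> / 2 * (norm h)\<^sup>2"
    using assms(1) \<open>\<epsilon> / 2 > 0\<close> unfolding superjet_def by blast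
  obtain s where s: "s > 0" "\<And>h. norm h < s \<Longrightarrow> v (x + h) \<le> v x + q \<bullet> h + Y h \<bullet> h / 2 + \<epsilon> / 2 * (norm h)\<^sup>2"
    using assms(2) \<open>\<epsilon> / 2 > 0\<close> unfolding superjet_def by blast
  have "u (x + h) + v (x + h) \<le> u x + v x + (p + q) \<bullet> h + (X h + Y h) \<bullet> h / 2 + \<epsilon> * (norm h)\<^sup>2" if "norm h < min r s" for h
    using r(2)[of h] s(2)[of h] that by (simp add: inner_add_left add_divide_distrib)
  then show "\<exists>r>0. \<forall>h. norm h < r \<longrightarrow> u (x + h) + v (x + h) \<le> u x + v x + (p + q) \<bullet> h + (X h + Y h) \<bullet> h / 2 + \<epsilon> * (norm h)\<^sup>2"
    using r s by (intro exI[of _ "min r s"]) auto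
qed

lemma superjet_affine:
  "superjet (\<lambda>z. c + b \<bullet> z) x b (\<lambda>h. 0)"
  unfolding superjet_def by (intro allI impI exI[of _ 1]) (simp add: inner_add_right)

text \<open>\<open>A'\<close> is the inverse of \<open>A\<close>; the slope and the second-order part transform with its adjoint. It
  undoes the change of the time scale in the doubling of variables.\<close>
lemma superjet_affine_change:
  fixes A :: "'a::euclidean_space \<Rightarrow> 'b::euclidean_space"
  assumes jet: "superjet (\<lambda>z. u (c + A z)) x p X" and A: "linear A" and A': "linear A'" and inv: "\<And>h. A (A' h) = h"
  shows "superjet u (c + A x) (adjoint A' p) (\<lambda>h. adjoint A' (X (A' h)))"
  unfolding superjet_def
proof (intro allI impI)
  fix \<epsilon> :: real assume "\<epsilon> > 0"
  obtain K where K: "K > 0" "\<And>h. norm (A' h) \<le> K * norm h"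
    using linear_bounded_pos[OF A'] by blast
  have "\<epsilon> / K\<^sup>2 > 0" using \<open>\<epsilon> > 0\<close> K by simp
  then obtain r where r: "r > 0" "\<And>h. norm h < r \<Longrightarrow> u (c + A (x + h)) \<le> u (c + A x) + p \<bullet> h + X h \<bullet> h / 2 + \<epsilon> / K\<^sup>2 * (norm h)\<^sup>2"
    using jet unfolding superjet_def by blast
  have "u (c + A x + h) \<le> u (c + A x) + adjoint A' p \<bullet> h + adjoint A' (X (A' h)) \<bullet> h / 2 + \<epsilon> * (norm h)\<^sup>2"
    if h: "norm h < r / K" for h
  proof -
    have "norm (A' h) < r" using K(2)[of h] h K(1) by (simp add: field_simps)
    then have "u (c + A (x + A' h)) \<le> u (c + A x) + p \<bullet> A' h + X (A' h) \<bullet> A' h / 2 + \<epsilon> / K\<^sup>2 * (norm (A' h))\<^sup>2" by (rule r(2))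
    moreover have "c + A (x + A' h) = c + A x + h" by (simp add: linear_add[OF A] inv)
    moreover have "\<epsilon> / K\<^sup>2 * (norm (A' h))\<^sup>2 \<le> \<epsilon> * (norm h)\<^sup>2"
    proof -
      have "(norm (A' h))\<^sup>2 \<le> (K * norm h)\<^sup>2" using K by (intro power_mono) auto
      then have "\<epsilon> / K\<^sup>2 * (norm (A' h))\<^sup>2 \<le> \<epsilon> / K\<^sup>2 * (K * norm h)\<^sup>2"
        using \<open>\<epsilon> / K\<^sup>2 > 0\<close> by (intro mult_left_mono) auto
      also have "\<dots> = \<epsilon> * (norm h)\<^sup>2" using K(1) by (simp add: power_mult_distrib)
      finally show ?thesis .
    qed
    moreover have "p \<bullet> A' h = adjoint A' p \<bullet> h" "X (A' h) \<bullet> A' h = adjoint A' (X (A' h)) \<bullet> h"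
      by (simp_all add: adjoint_clauses[OF A'])
    ultimately show ?thesis by simp
  qed
  then show "\<exists>r>0. \<forall>h. norm h < r \<longrightarrow> u (c + A x + h) \<le> u (c + A x) + adjoint A' p \<bullet> h + adjoint A' (X (A' h)) \<bullet> h / 2 + \<epsilon> * (norm h)\<^sup>2"
    using r K by (intro exI[of _ "r / K"]) auto
qed

text \<open>A superjet only sees the quadratic form of its second-order part.\<close>
lemma superjet_symmetrize:
  fixes X :: "'a::euclidean_space \<Rightarrow> 'a"
  assumes "superjet u x p X" "linear X"
  shows "superjet u x p (\<lambda>h. (1 / 2) *\<^sub>R (X h + adjoint X h))"
    "linear (\<lambda>h. (1 / 2) *\<^sub>R (X h + adjoint X h))"
    "\<And>h k. ((1 / 2) *\<^sub>R (X h + adjoint X h)) \<bullet> k = h \<bullet> ((1 / 2) *\<^sub>R (X k + adjoint X k))"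
    "\<And>h. ((1 / 2) *\<^sub>R (X h + adjoint X h)) \<bullet> h = X h \<bullet> h"
proof -
  note adj = adjoint_clauses[OF assms(2)]
  show form: "((1 / 2) *\<^sub>R (X h + adjoint X h)) \<bullet> h = X h \<bullet> h" for h
  proof -
    have "adjoint X h \<bullet> h = X h \<bullet> h" using adj(2)[of h h] by (simp only: inner_commute[of h])
    then show ?thesis by (simp add: inner_add_left)
  qed
  show "superjet u x p (\<lambda>h. (1 / 2) *\<^sub>R (X h + adjoint X h))"
    using assms(1) unfolding superjet_def form .
  show "linear (\<lambda>h. (1 / 2) *\<^sub>R (X h + adjoint X h))"
    using linear_add[OF assms(2)] linear_scale[OF assms(2)] linear_add[OF adjoint_linear[OF assms(2)]] linear_scale[OF adjoint_linear[OF assms(2)]]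
    by (auto intro!: linearI simp: algebra_simps)
  show "((1 / 2) *\<^sub>R (X h + adjoint X h)) \<bullet> k = h \<bullet> ((1 / 2) *\<^sub>R (X k + adjoint X k))" for h k
    using adj by (simp add: inner_add_left inner_add_right inner_commute)
qed

text \<open>The gradient is differentiable at the one point \<open>x\<close> only, which is all that Rademacher's theorem
  gives. The mean value theorem along the segment, applied to the difference of \<open>f\<close> and the
  expansion, bounds that difference by the error of the linearisation of \<open>g\<close>.\<close>
lemma second_order_expansion:
  fixes f :: "'a::euclidean_space \<Rightarrow> real" and g :: "'a \<Rightarrow> 'a"
  assumes f: "\<And>z. (f has_derivative (\<lambda>h. g z \<bullet> h)) (at z)" and g: "(g has_derivative D) (at x)"
    and "\<epsilon> > 0"
  shows "\<exists>r>0. \<forall>h. norm h < r \<longrightarrow> \<bar>f (x + h) - (f x + g x \<bullet> h + D h \<bullet> h / 2)\<bar> \<le> \<epsilon> * (norm h)\<^sup>2"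
proof -
  have lin: "linear D" using g by (rule has_derivative_linear)
  obtain r where r: "r > 0" "\<And>y. norm (y - x) < r \<Longrightarrow> norm (g y - g x - D (y - x)) \<le> \<epsilon> * norm (y - x)"
    using g \<open>\<epsilon> > 0\<close> unfolding has_derivative_at_alt by blast
  have "\<bar>f (x + h) - (f x + g x \<bullet> h + D h \<bullet> h / 2)\<bar> \<le> \<epsilon> * (norm h)\<^sup>2" if h: "norm h < r" for h
  proof -
    define \<phi> where "\<phi> = (\<lambda>s. f (x + s *\<^sub>R h) - s * (g x \<bullet> h) - s\<^sup>2 * (D h \<bullet> h / 2))"
    have "((\<lambda>s. f (x + s *\<^sub>R h)) has_derivative (\<lambda>t. g (x + s *\<^sub>R h) \<bullet> (t *\<^sub>R h))) (at s within {0..1})" for s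
      by (rule has_derivative_compose[OF _ f, where f="\<lambda>s. x + s *\<^sub>R h"]) (auto intro!: derivative_eq_intros)
    then have d: "(\<phi> has_derivative (\<lambda>t. g (x + s *\<^sub>R h) \<bullet> (t *\<^sub>R h) - t * (g x \<bullet> h) - 2 * s * t * (D h \<bullet> h / 2))) (at s within {0..1})" for s
      unfolding \<phi>_def by (auto intro!: derivative_eq_intros)
    obtain s where s: "s \<in> {0<..<1}"
        "\<phi> 1 - \<phi> 0 = g (x + s *\<^sub>R h) \<bullet> ((1 - 0) *\<^sub>R h) - (1 - 0) * (g x \<bullet> h) - 2 * s * (1 - 0) * (D h \<bullet> h / 2)"
      using mvt_simple[of 0 1 \<phi>, OF _ d] by auto
    have "\<phi> 1 - \<phi> 0 = (g (x + s *\<^sub>R h) - g x - D (s *\<^sub>R h)) \<bullet> h"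
      using s(2) by (simp add: linear_scale[OF lin] inner_diff_left)
    also have "\<bar>\<dots>\<bar> \<le> norm (g (x + s *\<^sub>R h) - g x - D (s *\<^sub>R h)) * norm h"
      by (rule Cauchy_Schwarz_ineq2)
    also have "\<dots> \<le> (\<epsilon> * norm h) * norm h"
    proof (intro mult_right_mono)
      have "norm (s *\<^sub>R h) \<le> norm h" using s(1) by (simp add: mult_left_le_one_le)
      then have "norm (s *\<^sub>R h) < r" using h by simp
      then have "norm (g (x + s *\<^sub>R h) - g x - D (s *\<^sub>R h)) \<le> \<epsilon> * norm (s *\<^sub>R h)"
        using r(2)[of "x + s *\<^sub>R h"] by simp
      also have "\<dots> \<le> \<epsilon> * norm h" using \<open>norm (s *\<^sub>R h) \<le> norm h\<close> \<open>\<epsilon> > 0\<close> by (intro mult_left_mono) auto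
      finally show "norm (g (x + s *\<^sub>R h) - g x - D (s *\<^sub>R h)) \<le> \<epsilon> * norm h" .
    qed auto
    finally have "\<bar>\<phi> 1 - \<phi> 0\<bar> \<le> \<epsilon> * (norm h)\<^sup>2" by (simp add: power2_eq_square mult.assoc)
    moreover have "\<phi> 1 - \<phi> 0 = f (x + h) - (f x + g x \<bullet> h + D h \<bullet> h / 2)" by (simp add: \<phi>_def)
    ultimately show ?thesis by simp
  qed
  then show ?thesis using r by blast
qed

text \<open>Functions homogeneous of degree two may be compared at arbitrarily short multiples of \<open>h\<close>.\<close>
lemma quadratic_le_of_local:
  fixes A B :: "'a::real_normed_vector \<Rightarrow> real"
  assumes hom: "\<And>s h. A (s *\<^sub>R h) = s\<^sup>2 * A h" "\<And>s h. B (s *\<^sub>R h) = s\<^sup>2 * B h"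
    and loc: "\<And>\<epsilon>. \<epsilon> > 0 \<Longrightarrow> \<exists>r>0. \<forall>h. norm h < r \<longrightarrow> A h \<le> B h + \<epsilon> * (norm h)\<^sup>2"
  shows "A h \<le> B h"
proof (rule field_le_epsilon)
  fix e :: real assume "e > 0"
  define \<epsilon> where "\<epsilon> = e / ((norm h)\<^sup>2 + 1)"
  have "(norm h)\<^sup>2 + 1 > 0" by (simp add: add_nonneg_pos)
  then have "\<epsilon> > 0" using \<open>e > 0\<close> by (simp add: \<epsilon>_def)
  then obtain r where r: "r > 0" "\<And>h. norm h < r \<Longrightarrow> A h \<le> B h + \<epsilon> * (norm h)\<^sup>2" using loc by blast
  define c where "c = norm h + 1"
  define s where "s = r / (2 * c)"
  have pos: "c > 0" by (simp add: c_def add_nonneg_pos)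
  have "s > 0" using r pos by (simp add: s_def)
  have "norm (s *\<^sub>R h) = s * norm h" using \<open>s > 0\<close> by simp
  also have "\<dots> \<le> s * c" using \<open>s > 0\<close> by (intro mult_left_mono) (auto simp: c_def)
  also have "\<dots> = r / 2" using pos by (simp add: s_def)
  also have "\<dots> < r" using r by simp
  finally have "A (s *\<^sub>R h) \<le> B (s *\<^sub>R h) + \<epsilon> * (norm (s *\<^sub>R h))\<^sup>2" by (rule r(2))
  then have "s\<^sup>2 * A h \<le> s\<^sup>2 * (B h + \<epsilon> * (norm h)\<^sup>2)"
    by (simp add: hom power_mult_distrib algebra_simps)
  then have "A h \<le> B h + \<epsilon> * (norm h)\<^sup>2" using \<open>s > 0\<close> by simp
  also have "\<epsilon> * (norm h)\<^sup>2 \<le> e" using \<open>e > 0\<close> \<open>(norm h)\<^sup>2 + 1 > 0\<close> by (simp add: \<epsilon>_def field_simps)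
  finally show "A h \<le> B h + e" by simp
qed

section \<open>Regularisation by double convolution\<close>

lemma midpoint_norm_identity:
  fixes x a b :: "'a::real_inner"
  shows "(norm (x - a))\<^sup>2 + (norm (x - b))\<^sup>2 = 2 * (norm (x - (1 / 2) *\<^sub>R (a + b)))\<^sup>2 + (norm (a - b))\<^sup>2 / 2"
proof -
  have "x - (1 / 2) *\<^sub>R (a + b) = (1 / 2) *\<^sub>R ((x - a) + (x - b))"
    by (simp add: algebra_simps flip: scaleR_left_distrib)
  then have "(norm (x - (1 / 2) *\<^sub>R (a + b)))\<^sup>2 = (norm ((x - a) + (x - b)))\<^sup>2 / 4"
    by (simp add: power_divide)
  moreover have "(norm ((x - a) + (x - b)))\<^sup>2 + (norm (a - b))\<^sup>2 = 2 * (norm (x - a))\<^sup>2 + 2 * (norm (x - b))\<^sup>2"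
    by (simp add: power2_norm_eq_inner inner_add_left inner_add_right inner_diff_left inner_diff_right inner_commute)
  ultimately show ?thesis by simp
qed

text \<open>The regularisation of Lasry and Lions. The sup-convolution \<open>V\<close> of \<open>u\<close> is semiconvex with constant
  \<open>l\<close>; the inf-convolution \<open>G\<close> of \<open>V\<close>, taken with the larger constant \<open>2 * l\<close>, has a Lipschitz
  continuous gradient. So Rademacher's theorem gives second derivatives of \<open>G\<close>, and at points where
  \<open>G\<close> is touched from above by a flat enough paraboloid they are inherited by \<open>u\<close> at a nearby point.\<close>
locale sup_inf_convolution =
  fixes u :: "'a::euclidean_space \<Rightarrow> real" and B :: "'a set" and l :: real
  assumes B: "compact B" "B \<noteq> {}" and usc: "usc_on B u" and l: "0 < l"
begin

definition V :: "'a \<Rightarrow> real" where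
  "V \<xi> = (SUP x\<in>B. u x - l * (norm (x - \<xi>))\<^sup>2 / 2)"

lemma V_max: "\<exists>x\<in>B. V \<xi> = u x - l * (norm (x - \<xi>))\<^sup>2 / 2 \<and> (\<forall>y\<in>B. u y - l * (norm (y - \<xi>))\<^sup>2 / 2 \<le> V \<xi>)"
proof -
  have "usc_on B (\<lambda>x. u x + (- (l * (norm (x - \<xi>))\<^sup>2 / 2)))"
    by (intro usc_on_add_continuous usc continuous_intros) auto
  then obtain x where x: "x \<in> B" "\<forall>y\<in>B. u y - l * (norm (y - \<xi>))\<^sup>2 / 2 \<le> u x - l * (norm (x - \<xi>))\<^sup>2 / 2"
    using usc_on_attains_max[OF B] by fastforce
  then have "V \<xi> = u x - l * (norm (x - \<xi>))\<^sup>2 / 2"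
    unfolding V_def by (intro cSup_eq_maximum) auto
  then show ?thesis using x by auto
qed

lemma V_attained: obtains x where "x \<in> B" "V \<xi> = u x - l * (norm (x - \<xi>))\<^sup>2 / 2"
  using V_max by blast

lemma V_ge: "x \<in> B \<Longrightarrow> u x - l * (norm (x - \<xi>))\<^sup>2 / 2 \<le> V \<xi>"
  using V_max by blast

text \<open>Semiconvexity of \<open>V\<close>, with the paraboloid given by a point \<open>x\<close> where the supremum is attained.\<close>
lemma V_touched_below:
  assumes "x \<in> B" "V \<xi> = u x - l * (norm (x - \<xi>))\<^sup>2 / 2"
  shows "V \<xi> + l * ((x - \<xi>) \<bullet> (\<eta> - \<xi>)) - l * (norm (\<eta> - \<xi>))\<^sup>2 / 2 \<le> V \<eta>"
proof -
  have "(norm (x - \<eta>))\<^sup>2 = (norm (x - \<xi>))\<^sup>2 - 2 * ((x - \<xi>) \<bullet> (\<eta> - \<xi>)) + (norm (\<eta> - \<xi>))\<^sup>2"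
    by (simp add: power2_norm_eq_inner algebra_simps inner_commute)
  then have "l * (norm (x - \<eta>))\<^sup>2 = l * (norm (x - \<xi>))\<^sup>2 - 2 * (l * ((x - \<xi>) \<bullet> (\<eta> - \<xi>))) + l * (norm (\<eta> - \<xi>))\<^sup>2"
    by algebra
  then show ?thesis using V_ge[OF assms(1), of \<eta>] assms(2) by linarith
qed

text \<open>Semiconvexity again, in midpoint form: the map \<open>\<xi> \<mapsto> V \<xi> + l * (norm \<xi>)\<^sup>2 / 2\<close> is convex.\<close>
lemma V_midpoint:
  "V ((1 / 2) *\<^sub>R (\<xi> + \<eta>)) \<le> (V \<xi> + V \<eta>) / 2 + l * (norm (\<xi> - \<eta>))\<^sup>2 / 8"
proof -
  define m where "m = (1 / 2) *\<^sub>R (\<xi> + \<eta>)"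
  obtain x where x: "x \<in> B" "V m = u x - l * (norm (x - m))\<^sup>2 / 2" by (rule V_attained)
  have "(norm (x - \<xi>))\<^sup>2 + (norm (x - \<eta>))\<^sup>2 = 2 * (norm (x - m))\<^sup>2 + (norm (\<xi> - \<eta>))\<^sup>2 / 2"
    using midpoint_norm_identity[of x \<xi> \<eta>] by (simp add: m_def)
  then have "l * ((norm (x - \<xi>))\<^sup>2 + (norm (x - \<eta>))\<^sup>2) = l * (2 * (norm (x - m))\<^sup>2 + (norm (\<xi> - \<eta>))\<^sup>2 / 2)"
    by simp
  then have "l * (norm (x - \<xi>))\<^sup>2 + l * (norm (x - \<eta>))\<^sup>2 = 2 * (l * (norm (x - m))\<^sup>2) + l * (norm (\<xi> - \<eta>))\<^sup>2 / 2"
    by (simp add: distrib_left)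
  then show ?thesis
    using V_ge[OF x(1), of \<xi>] V_ge[OF x(1), of \<eta>] x(2) unfolding m_def[symmetric] by argo
qed

text \<open>The function whose minimum over \<open>\<xi>\<close> is the inf-convolution of \<open>V\<close> at \<open>z\<close>.\<close>
definition \<Psi> :: "'a \<Rightarrow> 'a \<Rightarrow> real" where
  "\<Psi> z \<xi> = V \<xi> + l * (norm (z - \<xi>))\<^sup>2"

text \<open>Completing the square in \<open>V \<eta> \<ge> u x - l * (norm (x - \<eta>))\<^sup>2 / 2\<close>. It makes the minimum exist, and
  dropping the last square gives the bound of \<open>u\<close> by \<open>G\<close>.\<close>
lemma \<Psi>_coercive:
  assumes "x \<in> B"
  shows "u x - l * (norm (x - z))\<^sup>2 + l * (norm (\<eta> - (2 *\<^sub>R z - x)))\<^sup>2 / 2 \<le> \<Psi> z \<eta>"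
proof -
  have eq: "(norm (\<eta> - (2 *\<^sub>R z - x)))\<^sup>2 = 2 * (norm (z - \<eta>))\<^sup>2 - (norm (x - \<eta>))\<^sup>2 + 2 * (norm (x - z))\<^sup>2"
    by (simp add: power2_norm_eq_inner inner_diff_left inner_diff_right inner_commute)
  have "l * (norm (\<eta> - (2 *\<^sub>R z - x)))\<^sup>2 / 2 - l * (norm (x - z))\<^sup>2 = l * (norm (z - \<eta>))\<^sup>2 - l * (norm (x - \<eta>))\<^sup>2 / 2"
    unfolding eq by (simp add: field_simps)
  then show ?thesis using V_ge[OF assms, of \<eta>] unfolding \<Psi>_def by argo
qed

lemma \<Psi>_min: "\<exists>\<xi>. \<forall>\<eta>. \<Psi> z \<xi> \<le> \<Psi> z \<eta>"
proof -
  obtain x where x: "x \<in> B" using B by blast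
  define c where "c = 2 *\<^sub>R z - x"
  define a where "a = \<bar>\<Psi> z c - (u x - l * (norm (x - z))\<^sup>2)\<bar>"
  \<comment> \<open>Outside this ball the coercive lower bound exceeds the value at the centre.\<close>
  define R where "R = 1 + 2 * a / l"
  have "a \<ge> 0" by (simp add: a_def)
  have "R \<ge> 1" using l \<open>a \<ge> 0\<close> by (simp add: R_def)
  \<comment> \<open>\<open>V\<close> is lower semicontinuous, being a supremum of continuous functions.\<close>
  have "usc_on (cball c R) (\<lambda>\<eta>. - V \<eta>)"
    unfolding usc_on_def
  proof (intro ballI allI impI)
    fix \<eta> b assume "- V \<eta> < b"
    obtain y where y: "y \<in> B" "V \<eta> = u y - l * (norm (y - \<eta>))\<^sup>2 / 2" by (rule V_attained)
    have "((\<lambda>\<zeta>. u y - l * (norm (y - \<zeta>))\<^sup>2 / 2) \<longlongrightarrow> u y - l * (norm (y - \<eta>))\<^sup>2 / 2) (at \<eta> within cball c R)"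
      by (intro tendsto_intros) auto
    then have "eventually (\<lambda>\<zeta>. - b < u y - l * (norm (y - \<zeta>))\<^sup>2 / 2) (at \<eta> within cball c R)"
      by (rule order_tendstoD) (use \<open>- V \<eta> < b\<close> y in simp)
    then show "eventually (\<lambda>\<zeta>. - V \<zeta> < b) (at \<eta> within cball c R)"
      by eventually_elim (use V_ge[OF y(1)] in \<open>smt (verit)\<close>)
  qed
  then have "usc_on (cball c R) (\<lambda>\<eta>. - V \<eta> + (- (l * (norm (z - \<eta>))\<^sup>2)))"
    by (intro usc_on_add_continuous continuous_intros)
  from usc_on_attains_max[OF _ _ this]
  obtain \<xi> where \<xi>': "\<xi> \<in> cball c R"
      "\<forall>\<eta>\<in>cball c R. - V \<eta> + (- (l * (norm (z - \<eta>))\<^sup>2)) \<le> - V \<xi> + (- (l * (norm (z - \<xi>))\<^sup>2))"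
    using \<open>R \<ge> 1\<close> by auto
  then have \<xi>: "\<Psi> z \<xi> \<le> \<Psi> z \<eta>" if "\<eta> \<in> cball c R" for \<eta>
    using that by (fastforce simp: \<Psi>_def)
  have "\<Psi> z \<xi> \<le> \<Psi> z \<eta>" for \<eta>
  proof (cases "\<eta> \<in> cball c R")
    case False
    then have "R \<le> norm (\<eta> - c)" by (simp add: dist_norm norm_minus_commute)
    then have "R\<^sup>2 \<le> (norm (\<eta> - c))\<^sup>2" using \<open>R \<ge> 1\<close> by (intro power_mono) auto
    moreover have "R \<le> R\<^sup>2" using \<open>R \<ge> 1\<close> by (simp add: power2_eq_square)
    ultimately have "l * R \<le> l * (norm (\<eta> - c))\<^sup>2" using l by (intro mult_left_mono) auto
    moreover have "2 * a \<le> l * R" using l by (simp add: R_def field_simps)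
    moreover have "\<Psi> z \<xi> \<le> \<Psi> z c" using \<xi> \<open>R \<ge> 1\<close> by simp
    ultimately show ?thesis using \<Psi>_coercive[OF x, of z \<eta>] unfolding c_def[symmetric] a_def by argo
  qed (use \<xi> in auto)
  then show ?thesis by blast
qed

definition prox :: "'a \<Rightarrow> 'a" where
  "prox z = (SOME \<xi>. \<forall>\<eta>. \<Psi> z \<xi> \<le> \<Psi> z \<eta>)"

lemma \<Psi>_prox_le: "\<Psi> z (prox z) \<le> \<Psi> z \<eta>"
  using someI_ex[OF \<Psi>_min[of z]] by (simp add: prox_def)

text \<open>The constant \<open>2 * l\<close> of the inf-convolution beats the semiconvexity constant \<open>l\<close> of \<open>V\<close>, so
  \<open>\<Psi> z\<close> is uniformly convex and grows quadratically away from its minimum.\<close>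
lemma \<Psi>_growth: "\<Psi> z (prox z) + l * (norm (\<eta> - prox z))\<^sup>2 / 4 \<le> \<Psi> z \<eta>"
proof -
  define \<xi> where "\<xi> = prox z"
  define m where "m = (1 / 2) *\<^sub>R (\<xi> + \<eta>)"
  have "(norm (z - \<xi>))\<^sup>2 + (norm (z - \<eta>))\<^sup>2 = 2 * (norm (z - m))\<^sup>2 + (norm (\<xi> - \<eta>))\<^sup>2 / 2"
    using midpoint_norm_identity[of z \<xi> \<eta>] by (simp add: m_def)
  then have "l * ((norm (z - \<xi>))\<^sup>2 + (norm (z - \<eta>))\<^sup>2) = l * (2 * (norm (z - m))\<^sup>2 + (norm (\<xi> - \<eta>))\<^sup>2 / 2)"
    by simp
  then have "l * (norm (z - \<xi>))\<^sup>2 + l * (norm (z - \<eta>))\<^sup>2 = 2 * (l * (norm (z - m))\<^sup>2) + l * (norm (\<xi> - \<eta>))\<^sup>2 / 2"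
    by (simp add: distrib_left)
  then have "\<Psi> z m \<le> (\<Psi> z \<xi> + \<Psi> z \<eta>) / 2 - l * (norm (\<xi> - \<eta>))\<^sup>2 / 8"
    using V_midpoint[of \<xi> \<eta>] unfolding \<Psi>_def m_def[symmetric] by argo
  then show ?thesis
    using \<Psi>_prox_le[of z m] unfolding \<xi>_def norm_minus_commute[of \<eta>] by argo
qed

text \<open>The growth estimates at \<open>z\<close> and at \<open>z'\<close>, each tested with the minimiser of the other, are added.\<close>
lemma prox_lipschitz: "norm (prox z - prox z') \<le> 4 * norm (z - z')"
proof -
  define d where "d = norm (prox z - prox z')"
  have "l * d\<^sup>2 / 2 \<le> \<Psi> z (prox z') - \<Psi> z (prox z) + \<Psi> z' (prox z) - \<Psi> z' (prox z')"
    using \<Psi>_growth[of z "prox z'"] \<Psi>_growth[of z' "prox z"] by (simp add: d_def norm_minus_commute)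
  also have "\<dots> = l * (2 * ((z - z') \<bullet> (prox z - prox z')))"
    by (simp add: \<Psi>_def power2_norm_eq_inner algebra_simps inner_commute)
  also have "\<dots> \<le> l * (2 * (norm (z - z') * d))"
    using l norm_cauchy_schwarz[of "z - z'" "prox z - prox z'"] by (intro mult_left_mono) (auto simp: d_def)
  finally have "l * (d * d) \<le> l * (4 * norm (z - z') * d)" by (simp add: power2_eq_square algebra_simps)
  then have "d * d \<le> 4 * norm (z - z') * d" using l by (rule mult_left_le_imp_le)
  then show ?thesis
    by (cases "d = 0") (auto simp: d_def)
qed

definition G :: "'a \<Rightarrow> real" where "G z = \<Psi> z (prox z)"

definition grd :: "'a \<Rightarrow> 'a" where "grd z = (2 * l) *\<^sub>R (z - prox z)"

lemma grd_lipschitz: "norm (grd z - grd z') \<le> 10 * l * norm (z - z')"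
proof -
  have "grd z - grd z' = (2 * l) *\<^sub>R ((z - z') - (prox z - prox z'))"
    by (simp add: grd_def algebra_simps)
  then have "norm (grd z - grd z') = 2 * l * norm ((z - z') - (prox z - prox z'))" using l by simp
  also have "\<dots> \<le> 2 * l * (norm (z - z') + 4 * norm (z - z'))"
    using l norm_triangle_ineq4[of "z - z'" "prox z - prox z'"] prox_lipschitz[of z z']
    by (intro mult_left_mono) auto
  finally show ?thesis by simp
qed

text \<open>The minimiser for \<open>z\<close> is a competitor for \<open>z + h\<close>.\<close>
lemma G_upper: "G (z + h) \<le> G z + grd z \<bullet> h + l * (norm h)\<^sup>2"
proof -
  have "G (z + h) \<le> \<Psi> (z + h) (prox z)" unfolding G_def by (rule \<Psi>_prox_le)
  also have "\<dots> = G z + grd z \<bullet> h + l * (norm h)\<^sup>2"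
    by (simp add: G_def \<Psi>_def grd_def power2_norm_eq_inner algebra_simps inner_commute)
  finally show ?thesis .
qed

text \<open>The lower bound is the upper bound from the other end point \<open>z + h\<close>, whose slope is close to that at
  \<open>z\<close> because \<open>grd\<close> is Lipschitz continuous.\<close>
lemma G_has_derivative: "(G has_derivative (\<lambda>h. grd z \<bullet> h)) (at z)"
proof -
  have both: "\<bar>G (z + h) - G z - grd z \<bullet> h\<bar> \<le> 11 * l * (norm h)\<^sup>2" for h
  proof -
    define N where "N = l * (norm h)\<^sup>2"
    have "N \<ge> 0" using l by (simp add: N_def)
    have "G z \<le> G (z + h) - grd (z + h) \<bullet> h + N"
      using G_upper[of "z + h" "- h"] by (simp add: N_def)
    moreover have "\<bar>(grd (z + h) - grd z) \<bullet> h\<bar> \<le> (10 * l * norm h) * norm h"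
    proof -
      have "\<bar>(grd (z + h) - grd z) \<bullet> h\<bar> \<le> norm (grd (z + h) - grd z) * norm h" by (rule Cauchy_Schwarz_ineq2)
      also have "\<dots> \<le> (10 * l * norm h) * norm h"
        using grd_lipschitz[of "z + h" z] by (intro mult_right_mono) auto
      finally show ?thesis .
    qed
    moreover have "(10 * l * norm h) * norm h = 10 * N" by (simp add: N_def power2_eq_square)
    moreover have "G (z + h) \<le> G z + grd z \<bullet> h + N" using G_upper by (simp add: N_def)
    ultimately have "\<bar>G (z + h) - G z - grd z \<bullet> h\<bar> \<le> 11 * N"
      using \<open>N \<ge> 0\<close> unfolding inner_diff_left by linarith
    then show ?thesis by (simp add: N_def)
  qed
  show ?thesis
    unfolding has_derivative_at_alt
  proof (intro conjI allI impI)
    show "bounded_linear (\<lambda>h. grd z \<bullet> h)" by (rule bounded_linear_inner_right)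
    fix e :: real assume "e > 0"
    have "norm (G y - G z - grd z \<bullet> (y - z)) \<le> e * norm (y - z)" if "norm (y - z) < e / (11 * l)" for y
    proof -
      have "11 * l * norm (y - z) \<le> e" using that l by (simp add: field_simps)
      then have "11 * l * norm (y - z) * norm (y - z) \<le> e * norm (y - z)" by (intro mult_right_mono) auto
      then show ?thesis using both[of "y - z"] by (simp add: power2_eq_square mult.assoc)
    qed
    then show "\<exists>d>0. \<forall>y. norm (y - z) < d \<longrightarrow> norm (G y - G z - grd z \<bullet> (y - z)) \<le> e * norm (y - z)"
      using \<open>e > 0\<close> l by (intro exI[of _ "e / (11 * l)"]) auto
  qed
qed

lemma u_le_G:
  assumes "x \<in> B"
  shows "u x \<le> G z + l * (norm (x - z))\<^sup>2"
proof -
  have "0 \<le> l * (norm (prox z - (2 *\<^sub>R z - x)))\<^sup>2" using l by simp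
  then show ?thesis using \<Psi>_coercive[OF assms, of z "prox z"] unfolding G_def by linarith
qed

lemma G_le_V: "G z \<le> V z"
  using \<Psi>_prox_le[of z z] by (simp add: G_def \<Psi>_def)

text \<open>Let the supremum in \<open>V (prox z)\<close> be attained at \<open>y\<close>. Its paraboloid bounds \<open>V\<close> from below and thereby
  \<open>G\<close>, with a slope that differs from \<open>grd z\<close> by a multiple of \<open>d\<close>. A nonzero \<open>d\<close> would make \<open>G\<close>
  grow faster than a paraboloid with \<open>\<kappa> < 2 * l\<close> allows. Hence \<open>d = 0\<close>, which says that \<open>z\<close> is the midpoint of
  \<open>prox z\<close> and \<open>y\<close>; then \<open>y = x\<close>, and the inequality between \<open>u x\<close> and \<open>G z\<close> is an equality.\<close>
lemma contact:
  assumes touch: "\<And>h. G (z + h) \<le> G z + grd z \<bullet> h + \<kappa> / 2 * (norm h)\<^sup>2" and \<kappa>: "\<kappa> < 2 * l"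
  defines "x \<equiv> z + (1 / (2 * l)) *\<^sub>R grd z"
  shows "x \<in> B" "u x = G z + l * (norm (x - z))\<^sup>2" "\<And>h. G z + grd z \<bullet> h - l * (norm h)\<^sup>2 \<le> G (z + h)"
proof -
  obtain y where y: "y \<in> B" "V (prox z) = u y - l * (norm (y - prox z))\<^sup>2 / 2" by (rule V_attained)
  define d where "d = l *\<^sub>R (y - prox z) - (2 * l) *\<^sub>R (z - prox z)"
  have lower: "G z + grd z \<bullet> h - l * (norm h)\<^sup>2 + 2 * (h \<bullet> d) - (norm d)\<^sup>2 / (2 * l) \<le> G (z + h)" for h
  proof -
    define k where "k = prox (z + h) - prox z"
    have eta: "prox (z + h) = prox z + k" by (simp add: k_def)
    have "0 \<le> (norm (d + l *\<^sub>R (k - 2 *\<^sub>R h)))\<^sup>2 / (2 * l)" using l by simp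
    also have "\<dots> = (norm d)\<^sup>2 / (2 * l) + d \<bullet> (k - 2 *\<^sub>R h) + l * (norm (k - 2 *\<^sub>R h))\<^sup>2 / 2"
    proof -
      have "(norm (d + l *\<^sub>R w))\<^sup>2 = (norm d)\<^sup>2 + 2 * l * (d \<bullet> w) + l\<^sup>2 * (norm w)\<^sup>2" for w
        by (simp only: power2_norm_eq_inner inner_add_left inner_add_right inner_scaleR_left inner_scaleR_right inner_commute[of w d])
           (simp add: power2_eq_square algebra_simps)
      then show ?thesis using l by (simp add: add_divide_distrib power2_eq_square)
    qed
    finally have sq: "0 \<le> (norm d)\<^sup>2 / (2 * l) + d \<bullet> (k - 2 *\<^sub>R h) + l * (norm (k - 2 *\<^sub>R h))\<^sup>2 / 2" .
    have "V (prox z) + l * ((y - prox z) \<bullet> k) - l * (norm k)\<^sup>2 / 2 \<le> V (prox (z + h))"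
      using V_touched_below[OF y, of "prox (z + h)"] by (simp add: k_def)
    moreover have "l * (norm (z + h - prox (z + h)))\<^sup>2
        = l * (norm (z - prox z))\<^sup>2 + (2 * l) * ((z - prox z) \<bullet> (h - k)) + l * (norm (h - k))\<^sup>2"
      unfolding eta by (simp add: power2_norm_eq_inner algebra_simps inner_commute)
    moreover have "l * ((y - prox z) \<bullet> k) = d \<bullet> k + (2 * l) * ((z - prox z) \<bullet> k)"
      by (simp add: d_def algebra_simps)
    moreover have "l * (norm (h - k))\<^sup>2 - l * (norm k)\<^sup>2 / 2 = l * (norm (k - 2 *\<^sub>R h))\<^sup>2 / 2 - l * (norm h)\<^sup>2"
      by (simp add: power2_norm_eq_inner algebra_simps inner_commute)
    ultimately show ?thesis
      using sq unfolding G_def \<Psi>_def grd_def by (simp add: inner_diff_right inner_commute algebra_simps)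
  qed
  have "d = 0"
  proof (rule ccontr)
    assume "d \<noteq> 0"
    then have nd: "(norm d)\<^sup>2 > 0" by simp
    \<comment> \<open>The step \<open>s *\<^sub>R d\<close> maximises the gain \<open>2 * (h \<bullet> d) - 2 * l * (norm h)\<^sup>2\<close>.\<close>
    define s where "s = 1 / (2 * l)"
    have "2 * (s * (norm d)\<^sup>2) - (norm d)\<^sup>2 / (2 * l) \<le> (\<kappa> / 2 + l) * (s\<^sup>2 * (norm d)\<^sup>2)"
      using lower[of "s *\<^sub>R d"] touch[of "s *\<^sub>R d"]
      by (simp add: power_mult_distrib power2_norm_eq_inner[of d, symmetric] algebra_simps)
    then have "(norm d)\<^sup>2 * (1 / (2 * l)) \<le> (norm d)\<^sup>2 * ((\<kappa> / 2 + l) / (4 * l\<^sup>2))"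
      using l by (simp add: s_def power2_eq_square field_simps)
    then have "1 / (2 * l) \<le> (\<kappa> / 2 + l) / (4 * l\<^sup>2)" using nd by (rule mult_left_le_imp_le)
    then show False using l \<kappa> by (simp add: power2_eq_square field_simps)
  qed
  then have "l *\<^sub>R (y - prox z) = l *\<^sub>R (2 *\<^sub>R (z - prox z))" by (simp add: d_def)
  then have yp: "y - prox z = 2 *\<^sub>R (z - prox z)" using l by (metis less_irrefl scaleR_cancel_left)
  have "x = z + (z - prox z)" using l by (simp add: x_def grd_def)
  moreover have "y = prox z + 2 *\<^sub>R (z - prox z)" using yp by (simp add: diff_eq_eq)
  ultimately have xy: "x = y" by (simp add: scaleR_2[of "z - prox z"])
  show "x \<in> B" using xy y by simp
  have "norm (y - prox z) = 2 * norm (z - prox z)" by (simp add: yp)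
  moreover have "x - z = z - prox z" using \<open>x = z + (z - prox z)\<close> by simp
  ultimately show "u x = G z + l * (norm (x - z))\<^sup>2"
    using y(2) xy unfolding G_def \<Psi>_def by (simp add: power_mult_distrib)
  show "G z + grd z \<bullet> h - l * (norm h)\<^sup>2 \<le> G (z + h)" for h
    using lower[of h] \<open>d = 0\<close> by simp
qed

text \<open>At a contact point \<open>u (x + h) \<le> G (z + h) + l * (norm (x - z))\<^sup>2\<close> with equality for \<open>h = 0\<close>, so the
  expansion of \<open>G\<close> at \<open>z\<close> bounds \<open>u\<close> near \<open>x\<close>. The lower bound on \<open>D\<close> comes from the paraboloid below
  \<open>G\<close>.\<close>
lemma jet_at_contact:
  assumes touch: "\<And>h. G (z + h) \<le> G z + grd z \<bullet> h + \<kappa> / 2 * (norm h)\<^sup>2" and \<kappa>: "\<kappa> < 2 * l"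
    and D: "(grd has_derivative D) (at z)"
    and e: "0 < e" "\<And>h. norm h < e \<Longrightarrow> z + (1 / (2 * l)) *\<^sub>R grd z + h \<in> B"
  shows "superjet u (z + (1 / (2 * l)) *\<^sub>R grd z) (grd z) D" "- 2 * l * (norm k)\<^sup>2 \<le> D k \<bullet> k"
proof -
  define x where "x = z + (1 / (2 * l)) *\<^sub>R grd z"
  note c = contact[OF touch \<kappa>, folded x_def] and expand = second_order_expansion[OF G_has_derivative D]
  show "superjet u (z + (1 / (2 * l)) *\<^sub>R grd z) (grd z) D"
    unfolding x_def[symmetric] superjet_def
  proof (intro allI impI)
    fix \<epsilon> :: real assume "\<epsilon> > 0"
    then obtain s where s: "s > 0" "\<And>h. norm h < s \<Longrightarrow> \<bar>G (z + h) - (G z + grd z \<bullet> h + D h \<bullet> h / 2)\<bar> \<le> \<epsilon> * (norm h)\<^sup>2"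
      using expand by blast
    have "u (x + h) \<le> u x + grd z \<bullet> h + D h \<bullet> h / 2 + \<epsilon> * (norm h)\<^sup>2" if h: "norm h < min s e" for h
    proof -
      have "x + h \<in> B" using e(2) h by (simp add: x_def)
      then have "u (x + h) \<le> G (z + h) + l * (norm (x - z))\<^sup>2" using u_le_G[of "x + h" "z + h"] by simp
      then show ?thesis using s(2)[of h] h c(2) by (simp add: abs_le_iff)
    qed
    then show "\<exists>s>0. \<forall>h. norm h < s \<longrightarrow> u (x + h) \<le> u x + grd z \<bullet> h + D h \<bullet> h / 2 + \<epsilon> * (norm h)\<^sup>2"
      using s(1) e(1) by (intro exI[of _ "min s e"]) auto
  qed
  have lin: "linear D" using D by (rule has_derivative_linear)
  show "- 2 * l * (norm k)\<^sup>2 \<le> D k \<bullet> k"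
  proof (rule quadratic_le_of_local[of "\<lambda>h. - 2 * l * (norm h)\<^sup>2" "\<lambda>h. D h \<bullet> h"])
    fix \<epsilon> :: real assume "\<epsilon> > 0"
    then have "\<epsilon> / 2 > 0" by simp
    then obtain s where s: "s > 0" "\<And>h. norm h < s \<Longrightarrow> \<bar>G (z + h) - (G z + grd z \<bullet> h + D h \<bullet> h / 2)\<bar> \<le> \<epsilon> / 2 * (norm h)\<^sup>2"
      using expand by blast
    have "- 2 * l * (norm h)\<^sup>2 \<le> D h \<bullet> h + \<epsilon> * (norm h)\<^sup>2" if "norm h < s" for h
      using s(2)[OF that] c(3)[of h] by (simp add: abs_le_iff field_simps)
    then show "\<exists>r>0. \<forall>h. norm h < r \<longrightarrow> - 2 * l * (norm h)\<^sup>2 \<le> D h \<bullet> h + \<epsilon> * (norm h)\<^sup>2" using s(1) by blast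
  qed (auto simp: linear_scale[OF lin] power_mult_distrib power2_eq_square)
qed

end

section \<open>The theorem on sums\<close>

text \<open>The theorem on sums of Crandall, Ishii and Lions, in an approximate form that has the jets at points
  within \<open>\<delta>\<close> of the maximum and slopes smaller than \<open>\<delta>\<close>. The usual proof rests on Alexandrov's theorem for
  semiconvex functions; here the double convolutions of \<open>u\<close> and \<open>v\<close> have Lipschitz continuous
  gradients and Rademacher's theorem is enough.

  Let \<open>f\<close> be the sum of the two regularisations and \<open>q z = z \<bullet> L z + (norm (L z))\<^sup>2 / M\<close>. The hypothesis
  on \<open>u\<close> and \<open>v\<close> turns into \<open>f \<le> q / 2\<close>. For each small \<open>p\<close> the function \<open>F p\<close>, which
  is \<open>f - q / 2\<close> minus a small paraboloid and the linear function \<open>p\<close>, attains its maximum, and at a maximum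
  point the Lipschitz map \<open>P\<close> takes the value \<open>p\<close>. So \<open>P\<close> maps the set \<open>K\<close> of these maximum points onto a
  ball, and \<open>K\<close> is not null. Therefore the gradient \<open>g\<close> of \<open>f\<close> is differentiable at some point of
  \<open>K\<close>. The derivative there is block diagonal, as \<open>f\<close> is a sum of functions of separate variables, and
  the condition for a maximum is the asserted matrix inequality. Finally the contact lemma carries the two
  blocks over to \<open>u\<close> and \<open>v\<close>.\<close>
theorem theorem_on_sums:
  fixes u :: "'a::euclidean_space \<Rightarrow> real" and v :: "'b::euclidean_space \<Rightarrow> real"
    and L :: "'a \<times> 'b \<Rightarrow> 'a \<times> 'b" and r M \<tau> \<delta> :: real
  assumes "0 < r" and uscu: "usc_on (cball 0 r) u" and uscv: "usc_on (cball 0 r) v"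
    and u0: "u 0 = 0" and v0: "v 0 = 0"
    and L: "linear L" and sym: "\<And>z w. L z \<bullet> w = z \<bullet> L w" and bound: "\<And>z. norm (L z) \<le> M * norm z" and M: "0 < M"
    and le: "\<And>x y. norm x \<le> r \<Longrightarrow> norm y \<le> r \<Longrightarrow> u x + v y \<le> (x, y) \<bullet> L (x, y) / 2"
    and \<tau>: "0 < \<tau>" "\<tau> \<le> M" and "0 < \<delta>"
  obtains x y p q X Y where "norm x < \<delta>" "norm y < \<delta>" "norm p < \<delta>" "norm q < \<delta>"
    "linear X" "linear Y" "superjet u x p X" "superjet v y q Y"
    "\<And>h. - 4 * M * (norm h)\<^sup>2 \<le> X h \<bullet> h" "\<And>k. - 4 * M * (norm k)\<^sup>2 \<le> Y k \<bullet> k"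
    "\<And>h k. X h \<bullet> h + Y k \<bullet> k \<le> (h, k) \<bullet> L (h, k) + (norm (L (h, k)))\<^sup>2 / M + \<tau> * (norm (h, k))\<^sup>2"
proof -
  define l where "l = 2 * M"
  have l: "0 < l" using M by (simp add: l_def)
  interpret U: sup_inf_convolution u "cball 0 r" l
    using \<open>0 < r\<close> uscu l by unfold_locales auto
  interpret W: sup_inf_convolution v "cball 0 r" l
    using \<open>0 < r\<close> uscv l by unfold_locales auto
  note lin = linear_add[OF L] linear_diff[OF L] linear_scale[OF L] linear_0[OF L]
  define f where "f = (\<lambda>z. U.G (fst z) + W.G (snd z))"
  define g where "g = (\<lambda>z. (U.grd (fst z), W.grd (snd z)))"
  define q where "q = (\<lambda>z. z \<bullet> L z + (norm (L z))\<^sup>2 / M)"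
  define L' where "L' = (\<lambda>z. L z + (1 / M) *\<^sub>R L (L z))"
  have q_add: "q (z + h) = q z + 2 * (L' z \<bullet> h) + q h" for z h
    using sym[of h z] sym[of "L z" h]
    by (simp add: q_def L'_def lin power2_norm_eq_inner inner_add_left inner_add_right inner_commute add_divide_distrib)
  have q_scale: "q (s *\<^sub>R h) = s\<^sup>2 * q h" for s h
    by (simp add: q_def lin power_mult_distrib power2_eq_square algebra_simps)
  have q_le: "q z \<le> 2 * M * (norm z)\<^sup>2" for z
  proof -
    have "z \<bullet> L z \<le> norm z * norm (L z)" by (rule norm_cauchy_schwarz)
    also have "\<dots> \<le> norm z * (M * norm z)" by (intro mult_left_mono bound) auto
    finally have 1: "z \<bullet> L z \<le> M * (norm z)\<^sup>2" by (simp add: power2_eq_square mult_ac)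
    have "(norm (L z))\<^sup>2 \<le> (M * norm z)\<^sup>2" by (intro power_mono bound) auto
    then have "(norm (L z))\<^sup>2 / M \<le> M * (norm z)\<^sup>2" using M by (simp add: field_simps power2_eq_square)
    then show ?thesis using 1 by (simp add: q_def)
  qed
  \<comment> \<open>The quadratic form is maximised against \<open>- M * (norm d)\<^sup>2\<close>: one half of this term absorbs
    \<open>d \<bullet> L d / 2\<close>, the other half is paired with \<open>L z \<bullet> d\<close> and leaves \<open>(norm (L z))\<^sup>2 / (2 * M)\<close>.\<close>
  have f_le: "f z \<le> q z / 2" for z
  proof -
    obtain x where x: "x \<in> cball 0 r" "U.V (fst z) = u x - l * (norm (x - fst z))\<^sup>2 / 2" by (rule U.V_attained)
    obtain y where y: "y \<in> cball 0 r" "W.V (snd z) = v y - l * (norm (y - snd z))\<^sup>2 / 2" by (rule W.V_attained)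
    define d where "d = (x, y) - z"
    have xy: "(x, y) = z + d" by (simp add: d_def)
    have nd: "(norm d)\<^sup>2 = (norm (x - fst z))\<^sup>2 + (norm (y - snd z))\<^sup>2"
      by (simp add: d_def norm_prod_def minus_prod_def)
    have "f z \<le> U.V (fst z) + W.V (snd z)" unfolding f_def by (intro add_mono U.G_le_V W.G_le_V)
    also have "\<dots> = u x + v y - M * (norm d)\<^sup>2" unfolding x(2) y(2) nd by (simp add: l_def algebra_simps)
    also have "u x + v y \<le> (z + d) \<bullet> L (z + d) / 2" using le[of x y] x y unfolding xy by simp
    also have "(z + d) \<bullet> L (z + d) = z \<bullet> L z + 2 * (L z \<bullet> d) + d \<bullet> L d"
      using sym[of z d] by (simp add: lin inner_add_left inner_add_right inner_commute)
    also have "(z \<bullet> L z + 2 * (L z \<bullet> d) + d \<bullet> L d) / 2 - M * (norm d)\<^sup>2 \<le> q z / 2"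
    proof -
      have "d \<bullet> L d \<le> norm d * norm (L d)" by (rule norm_cauchy_schwarz)
      also have "\<dots> \<le> norm d * (M * norm d)" by (intro mult_left_mono bound) auto
      finally have 1: "d \<bullet> L d \<le> M * (norm d)\<^sup>2" by (simp add: power2_eq_square mult_ac)
      have "0 \<le> (norm (L z - M *\<^sub>R d))\<^sup>2 / M" using M by simp
      also have "\<dots> = (norm (L z))\<^sup>2 / M - 2 * (L z \<bullet> d) + M * (norm d)\<^sup>2"
        using M by (simp add: power2_norm_eq_inner inner_diff_left inner_diff_right inner_commute diff_divide_distrib add_divide_distrib)
      finally have 2: "0 \<le> (norm (L z))\<^sup>2 / M - 2 * (L z \<bullet> d) + M * (norm d)\<^sup>2" .
      have aux: "(a + 2 * b + c) / 2 - m \<le> (a + A) / 2" if "c \<le> m" "0 \<le> A - 2 * b + m" for a b c m A :: real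
        using that by (simp add: field_simps)
      show ?thesis unfolding q_def by (rule aux[OF 1 2])
    qed
    finally show ?thesis by simp
  qed
  have f0: "0 \<le> f 0"
    using U.u_le_G[of 0 0] W.u_le_G[of 0 0] \<open>0 < r\<close> by (simp add: f_def u0 v0)
  have f_der: "(f has_derivative (\<lambda>h. g z \<bullet> h)) (at z)" for z
  proof -
    have "((\<lambda>z. U.G (fst z)) has_derivative (\<lambda>h. U.grd (fst z) \<bullet> fst h)) (at z)"
      by (rule has_derivative_compose[OF _ U.G_has_derivative, where f=fst]) (auto intro!: derivative_eq_intros)
    moreover have "((\<lambda>z. W.G (snd z)) has_derivative (\<lambda>h. W.grd (snd z) \<bullet> snd h)) (at z)"
      by (rule has_derivative_compose[OF _ W.G_has_derivative, where f=snd]) (auto intro!: derivative_eq_intros)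
    ultimately have "(f has_derivative (\<lambda>h. U.grd (fst z) \<bullet> fst h + W.grd (snd z) \<bullet> snd h)) (at z)"
      unfolding f_def by (rule has_derivative_add)
    then show ?thesis by (simp add: g_def inner_prod_def)
  qed
  have g_lip: "norm (g z - g z') \<le> 20 * l * norm (z - z')" for z z'
  proof -
    have "norm (g z - g z') \<le> norm (U.grd (fst z) - U.grd (fst z')) + norm (W.grd (snd z) - W.grd (snd z'))"
      by (simp add: g_def norm_Pair_le)
    also have "\<dots> \<le> 10 * l * norm (fst z - fst z') + 10 * l * norm (snd z - snd z')"
      by (intro add_mono U.grd_lipschitz W.grd_lipschitz)
    also have "\<dots> \<le> 10 * l * norm (z - z') + 10 * l * norm (z - z')"
      using l norm_fst_le[of "fst z - fst z'" "snd z - snd z'"] norm_snd_le[of "snd z - snd z'" "fst z - fst z'"]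
      by (intro add_mono mult_left_mono) (auto simp: minus_prod_def)
    finally show ?thesis by simp
  qed
  define P where "P = (\<lambda>z. g z - L' z - \<tau> *\<^sub>R z)"
  have L'_le: "norm (L' z) \<le> 2 * M * norm z" for z
  proof -
    have "norm (L (L z)) \<le> M * (M * norm z)"
      using bound[of "L z"] mult_left_mono[OF bound[of z], of M] M by linarith
    then have "norm ((1 / M) *\<^sub>R L (L z)) \<le> M * norm z" using M by (simp add: field_simps)
    then show ?thesis unfolding L'_def using norm_triangle_ineq[of "L z" "(1 / M) *\<^sub>R L (L z)"] bound[of z] by linarith
  qed
  have P_lip: "norm (P z - P z') \<le> (20 * l + 2 * M + \<tau>) * norm (z - z')" for z z'
  proof -
    have "P z - P z' = (g z - g z') - L' (z - z') - \<tau> *\<^sub>R (z - z')"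
      by (simp add: P_def L'_def lin algebra_simps)
    then have "norm (P z - P z') \<le> norm (g z - g z') + norm (L' (z - z')) + norm (\<tau> *\<^sub>R (z - z'))"
      using norm_triangle_ineq4[of "(g z - g z') - L' (z - z')" "\<tau> *\<^sub>R (z - z')"]
        norm_triangle_ineq4[of "g z - g z'" "L' (z - z')"] by simp
    then show ?thesis using g_lip[of z z'] L'_le[of "z - z'"] \<tau> by (simp add: distrib_right)
  qed
  define F where "F = (\<lambda>p z. f z - q z / 2 - \<tau> * (norm z)\<^sup>2 / 2 - p \<bullet> z)"
  have F_max: "\<exists>z. norm z \<le> 2 * norm p / \<tau> \<and> (\<forall>z'. F p z' \<le> F p z)" for p
  proof -
    define R where "R = 2 * norm p / \<tau>"
    have "R \<ge> 0" using \<tau> by (simp add: R_def)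
    have "continuous_on UNIV f"
      using f_der by (meson continuous_at_imp_continuous_on has_derivative_continuous)
    moreover have "continuous_on UNIV L" using L by (rule linear_continuous_on_compose[OF continuous_on_id, simplified])
    ultimately have "continuous_on (cball 0 R) (F p)"
      unfolding F_def q_def by (intro continuous_intros) (auto intro: continuous_on_subset simp: M less_imp_neq[OF M, symmetric])
    then obtain z where z: "z \<in> cball 0 R" "\<And>z'. z' \<in> cball 0 R \<Longrightarrow> F p z' \<le> F p z"
      using continuous_attains_sup[of "cball 0 R" "F p"] \<open>R \<ge> 0\<close> by fastforce
    have "0 \<le> F p 0" using f0 by (simp add: F_def q_def lin)
    also have "\<dots> \<le> F p z" using z(2)[of 0] \<open>R \<ge> 0\<close> by simp
    finally have pos: "0 \<le> F p z" .
    \<comment> \<open>Outside \<open>cball 0 R\<close> the paraboloid outweighs the linear term, so that \<open>F p\<close> is at most zero there.\<close>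
    have all: "F p z' \<le> F p z" for z'
    proof (cases "z' \<in> cball 0 R")
      case False
      then have "2 * norm p < norm z' * \<tau>" using \<tau> by (simp add: R_def field_simps)
      then have "2 * norm p * norm z' \<le> (norm z' * \<tau>) * norm z'" by (intro mult_right_mono) auto
      moreover have "- (p \<bullet> z') \<le> norm p * norm z'" using Cauchy_Schwarz_ineq2[of p z'] by linarith
      ultimately have "F p z' \<le> 0" using f_le[of z'] unfolding F_def power2_eq_square by (simp add: algebra_simps)
      then show ?thesis using pos by simp
    qed (use z in auto)
    show ?thesis
    proof (intro exI conjI allI)
      show "norm z \<le> 2 * norm p / \<tau>" using z(1) by (simp add: R_def)
      show "F p z' \<le> F p z" for z' by (rule all)
    qed
  qed
  have touch: "f (z + h) \<le> f z + g z \<bullet> h + q h / 2 + \<tau> * (norm h)\<^sup>2 / 2" and P_eq: "P z = p"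
    if max: "\<And>z'. F p z' \<le> F p z" for z p h
  proof -
    define b where "b = L' z + \<tau> *\<^sub>R z + p"
    have up: "f (z + h) \<le> f z + b \<bullet> h + q h / 2 + \<tau> * (norm h)\<^sup>2 / 2" for h
    proof -
      have "(norm (z + h))\<^sup>2 = (norm z)\<^sup>2 + 2 * (z \<bullet> h) + (norm h)\<^sup>2"
        by (simp add: power2_norm_eq_inner inner_add_left inner_add_right inner_commute)
      then show ?thesis
        using max[of "z + h"] unfolding F_def q_add b_def inner_add_left inner_add_right
        by (simp add: algebra_simps add_divide_distrib)
    qed
    \<comment> \<open>A differentiable function touched from above by a paraboloid has the same slope.\<close>
    have "g z = b"
    proof -
      define c where "c = (2 * M + \<tau>) / 2"
      have c: "c > 0" using M \<tau> by (simp add: c_def)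
      have up': "f (z + h) - f z \<le> b \<bullet> h + c * (norm h)\<^sup>2" for h
        using up[of h] q_le[of h] by (simp add: c_def field_simps)
      have "norm (g z - b) \<le> e" if "e > 0" for e
      proof (rule ccontr)
        assume "\<not> norm (g z - b) \<le> e"
        then have big: "norm (g z - b) > e" by simp
        obtain d where d: "d > 0" "\<And>y. norm (y - z) < d \<Longrightarrow> norm (f y - f z - g z \<bullet> (y - z)) \<le> (e / 2) * norm (y - z)"
          using f_der[of z] \<open>e > 0\<close> unfolding has_derivative_at_alt by (meson half_gt_zero)
        define n where "n = norm (g z - b)"
        define s where "s = min (d / 2) (e / (4 * c)) / n"
        have "n > 0" using big \<open>e > 0\<close> unfolding n_def by linarith
        have "s > 0" using d \<open>e > 0\<close> c \<open>n > 0\<close> by (simp add: s_def)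
        define h where "h = s *\<^sub>R (g z - b)"
        have nh: "norm h = s * n" using \<open>s > 0\<close> by (simp add: h_def n_def)
        have "s * n = min (d / 2) (e / (4 * c))" using \<open>n > 0\<close> by (simp add: s_def)
        then have nh1: "norm h < d" "norm h \<le> e / (4 * c)" using nh d by auto
        have "norm (f (z + h) - f z - g z \<bullet> h) \<le> e / 2 * norm h" using d(2)[of "z + h"] nh1 by simp
        then have "- (e / 2 * norm h) \<le> f (z + h) - f z - g z \<bullet> h" unfolding real_norm_def abs_le_iff by simp
        with up'[of h] have "g z \<bullet> h - e / 2 * norm h \<le> b \<bullet> h + c * (norm h)\<^sup>2" by simp
        then have "(g z - b) \<bullet> h \<le> e / 2 * norm h + c * norm h * norm h" by (simp add: inner_diff_left power2_eq_square)
        moreover have "c * norm h * norm h \<le> e / 4 * norm h"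
          using nh1(2) c by (intro mult_right_mono) (auto simp: field_simps)
        moreover have "(g z - b) \<bullet> h = n * norm h"
        proof -
          have "(g z - b) \<bullet> h = s * ((g z - b) \<bullet> (g z - b))" by (simp only: h_def inner_scaleR_right)
          also have "(g z - b) \<bullet> (g z - b) = n * n" by (simp add: n_def power2_norm_eq_inner[symmetric] power2_eq_square)
          finally show ?thesis by (simp add: nh)
        qed
        ultimately have "n * norm h \<le> (3 / 4 * e) * norm h" by argo
        then have "n \<le> 3 / 4 * e" using nh \<open>s > 0\<close> \<open>n > 0\<close> by simp
        then show False using big \<open>e > 0\<close> by (simp add: n_def)
      qed
      then have "norm (g z - b) \<le> 0" using field_le_epsilon[of "norm (g z - b)" 0] by simp
      then show ?thesis by simp
    qed
    then show "f (z + h) \<le> f z + g z \<bullet> h + q h / 2 + \<tau> * (norm h)\<^sup>2 / 2" "P z = p"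
      using up by (simp_all add: P_def b_def)
  qed
  \<comment> \<open>All displacements and slopes below turn out smaller than \<open>m * k\<close>, where \<open>m\<close> bounds \<open>norm p\<close>.\<close>
  define k where "k = 1 + 2 / \<tau> + (1 + 6 * M / \<tau>) + (1 + 6 * M / \<tau>) / (4 * M)"
  define m where "m = min \<delta> r / k"
  have k: "0 < k" "2 / \<tau> < k" "1 + 6 * M / \<tau> < k" "2 / \<tau> + (1 + 6 * M / \<tau>) / (4 * M) < k"
    using M \<tau> by (auto simp: k_def add_pos_pos)
  have m: "0 < m" "m * k \<le> \<delta>" "m * k \<le> r" using k \<open>0 < \<delta>\<close> \<open>0 < r\<close> by (auto simp: m_def)
  define K where "K = {z. \<exists>p. norm p < m \<and> norm z \<le> 2 * norm p / \<tau> \<and> (\<forall>z'. F p z' \<le> F p z)}"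
  have "\<exists>z\<in>K. g differentiable (at z)"
  proof (rule ccontr)
    assume "\<not> (\<exists>z\<in>K. g differentiable (at z))"
    then have "K \<subseteq> {z. \<not> g differentiable (at z)}" by blast
    moreover have "(20 * l)-lipschitz_on UNIV g"
      using g_lip l by (intro lipschitz_onI) (auto simp: dist_norm)
    ultimately have "negligible K" using rademacher negligible_subset by blast
    then have "negligible (P ` K)"
    proof (rule negligible_locally_Lipschitz_image[rotated])
      fix z assume "z \<in> K"
      show "\<exists>T B. open T \<and> z \<in> T \<and> (\<forall>y\<in>K \<inter> T. norm (P y - P z) \<le> B * norm (y - z))"
        using P_lip by (intro exI[of _ UNIV] exI[of _ "20 * l + 2 * M + \<tau>"]) auto
    qed simp
    moreover have "ball 0 m \<subseteq> P ` K"
    proof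
      fix p assume "p \<in> ball (0 :: 'a \<times> 'b) m"
      then have pm: "norm p < m" by simp
      obtain z where z: "norm z \<le> 2 * norm p / \<tau>" "\<And>z'. F p z' \<le> F p z"
        using F_max[of p] by blast
      have "z \<in> K" using pm z unfolding K_def by blast
      moreover have "P z = p" using z(2) by (rule P_eq)
      ultimately show "p \<in> P ` K" by blast
    qed
    ultimately have "negligible (ball (0 :: 'a \<times> 'b) m)" by (rule negligible_subset)
    then show False using m open_not_negligible[of "ball (0 :: 'a \<times> 'b) m"] by simp
  qed
  then obtain z p where p: "norm p < m" and z: "norm z \<le> 2 * norm p / \<tau>" "\<And>z'. F p z' \<le> F p z"
      and diff: "g differentiable (at z)"
    unfolding K_def by blast
  note touch = touch[OF z(2)] and P_eq = P_eq[OF z(2)]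
  define z1 z2 where "z1 = fst z" and "z2 = snd z"
  obtain D where D: "(g has_derivative D) (at z)" using diff unfolding differentiable_def by blast
  define X where "X = (\<lambda>h. fst (D (h, 0)))"
  define Y where "Y = (\<lambda>h. snd (D (0, h)))"
  have derX: "(U.grd has_derivative X) (at z1)"
  proof -
    have "((\<lambda>x. (x, z2)) has_derivative (\<lambda>h. (h, 0))) (at z1)" by (auto intro!: derivative_eq_intros)
    moreover have "(g has_derivative D) (at (z1, z2))" using D by (simp add: z1_def z2_def)
    ultimately have "((\<lambda>x. g (x, z2)) has_derivative (\<lambda>h. D (h, 0))) (at z1)" by (rule has_derivative_compose)
    from has_derivative_fst[OF this] show ?thesis by (simp add: g_def X_def)
  qed
  have derY: "(W.grd has_derivative Y) (at z2)"
  proof -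
    have "((\<lambda>x. (z1, x)) has_derivative (\<lambda>h. (0, h))) (at z2)" by (auto intro!: derivative_eq_intros)
    moreover have "(g has_derivative D) (at (z1, z2))" using D by (simp add: z1_def z2_def)
    ultimately have "((\<lambda>x. g (z1, x)) has_derivative (\<lambda>h. D (0, h))) (at z2)" by (rule has_derivative_compose)
    from has_derivative_snd[OF this] show ?thesis by (simp add: g_def Y_def)
  qed
  have linX: "linear X" and linY: "linear Y" using derX derY by (auto intro: has_derivative_linear)
  have touchU: "U.G (z1 + h) \<le> U.G z1 + U.grd z1 \<bullet> h + (2 * M + \<tau>) / 2 * (norm h)\<^sup>2" for h
    using touch[of "(h, 0)"] q_le[of "(h, 0)"] by (simp add: f_def g_def z1_def inner_prod_def field_simps)
  have touchW: "W.G (z2 + h) \<le> W.G z2 + W.grd z2 \<bullet> h + (2 * M + \<tau>) / 2 * (norm h)\<^sup>2" for h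
    using touch[of "(0, h)"] q_le[of "(0, h)"] by (simp add: f_def g_def z2_def inner_prod_def field_simps)
  have kap: "2 * M + \<tau> < 2 * l" using M \<tau> by (simp add: l_def)
  define x where "x = z1 + (1 / (2 * l)) *\<^sub>R U.grd z1"
  define y where "y = z2 + (1 / (2 * l)) *\<^sub>R W.grd z2"
  have nz: "norm z \<le> m * (2 / \<tau>)"
  proof -
    have "2 * norm p / \<tau> \<le> 2 * m / \<tau>" using p \<tau> by (intro divide_right_mono) auto
    then show ?thesis using z(1) by (simp add: field_simps)
  qed
  have ng: "norm (g z) < m * (1 + 6 * M / \<tau>)"
  proof -
    have "g z = p + L' z + \<tau> *\<^sub>R z" using P_eq by (simp add: P_def algebra_simps)
    then have "norm (g z) \<le> norm p + norm (L' z) + norm (\<tau> *\<^sub>R z)"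
      using norm_triangle_ineq[of "p + L' z" "\<tau> *\<^sub>R z"] norm_triangle_ineq[of p "L' z"] by simp
    also have "\<dots> < m + 2 * M * norm z + M * norm z"
      using p L'_le[of z] \<tau> mult_right_mono[of \<tau> M "norm z"] by simp
    also have "\<dots> \<le> m + 3 * M * (m * (2 / \<tau>))"
      using mult_left_mono[OF nz, of "3 * M"] M by simp
    finally show ?thesis by (simp add: algebra_simps)
  qed
  have comp: "norm z1 \<le> norm z" "norm z2 \<le> norm z" "norm (U.grd z1) \<le> norm (g z)" "norm (W.grd z2) \<le> norm (g z)"
    using norm_fst_le[of z1 z2] norm_snd_le[of z2 z1] norm_fst_le[of "U.grd z1" "W.grd z2"] norm_snd_le[of "W.grd z2" "U.grd z1"]
    by (auto simp: z1_def z2_def g_def)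
  have small_pt: "norm (a + (1 / (2 * l)) *\<^sub>R b) < m * k" if "norm a \<le> norm z" "norm b \<le> norm (g z)" for a :: "'c::real_normed_vector" and b
  proof -
    have "norm (a + (1 / (2 * l)) *\<^sub>R b) \<le> norm a + norm b / (4 * M)"
      using norm_triangle_ineq[of a "(1 / (2 * l)) *\<^sub>R b"] M by (simp add: l_def)
    also have "\<dots> \<le> m * (2 / \<tau>) + m * (1 + 6 * M / \<tau>) / (4 * M)"
      using that nz ng M by (intro add_mono divide_right_mono) auto
    also have "\<dots> = m * (2 / \<tau> + (1 + 6 * M / \<tau>) / (4 * M))" by (simp add: distrib_left)
    also have "\<dots> < m * k" using k m by (intro mult_strict_left_mono) auto
    finally show ?thesis .
  qed
  have nx: "norm x < m * k" "norm y < m * k"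
    unfolding x_def y_def using comp by (auto intro!: small_pt)
  have np: "norm (U.grd z1) < \<delta>" "norm (W.grd z2) < \<delta>"
  proof -
    have "m * (1 + 6 * M / \<tau>) < m * k" using k m by (intro mult_strict_left_mono) auto
    then have "norm (g z) < \<delta>" by (rule less_le_trans[OF less_trans[OF ng] m(2)])
    then show "norm (U.grd z1) < \<delta>" "norm (W.grd z2) < \<delta>" using comp by linarith+
  qed
  have xB: "x + h \<in> cball 0 r" if "norm h < r - norm x" for h
    using norm_triangle_ineq[of x h] that by simp
  have yB: "y + h \<in> cball 0 r" if "norm h < r - norm y" for h
    using norm_triangle_ineq[of y h] that by simp
  have rx: "0 < r - norm x" and ry: "0 < r - norm y" using nx m by auto
  note jetU = U.jet_at_contact[OF touchU kap derX, of "r - norm x", folded x_def, OF rx xB]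
  note jetW = W.jet_at_contact[OF touchW kap derY, of "r - norm y", folded y_def, OF ry yB]
  have sx: "superjet u x (U.grd z1) X" by (rule jetU(1))
  have sy: "superjet v y (W.grd z2) Y" by (rule jetW(1))
  have lowX: "- 4 * M * (norm h)\<^sup>2 \<le> X h \<bullet> h" for h using jetU(2)[of h] by (simp add: l_def)
  have lowY: "- 4 * M * (norm h)\<^sup>2 \<le> Y h \<bullet> h" for h using jetW(2)[of h] by (simp add: l_def)
  have derg: "(g has_derivative (\<lambda>h. (X (fst h), Y (snd h)))) (at z)"
  proof -
    have "((\<lambda>z. U.grd (fst z)) has_derivative (\<lambda>h. X (fst h))) (at z)"
      by (rule has_derivative_compose[of fst fst, OF _ derX[unfolded z1_def]]) (auto intro!: derivative_eq_intros)
    moreover have "((\<lambda>z. W.grd (snd z)) has_derivative (\<lambda>h. Y (snd h))) (at z)"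
      by (rule has_derivative_compose[of snd snd, OF _ derY[unfolded z2_def]]) (auto intro!: derivative_eq_intros)
    ultimately show ?thesis unfolding g_def by (rule has_derivative_Pair)
  qed
  have main: "(X (fst h), Y (snd h)) \<bullet> h \<le> q h + \<tau> * (norm h)\<^sup>2" for h
  proof (rule quadratic_le_of_local[of "\<lambda>h. (X (fst h), Y (snd h)) \<bullet> h" "\<lambda>h. q h + \<tau> * (norm h)\<^sup>2"])
    fix \<epsilon> :: real assume "\<epsilon> > 0"
    then have "\<epsilon> / 2 > 0" by simp
    then obtain s where s: "s > 0" "\<And>h. norm h < s \<Longrightarrow> \<bar>f (z + h) - (f z + g z \<bullet> h + (X (fst h), Y (snd h)) \<bullet> h / 2)\<bar> \<le> \<epsilon> / 2 * (norm h)\<^sup>2"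
      using second_order_expansion[OF f_der derg] by blast
    have "(X (fst h), Y (snd h)) \<bullet> h \<le> (q h + \<tau> * (norm h)\<^sup>2) + \<epsilon> * (norm h)\<^sup>2" if "norm h < s" for h
      using s(2)[OF that] touch[of h] by (simp add: abs_le_iff field_simps)
    then show "\<exists>r>0. \<forall>h. norm h < r \<longrightarrow> (X (fst h), Y (snd h)) \<bullet> h \<le> (q h + \<tau> * (norm h)\<^sup>2) + \<epsilon> * (norm h)\<^sup>2" using s(1) by blast
  qed (auto simp: linear_scale[OF linX] linear_scale[OF linY] q_scale power_mult_distrib power2_eq_square inner_prod_def algebra_simps)
  have main': "X h \<bullet> h + Y k \<bullet> k \<le> (h, k) \<bullet> L (h, k) + (norm (L (h, k)))\<^sup>2 / M + \<tau> * (norm (h, k))\<^sup>2" for h k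
    using main[of "(h, k)"] by (simp add: q_def inner_prod_def)
  have "norm x < \<delta>" "norm y < \<delta>" using nx m by auto
  from that[OF this np linX linY sx sy lowX lowY main'] show thesis .
qed

section \<open>Symmetric matrices and orthogonal projections\<close>

lemma sym_matrix_inner: "X \<in> sym_matrices \<Longrightarrow> (X *v x) \<bullet> y = x \<bullet> (X *v y)"
  unfolding sym_matrices_def by (metis (mono_tags, lifting) dot_lmul_matrix mem_Collect_eq vector_transpose_matrix)

lemma sym_matricesI: "(\<And>x y. (X *v x) \<bullet> y = x \<bullet> (X *v y)) \<Longrightarrow> X \<in> sym_matrices"
proof -
  assume *: "\<And>x y. (X *v x) \<bullet> y = x \<bullet> (X *v y)"
  have "transpose X *v x = X *v x" for x
  proof (rule vector_eq_ldot[THEN iffD1], intro allI)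
    fix y
    have "y \<bullet> (transpose X *v x) = (y v* transpose X) \<bullet> x" by (rule dot_lmul_matrix[symmetric])
    also have "\<dots> = y \<bullet> (X *v x)" by (simp add: vector_transpose_matrix *)
    finally show "y \<bullet> (transpose X *v x) = y \<bullet> (X *v x)" .
  qed
  then show ?thesis unfolding sym_matrices_def by (simp add: matrix_eq)
qed

lemma sym_matrices_closed_ops:
  "X \<in> sym_matrices \<Longrightarrow> Y \<in> sym_matrices \<Longrightarrow> X + Y \<in> sym_matrices"
  "X \<in> sym_matrices \<Longrightarrow> Y \<in> sym_matrices \<Longrightarrow> X - Y \<in> sym_matrices"
  "X \<in> sym_matrices \<Longrightarrow> c *\<^sub>R X \<in> sym_matrices"
  by (auto simp: sym_matrices_def transpose_def vec_eq_iff)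

lemma mat_1_sym: "mat 1 \<in> sym_matrices"
  by (simp add: sym_matrices_def transpose_mat)

definition outer :: "real^'n \<Rightarrow> real^'n^'n" where
  "outer c = (\<chi> i j. c $ i * c $ j)"

lemma outer_mult: "outer c *v h = (c \<bullet> h) *\<^sub>R c"
  by (simp add: vec_eq_iff outer_def matrix_vector_mult_def inner_vec_def sum_distrib_left sum_distrib_right mult_ac)

lemma outer_sym: "outer c \<in> sym_matrices"
  by (simp add: sym_matrices_def transpose_def outer_def vec_eq_iff mult.commute)

lemma matrix_works_linear: "linear f \<Longrightarrow> matrix f *v x = f x" for f :: "real^'n \<Rightarrow> real^'m"
  by (metis matrix_vector_mul(2))

lemma orth_proj_spec:
  assumes V: "subspace V"
  shows "orth_proj V *v x \<in> V" "z \<in> V \<Longrightarrow> (x - orth_proj V *v x) \<bullet> z = 0"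
proof -
  define P where "P = (\<lambda>x y. y \<in> V \<and> (\<forall>z\<in>V. orthogonal (x - y) z))"
  define f where "f = (\<lambda>x. THE y. P x y)"
  have ex1: "\<exists>!y. P x y" for x
  proof -
    obtain y z where yz: "y \<in> span V" "\<And>w. w \<in> span V \<Longrightarrow> orthogonal z w" "x = y + z"
      using orthogonal_subspace_decomp_exists[of V x] by blast
    have "span V = V" using V by (simp add: span_eq_iff)
    note yz = yz[unfolded this]
    have "x - y = z" using yz(3) by simp
    then have "P x y" unfolding P_def using yz(1,2) by auto
    moreover have "y' = y" if "P x y'" for y'
    proof -
      have "y' - y \<in> V" using that \<open>P x y\<close> V by (simp add: P_def subspace_diff)
      then have "(x - y) \<bullet> (y' - y) = 0" "(x - y') \<bullet> (y' - y) = 0"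
        using that \<open>P x y\<close> by (auto simp: P_def orthogonal_def)
      then have "(y' - y) \<bullet> (y' - y) = 0" by (simp add: inner_diff_left)
      then show ?thesis by simp
    qed
    ultimately show ?thesis by blast
  qed
  have Pf: "P x (f x)" for x unfolding f_def by (rule theI'[OF ex1])
  have fI: "f x = y" if "P x y" for x y using that ex1 Pf by blast
  have "linear f"
  proof (rule linearI)
    fix x y c
    have "P (x + y) (f x + f y)"
      using Pf[of x] Pf[of y] V unfolding P_def
      by (auto simp: subspace_add orthogonal_def inner_diff_left inner_add_left)
    then show "f (x + y) = f x + f y" by (rule fI)
    have "P (c *\<^sub>R x) (c *\<^sub>R f x)"
      using Pf[of x] V unfolding P_def
      by (auto simp: subspace_scale orthogonal_def inner_diff_left)
    then show "f (c *\<^sub>R x) = c *\<^sub>R f x" by (rule fI)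
  qed
  then have "matrix f *v x = f x" for x by (rule matrix_works_linear)
  moreover have "orth_proj V = matrix f" by (simp add: orth_proj_def f_def[abs_def] P_def)
  ultimately have "orth_proj V *v x = f x" for x by simp
  then show "orth_proj V *v x \<in> V" "z \<in> V \<Longrightarrow> (x - orth_proj V *v x) \<bullet> z = 0"
    using Pf[of x] by (auto simp: P_def orthogonal_def)
qed

text \<open>A symmetric matrix that vanishes on the orthogonal complement of \<open>V\<close> has its range in \<open>V\<close>. This
  description, unlike the one by projections, is stable under sums and easy to test.\<close>
lemma sym_sub_iff:
  assumes V: "subspace V"
  shows "X \<in> sym_sub V \<longleftrightarrow> X \<in> sym_matrices \<and> (\<forall>h. (\<forall>z\<in>V. h \<bullet> z = 0) \<longrightarrow> X *v h = 0)"
proof safe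
  assume X: "X \<in> sym_sub V"
  then show "X \<in> sym_matrices" by (simp add: sym_sub_def)
  fix h assume h: "\<forall>z\<in>V. h \<bullet> z = 0"
  define y where "y = orth_proj V *v h"
  have "y \<in> V" unfolding y_def by (rule orth_proj_spec[OF V])
  then have "y \<bullet> y = 0" using orth_proj_spec(2)[OF V, of y h] h by (simp add: y_def inner_diff_left)
  then have "y = 0" by simp
  have "X *v h = (orth_proj V ** X ** orth_proj V) *v h" using X by (simp add: sym_sub_def)
  also have "\<dots> = orth_proj V *v (X *v y)" by (simp add: y_def matrix_vector_mul_assoc matrix_mul_assoc)
  finally show "X *v h = 0" using \<open>y = 0\<close> by simp
next
  assume X: "X \<in> sym_matrices" and kill: "\<forall>h. (\<forall>z\<in>V. h \<bullet> z = 0) \<longrightarrow> X *v h = 0"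
  have XP: "X *v (orth_proj V *v x) = X *v x" for x
  proof -
    have "X *v (x - orth_proj V *v x) = 0" using kill orth_proj_spec(2)[OF V, of _ x] by blast
    then show ?thesis by (simp add: matrix_vector_mult_diff_distrib)
  qed
  have PX: "orth_proj V *v (X *v x) = X *v x" for x
  proof -
    define h where "h = X *v x - orth_proj V *v (X *v x)"
    have orth: "h \<bullet> z = 0" if "z \<in> V" for z unfolding h_def by (rule orth_proj_spec(2)[OF V that])
    then have "X *v h = 0" using kill by blast
    have "h \<bullet> h = h \<bullet> (X *v x) - h \<bullet> (orth_proj V *v (X *v x))" by (simp add: h_def inner_diff_right)
    also have "h \<bullet> (orth_proj V *v (X *v x)) = 0" by (intro orth orth_proj_spec[OF V])
    also have "h \<bullet> (X *v x) = (X *v h) \<bullet> x" by (simp add: sym_matrix_inner[OF X])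
    finally have "h \<bullet> h = 0" using \<open>X *v h = 0\<close> by simp
    then show ?thesis by (simp add: h_def)
  qed
  have "(orth_proj V ** X ** orth_proj V) *v x = X *v x" for x
    by (simp add: matrix_vector_mul_assoc[symmetric] XP PX)
  then have "orth_proj V ** X ** orth_proj V = X" unfolding matrix_eq by blast
  then show "X \<in> sym_sub V" using X by (simp add: sym_sub_def)
qed

section \<open>Interpolating symmetric matrices\<close>

text \<open>With \<open>c = Z *v w\<close> and \<open>a = w \<bullet> c < 0\<close>, the Schur complement \<open>Z - c c\<^sup>T / a\<close> vanishes at \<open>w\<close>, and
  its form at \<open>h\<close> is the maximum of the form of \<open>Z\<close> over the line \<open>h + span {w}\<close>. As that line stays in
  the coset \<open>h + W\<close>, the bound by \<open>Y\<close> persists. For \<open>a = 0\<close> the form of \<open>Z\<close> is affine and bounded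
  above on these lines, which forces \<open>c = 0\<close>.\<close>
lemma schur_step:
  fixes Z Y :: "real^'n^'n"
  assumes Z: "Z \<in> sym_matrices" and W: "subspace W" "w \<in> W"
    and le: "\<And>h k. h - k \<in> W \<Longrightarrow> h \<bullet> (Z *v h) \<le> k \<bullet> (Y *v k)"
  shows "\<exists>Z'\<in>sym_matrices. (\<forall>h. h \<bullet> (Z *v h) \<le> h \<bullet> (Z' *v h)) \<and>
     (\<forall>h k. h - k \<in> W \<longrightarrow> h \<bullet> (Z' *v h) \<le> k \<bullet> (Y *v k)) \<and> Z' *v w = 0 \<and> (\<forall>h. Z *v h = 0 \<longrightarrow> Z' *v h = 0)"
proof -
  define c where "c = Z *v w"
  define a where "a = w \<bullet> c"
  have "a \<le> 0" using le[of w 0] W by (simp add: a_def c_def)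
  have expand: "(h + t *\<^sub>R w) \<bullet> (Z *v (h + t *\<^sub>R w)) = h \<bullet> (Z *v h) + 2 * t * (c \<bullet> h) + t\<^sup>2 * a" for h t
    using sym_matrix_inner[OF Z, of w h]
    by (simp add: a_def c_def matrix_vector_right_distrib matrix_vector_mult_scaleR inner_add_left inner_add_right
        inner_commute power2_eq_square algebra_simps)
  have shift: "h + t *\<^sub>R w - k \<in> W" if "h - k \<in> W" for h k t
    using subspace_add[OF W(1) that subspace_scale[OF W(1,2), of t]] by (simp add: algebra_simps)
  show ?thesis
  proof (cases "a = 0")
    case True
    have "c \<bullet> h = 0" for h
    proof (rule ccontr)
      assume ne: "c \<bullet> h \<noteq> 0"
      \<comment> \<open>The point of the line where the affine function exceeds its bound by one.\<close>
      define t where "t = (h \<bullet> (Y *v h) - h \<bullet> (Z *v h) + 1) / (2 * (c \<bullet> h))"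
      have "h \<bullet> (Z *v h) + 2 * t * (c \<bullet> h) \<le> h \<bullet> (Y *v h)"
        using le[OF shift[of h h t]] expand[of h t] True W by (simp add: subspace_0)
      moreover have "2 * t * (c \<bullet> h) = h \<bullet> (Y *v h) - h \<bullet> (Z *v h) + 1" using ne by (simp add: t_def)
      ultimately show False by simp
    qed
    then have "c = 0" using inner_eq_zero_iff by blast
    then show ?thesis using Z le by (intro bexI[of _ Z]) (auto simp: c_def)
  next
    case False
    then have "a < 0" using \<open>a \<le> 0\<close> by simp
    define Z' where "Z' = Z - (1 / a) *\<^sub>R outer c"
    have Z'h: "Z' *v h = Z *v h - ((c \<bullet> h) / a) *\<^sub>R c" for h
      by (simp add: Z'_def matrix_vector_mult_diff_rdistrib scaleR_matrix_vector_assoc[symmetric] outer_mult)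
    have quad: "h \<bullet> (Z' *v h) = h \<bullet> (Z *v h) - (c \<bullet> h)\<^sup>2 / a" for h
      by (simp add: Z'h inner_diff_right inner_commute power2_eq_square)
    have quad': "h \<bullet> (Z' *v h) = (h + (- (c \<bullet> h) / a) *\<^sub>R w) \<bullet> (Z *v (h + (- (c \<bullet> h) / a) *\<^sub>R w))" for h
      unfolding expand quad using \<open>a < 0\<close> by (simp add: power2_eq_square field_simps)
    have "Z' \<in> sym_matrices"
      unfolding Z'_def by (intro sym_matrices_closed_ops outer_sym Z)
    moreover have "h \<bullet> (Z *v h) \<le> h \<bullet> (Z' *v h)" for h
      unfolding quad using \<open>a < 0\<close> by (simp add: divide_nonneg_neg)
    moreover have "h \<bullet> (Z' *v h) \<le> k \<bullet> (Y *v k)" if "h - k \<in> W" for h k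
      unfolding quad' by (intro le shift that)
    moreover have "Z' *v w = 0" using \<open>a < 0\<close> by (simp add: Z'h c_def[symmetric]) (simp add: a_def inner_commute)
    moreover have "Z' *v h = 0" if "Z *v h = 0" for h
      using that sym_matrix_inner[OF Z, of w h] by (simp add: Z'h c_def)
    ultimately show ?thesis by blast
  qed
qed

text \<open>If the form of \<open>X\<close> lies below that of \<open>Y\<close> even after moving the argument along \<open>W\<close>, then a
  symmetric matrix that vanishes on \<open>W\<close> fits between them: eliminate the vectors of a basis of \<open>W\<close> one
  at a time.\<close>
lemma interpolating_matrix:
  fixes X Y :: "real^'n^'n"
  assumes X: "X \<in> sym_matrices" and W: "subspace W"
    and le: "\<And>h k. h - k \<in> W \<Longrightarrow> h \<bullet> (X *v h) \<le> k \<bullet> (Y *v k)"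
  shows "\<exists>Z\<in>sym_matrices. (\<forall>h. h \<bullet> (X *v h) \<le> h \<bullet> (Z *v h)) \<and> (\<forall>h. h \<bullet> (Z *v h) \<le> h \<bullet> (Y *v h)) \<and> (\<forall>w\<in>W. Z *v w = 0)"
proof -
  have step: "\<exists>Z\<in>sym_matrices. (\<forall>h. h \<bullet> (X *v h) \<le> h \<bullet> (Z *v h)) \<and>
     (\<forall>h k. h - k \<in> W \<longrightarrow> h \<bullet> (Z *v h) \<le> k \<bullet> (Y *v k)) \<and> (\<forall>w\<in>S. Z *v w = 0)" if "finite S" "S \<subseteq> W" for S
    using that
  proof (induction S rule: finite_induct)
    case empty
    then show ?case using X le by (intro bexI[of _ X]) auto
  next
    case (insert w S)
    then obtain Z where Z: "Z \<in> sym_matrices" "\<And>h. h \<bullet> (X *v h) \<le> h \<bullet> (Z *v h)"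
      "\<And>h k. h - k \<in> W \<Longrightarrow> h \<bullet> (Z *v h) \<le> k \<bullet> (Y *v k)" "\<And>w. w \<in> S \<Longrightarrow> Z *v w = 0"
      by blast
    have "w \<in> W" using insert by simp
    obtain Z' where "Z' \<in> sym_matrices" "\<And>h. h \<bullet> (Z *v h) \<le> h \<bullet> (Z' *v h)"
      "\<And>h k. h - k \<in> W \<Longrightarrow> h \<bullet> (Z' *v h) \<le> k \<bullet> (Y *v k)" "Z' *v w = 0" "\<And>h. Z *v h = 0 \<Longrightarrow> Z' *v h = 0"
      using schur_step[OF Z(1) W \<open>w \<in> W\<close> Z(3)] by blast
    then show ?case using Z order_trans[OF Z(2)] by (intro bexI[of _ Z']) auto
  qed
  obtain S where S: "S \<subseteq> W" "independent S" "W \<subseteq> span S" "card S = dim W"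
    by (rule basis_exists)
  obtain Z where Z: "Z \<in> sym_matrices" "\<And>h. h \<bullet> (X *v h) \<le> h \<bullet> (Z *v h)"
      "\<And>h k. h - k \<in> W \<Longrightarrow> h \<bullet> (Z *v h) \<le> k \<bullet> (Y *v k)" "\<And>w. w \<in> S \<Longrightarrow> Z *v w = 0"
    using step[OF independent_imp_finite[OF S(2)] S(1)] by blast
  have "subspace {w. Z *v w = 0}"
    by (auto simp: subspace_def matrix_vector_right_distrib matrix_vector_mult_scaleR)
  then have "span S \<subseteq> {w. Z *v w = 0}" using Z(4) by (intro span_minimal) auto
  then have "\<forall>w\<in>W. Z *v w = 0" using S by blast
  moreover have "h \<bullet> (Z *v h) \<le> h \<bullet> (Y *v h)" for h using Z(3)[of h h] W by (simp add: subspace_0)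
  ultimately show ?thesis using Z by blast
qed

section \<open>Tangent spaces of the dual norm and compatibility\<close>

definition tang_space :: "real^'n \<Rightarrow> (real^'n \<Rightarrow> real) \<Rightarrow> (real^'n) set" where
  "tang_space p \<phi> = {a + b |a b. a \<in> span {p} \<and> b \<in> tang p \<phi>}"

lemma subspace_tang_space: "subspace (tang_space p \<phi>)"
proof -
  have "subspace (tang p \<phi>)"
    by (auto simp: subspace_def tang_def inner_add_left)
  then show ?thesis
    unfolding tang_space_def by (intro subspace_sums) auto
qed

lemma sym_tang_iff:
  "X \<in> sym_tang p \<phi> \<longleftrightarrow> X \<in> sym_matrices \<and> (\<forall>h. (\<forall>z\<in>tang_space p \<phi>. h \<bullet> z = 0) \<longrightarrow> X *v h = 0)"
  unfolding sym_tang_def tang_space_def[symmetric] by (rule sym_sub_iff[OF subspace_tang_space])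

lemma finsler_norm_lower_bound:
  fixes \<phi> :: "real^'n \<Rightarrow> real"
  assumes \<phi>: "finsler_norm \<phi>"
  obtains m where "0 < m" "\<And>q. m * norm q \<le> \<phi> q"
proof -
  obtain q0 where q0: "\<forall>q. q \<noteq> 0 \<longrightarrow> \<phi> q0 / norm q0 \<le> \<phi> q / norm q" "0 < \<phi> q0 / norm q0"
    using \<phi> unfolding finsler_norm_def by blast
  have "\<phi> q0 / norm q0 * norm q \<le> \<phi> q" for q
  proof (cases "q = 0")
    case True
    then show ?thesis using \<phi> by (simp add: finsler_norm_def)
  next
    case False
    then show ?thesis using q0(1) by (simp add: le_divide_eq)
  qed
  then show thesis using q0(2) that by blast
qed

lemma dual_norm_scale:
  fixes \<phi> :: "real^'n \<Rightarrow> real"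
  assumes \<phi>: "finsler_norm \<phi>" and c: "0 < c"
  shows "dual_norm \<phi> (c *\<^sub>R p) = c * dual_norm \<phi> p"
proof -
  obtain m where m: "0 < m" "\<And>q. m * norm q \<le> \<phi> q"
    using finsler_norm_lower_bound[OF \<phi>] by blast
  have bdd: "bdd_above ((\<lambda>q. (p \<bullet> q) / \<phi> q) ` {q. q \<noteq> 0})" for p :: "real^'n"
  proof (rule bdd_aboveI2)
    fix q :: "real^'n" assume "q \<in> {q. q \<noteq> 0}"
    then have "norm q > 0" by simp
    then have "\<phi> q > 0" using m(2)[of q] mult_pos_pos[OF m(1) \<open>norm q > 0\<close>] by linarith
    have "p \<bullet> q \<le> norm p * norm q" by (rule norm_cauchy_schwarz)
    also have "\<dots> \<le> norm p * (\<phi> q / m)" using m by (intro mult_left_mono) (auto simp: le_divide_eq mult.commute)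
    finally show "(p \<bullet> q) / \<phi> q \<le> norm p / m" using \<open>\<phi> q > 0\<close> by (simp add: divide_le_eq)
  qed
  have ne: "{q::real^'n. q \<noteq> 0} \<noteq> {}"
  proof -
    have "axis undefined 1 \<noteq> (0::real^'n)" by (simp add: axis_eq_0_iff)
    then show ?thesis by blast
  qed
  have le: "dual_norm \<phi> (c *\<^sub>R p) \<le> c * dual_norm \<phi> p" if "0 < c" for c p
    unfolding dual_norm_def
  proof (rule cSUP_least[OF ne])
    fix q :: "real^'n" assume "q \<in> {q. q \<noteq> 0}"
    then have "(p \<bullet> q) / \<phi> q \<le> (SUP q\<in>{q. q \<noteq> 0}. (p \<bullet> q) / \<phi> q)" by (intro cSUP_upper bdd)
    then have "c * ((p \<bullet> q) / \<phi> q) \<le> c * (SUP q\<in>{q. q \<noteq> 0}. (p \<bullet> q) / \<phi> q)" using that by (intro mult_left_mono) auto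
    then show "(c *\<^sub>R p \<bullet> q) / \<phi> q \<le> c * (SUP q\<in>{q. q \<noteq> 0}. (p \<bullet> q) / \<phi> q)" by simp
  qed
  have "dual_norm \<phi> ((1 / c) *\<^sub>R (c *\<^sub>R p)) \<le> (1 / c) * dual_norm \<phi> (c *\<^sub>R p)"
    using c by (intro le) auto
  then have "c * dual_norm \<phi> p \<le> dual_norm \<phi> (c *\<^sub>R p)" using c by (simp add: field_simps)
  then show ?thesis using le[OF c, of p] by simp
qed

text \<open>The dual norm is positively homogeneous, so its subdifferential is constant along rays. Hence passing
  from a norm to an increasing function of it, which rescales the gradient, does not change the space.\<close>
lemma tang_space_scale:
  assumes \<phi>: "finsler_norm \<phi>" and c: "0 < c"
  shows "tang_space (c *\<^sub>R p) \<phi> = tang_space p \<phi>"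
proof -
  have sub: "subdifferential (dual_norm \<phi>) p \<subseteq> subdifferential (dual_norm \<phi>) (c *\<^sub>R p)" if "0 < c" for c p
  proof
    fix q assume q: "q \<in> subdifferential (dual_norm \<phi>) p"
    show "q \<in> subdifferential (dual_norm \<phi>) (c *\<^sub>R p)"
      unfolding subdifferential_def
    proof (intro CollectI allI)
      fix p'
      have "dual_norm \<phi> p + q \<bullet> ((1 / c) *\<^sub>R p' - p) \<le> dual_norm \<phi> ((1 / c) *\<^sub>R p')"
        using q by (simp add: subdifferential_def)
      also have "\<dots> = (1 / c) * dual_norm \<phi> p'" using that by (intro dual_norm_scale \<phi>) auto
      finally have "c * (dual_norm \<phi> p + q \<bullet> ((1 / c) *\<^sub>R p' - p)) \<le> c * ((1 / c) * dual_norm \<phi> p')"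
        using that by (intro mult_left_mono) auto
      then show "dual_norm \<phi> (c *\<^sub>R p) + q \<bullet> (p' - c *\<^sub>R p) \<le> dual_norm \<phi> p'"
        using that by (simp add: dual_norm_scale[OF \<phi> that] inner_diff_right algebra_simps)
    qed
  qed
  have "subdifferential (dual_norm \<phi>) (c *\<^sub>R p) \<subseteq> subdifferential (dual_norm \<phi>) ((1 / c) *\<^sub>R (c *\<^sub>R p))"
    using c by (intro sub) auto
  then have "subdifferential (dual_norm \<phi>) (c *\<^sub>R p) = subdifferential (dual_norm \<phi>) p"
    using sub[OF c, of p] c by auto
  moreover have "span {c *\<^sub>R p} = span {p}"
    using c by (intro span_image_scale[of "{p}" "\<lambda>_. c", simplified]) auto
  ultimately show ?thesis unfolding tang_space_def tang_def by simp
qed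

text \<open>This is how compatibility enters. The right-hand side of the inequality vanishes when \<open>h - k\<close> lies in the
  space \<open>W\<close> orthogonal to \<open>tang_space p \<phi>\<close>, since \<open>C\<close> kills \<open>W\<close>. So there is a matrix \<open>Z\<close> in
  \<open>sym_tang p \<phi>\<close> with \<open>X \<le> Z \<le> Y\<close>. The two operators agree at \<open>Z\<close>, and monotonicity gives
  \<open>Fup p X \<le> Fup p Z = Flo p Z \<le> Flo p Y\<close>.\<close>
lemma F_le_of_form_inequality:
  fixes Fup Flo :: "real^'n \<Rightarrow> real^'n^'n \<Rightarrow> real"
  assumes mono: "\<forall>p. \<forall>X\<in>sym_matrices. \<forall>Y\<in>sym_matrices. psd Y \<longrightarrow> Fup p (X + Y) \<ge> Fup p X \<and> Flo p (X + Y) \<ge> Flo p X"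
    and comp: "compatible Fup Flo \<phi>"
    and X: "X \<in> sym_matrices" and Y: "Y \<in> sym_matrices" and C: "C \<in> sym_tang p \<phi>"
    and le: "\<And>h k. h \<bullet> (X *v h) - k \<bullet> (Y *v k) \<le> (h - k) \<bullet> (C *v (h - k)) + (norm (C *v (h - k)))\<^sup>2"
  shows "Fup p X \<le> Flo p Y"
proof -
  define W where "W = {h. \<forall>z\<in>tang_space p \<phi>. h \<bullet> z = 0}"
  have W: "subspace W" by (auto simp: W_def subspace_def inner_add_left)
  have "h \<bullet> (X *v h) \<le> k \<bullet> (Y *v k)" if "h - k \<in> W" for h k
  proof -
    have "C *v (h - k) = 0" using C that by (simp add: sym_tang_iff W_def)
    then show ?thesis using le[of h k] by simp
  qed
  then obtain Z where Z: "Z \<in> sym_matrices" "\<And>h. h \<bullet> (X *v h) \<le> h \<bullet> (Z *v h)" "\<And>h. h \<bullet> (Z *v h) \<le> h \<bullet> (Y *v h)"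
      "\<And>w. w \<in> W \<Longrightarrow> Z *v w = 0"
    using interpolating_matrix[OF X W, of Y] by blast
  have "Z \<in> sym_tang p \<phi>" using Z by (simp add: sym_tang_iff W_def)
  then have eq: "Fup p Z = Flo p Z" using comp by (simp add: compatible_def)
  have "psd (Z - X)" "psd (Y - Z)"
    using X Y Z by (auto simp: psd_def sym_matrices_closed_ops matrix_vector_mult_diff_rdistrib inner_diff_right)
  then have "Fup p (X + (Z - X)) \<ge> Fup p X" "Flo p (Z + (Y - Z)) \<ge> Flo p Z"
    using mono[rule_format, OF X _ \<open>psd (Z - X)\<close>, of p] mono[rule_format, OF Z(1) _ \<open>psd (Y - Z)\<close>, of p]
    unfolding psd_def by blast+
  then show ?thesis using eq by simp
qed

section \<open>Quadratic test functions and viscosity inequalities at superjets\<close>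

lemma grad_eqI:
  assumes "(f has_derivative (\<lambda>h. g \<bullet> h)) (at x)"
  shows "grad f x = g"
  unfolding grad_def gderiv_def
proof (rule the_equality)
  show "(f has_derivative (\<lambda>h. h \<bullet> g)) (at x)" using assms by (simp add: inner_commute)
  fix g' assume "(f has_derivative (\<lambda>h. h \<bullet> g')) (at x)"
  then have "(\<lambda>h. h \<bullet> g') = (\<lambda>h. g \<bullet> h)" using assms by (rule has_derivative_unique)
  then have "h \<bullet> g' = h \<bullet> g" for h by (metis inner_commute)
  then show "g' = g" using vector_eq_ldot by blast
qed

lemma hess_eqI:
  assumes "\<And>y. (f has_derivative (\<lambda>h. g y \<bullet> h)) (at y)" "(g has_derivative D) (at x)"
  shows "hess f x = matrix D"
proof -
  have "grad f = g" by (rule ext, rule grad_eqI, rule assms)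
  then show ?thesis
    using frechet_derivative_at[OF assms(2)] by (simp add: hess_def jacobian_def)
qed

text \<open>Directional derivatives of a quadratic function are affine, and those of an affine function are constant.\<close>
lemma smooth_on_quadratic:
  fixes D :: "'a::real_inner \<Rightarrow> 'a" and c :: real
  assumes D: "bounded_linear D" and sym: "\<And>x y. D x \<bullet> y = x \<bullet> D y"
  shows "smooth_on S (\<lambda>z. g \<bullet> (z - z0) + D (z - z0) \<bullet> (z - z0) / 2)"
proof -
  have const: "Ck_on k S (\<lambda>z. c)" for k S and c :: real
  proof (induction k arbitrary: c)
    case (Suc k)
    have "frechet_derivative (\<lambda>z. c) (at x) h = 0" for x h :: 'a by simp
    then show ?case using Suc[of 0] by simp
  qed simp
  have affine: "Ck_on k S (\<lambda>z. c + b \<bullet> z)" for k S and b :: 'a and c :: real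
  proof (cases k)
    case 0
    then show ?thesis by (auto intro!: continuous_intros)
  next
    case (Suc k')
    have d: "((\<lambda>z. c + b \<bullet> z) has_derivative (\<lambda>h. b \<bullet> h)) (at x)" for x
      by (auto intro!: derivative_eq_intros)
    then have "frechet_derivative (\<lambda>z. c + b \<bullet> z) (at x) h = b \<bullet> h" for x h
      using frechet_derivative_at by metis
    then show ?thesis using Suc d const by (auto simp: differentiable_def)
  qed
  have "Ck_on k S (\<lambda>z. g \<bullet> (z - z0) + D (z - z0) \<bullet> (z - z0) / 2)" for k
  proof (cases k)
    case 0
    have "continuous_on S D" using D by (rule linear_continuous_on)
    moreover have "continuous_on S (\<lambda>z. D (z - z0))"
      using D by (intro bounded_linear.continuous_on[OF D] continuous_intros)
    ultimately show ?thesis using 0 by (auto intro!: continuous_intros)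
  next
    case (Suc k')
    have d: "((\<lambda>z. g \<bullet> (z - z0) + D (z - z0) \<bullet> (z - z0) / 2) has_derivative (\<lambda>h. g \<bullet> h + D (x - z0) \<bullet> h)) (at x)" for x
    proof -
      have "((\<lambda>z. D (z - z0)) has_derivative D) (at x)"
        by (rule bounded_linear.has_derivative[OF D]) (auto intro!: derivative_eq_intros)
      then have "((\<lambda>z. g \<bullet> (z - z0) + D (z - z0) \<bullet> (z - z0) / 2) has_derivative (\<lambda>h. g \<bullet> h + (D (x - z0) \<bullet> h + D h \<bullet> (x - z0)) / 2)) (at x)"
        by (auto intro!: derivative_eq_intros)
      moreover have "D h \<bullet> (x - z0) = D (x - z0) \<bullet> h" for h by (simp add: sym inner_commute)
      ultimately show ?thesis by simp
    qed
    have "frechet_derivative (\<lambda>z. g \<bullet> (z - z0) + D (z - z0) \<bullet> (z - z0) / 2) (at x) h = (g \<bullet> h - D h \<bullet> z0) + D h \<bullet> x" for x h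
      using frechet_derivative_at[OF d[of x]] sym[of "x - z0" h]
      by (metis (no_types, lifting) add_diff_eq diff_add_eq inner_commute inner_diff_right)
    then show ?thesis using Suc d affine by (auto simp: differentiable_def)
  qed
  then show ?thesis by (simp add: smooth_on_def)
qed

text \<open>Raising the second-order part by \<open>2 * \<kappa>\<close> absorbs the error term of the superjet, so that the quadratic
  itself becomes a test function.\<close>
lemma superjet_quadratic_touch:
  assumes "superjet u x p X" "0 < \<kappa>"
  shows "eventually (\<lambda>z. u z - (p \<bullet> (z - x) + (X (z - x) + (2 * \<kappa>) *\<^sub>R (z - x)) \<bullet> (z - x) / 2) \<le> u x) (nhds x)"
proof -
  obtain r where r: "r > 0" "\<And>h. norm h < r \<Longrightarrow> u (x + h) \<le> u x + p \<bullet> h + X h \<bullet> h / 2 + \<kappa> * (norm h)\<^sup>2"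
    using assms unfolding superjet_def by blast
  show ?thesis
    unfolding eventually_nhds_metric
  proof (intro exI[of _ r] conjI allI impI)
    fix z assume "dist z x < r"
    then have "u (x + (z - x)) \<le> u x + p \<bullet> (z - x) + X (z - x) \<bullet> (z - x) / 2 + \<kappa> * (norm (z - x))\<^sup>2"
      by (intro r(2)) (simp add: dist_norm)
    then show "u z - (p \<bullet> (z - x) + (X (z - x) + (2 * \<kappa>) *\<^sub>R (z - x)) \<bullet> (z - x) / 2) \<le> u x"
      by (simp add: inner_add_left power2_norm_eq_inner add_divide_distrib)
  qed (rule r)
qed

context
  fixes D :: "(real^'n) \<times> real \<Rightarrow> (real^'n) \<times> real" and g z0 :: "(real^'n) \<times> real"
  assumes D: "linear D" and sym: "\<And>x y. D x \<bullet> y = x \<bullet> D y"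
begin

lemma spacetime_quadratic_deriv:
  "deriv (\<lambda>t. g \<bullet> ((fst z0, t) - z0) + D ((fst z0, t) - z0) \<bullet> ((fst z0, t) - z0) / 2) (snd z0) = snd g"
proof -
  have eq: "(fst z0, t) - z0 = (t - snd z0) *\<^sub>R (0, 1)" for t by (simp add: prod_eq_iff)
  have "((\<lambda>t. (t - snd z0) * (g \<bullet> (0, 1)) + (t - snd z0)\<^sup>2 * (D (0, 1) \<bullet> (0, 1)) / 2) has_field_derivative (g \<bullet> (0, 1))) (at (snd z0))"
    by (auto intro!: derivative_eq_intros)
  then have "deriv (\<lambda>t. (t - snd z0) * (g \<bullet> (0, 1)) + (t - snd z0)\<^sup>2 * (D (0, 1) \<bullet> (0, 1)) / 2) (snd z0) = g \<bullet> (0, 1)"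
    by (rule DERIV_imp_deriv)
  moreover have "(\<lambda>t. g \<bullet> ((fst z0, t) - z0) + D ((fst z0, t) - z0) \<bullet> ((fst z0, t) - z0) / 2)
      = (\<lambda>t. (t - snd z0) * (g \<bullet> (0, 1)) + (t - snd z0)\<^sup>2 * (D (0, 1) \<bullet> (0, 1)) / 2)"
    unfolding eq linear_scale[OF D] inner_scaleR_left inner_scaleR_right by (simp add: power2_eq_square mult.assoc)
  moreover have "g \<bullet> (0, 1) = snd g" by (simp add: inner_prod_def)
  ultimately show ?thesis by simp
qed

lemma spacetime_quadratic_space_derivs:
  "grad (\<lambda>x. g \<bullet> ((x, snd z0) - z0) + D ((x, snd z0) - z0) \<bullet> ((x, snd z0) - z0) / 2) (fst z0) = fst g"
  "hess (\<lambda>x. g \<bullet> ((x, snd z0) - z0) + D ((x, snd z0) - z0) \<bullet> ((x, snd z0) - z0) / 2) (fst z0) = matrix (\<lambda>h. fst (D (h, 0)))"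
proof -
  define E where "E = (\<lambda>h. fst (D (h, 0)))"
  have linE: "linear E"
    unfolding E_def by (intro linear_compose[of "\<lambda>h. D (h, 0)" fst, unfolded o_def] linear_compose[of "\<lambda>h. (h, 0)" D, unfolded o_def] D)
      (auto intro!: linearI)
  have symE: "E h \<bullet> k = h \<bullet> E k" for h k using sym[of "(h, 0)" "(k, 0)"] by (simp add: E_def inner_prod_def)
  have eq: "(\<lambda>x. g \<bullet> ((x, snd z0) - z0) + D ((x, snd z0) - z0) \<bullet> ((x, snd z0) - z0) / 2)
      = (\<lambda>x. fst g \<bullet> (x - fst z0) + E (x - fst z0) \<bullet> (x - fst z0) / 2)"
  proof
    fix x
    have "(x, snd z0) - z0 = (x - fst z0, 0)" by (simp add: prod_eq_iff)
    then show "g \<bullet> ((x, snd z0) - z0) + D ((x, snd z0) - z0) \<bullet> ((x, snd z0) - z0) / 2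
      = fst g \<bullet> (x - fst z0) + E (x - fst z0) \<bullet> (x - fst z0) / 2"
      by (simp add: E_def inner_prod_def)
  qed
  have blE: "bounded_linear E" using linE by (simp add: linear_conv_bounded_linear)
  have dE: "((\<lambda>x. E (x - fst z0)) has_derivative E) (at x)" for x
    by (rule bounded_linear.has_derivative[OF blE]) (auto intro!: derivative_eq_intros)
  have d1: "((\<lambda>x. fst g \<bullet> (x - fst z0) + E (x - fst z0) \<bullet> (x - fst z0) / 2) has_derivative (\<lambda>h. (fst g + E (x - fst z0)) \<bullet> h)) (at x)" for x
  proof -
    have "((\<lambda>x. fst g \<bullet> (x - fst z0) + E (x - fst z0) \<bullet> (x - fst z0) / 2) has_derivative
        (\<lambda>h. fst g \<bullet> h + (E (x - fst z0) \<bullet> h + E h \<bullet> (x - fst z0)) / 2)) (at x)"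
      using dE[of x] by (auto intro!: derivative_eq_intros)
    moreover have "E h \<bullet> (x - fst z0) = E (x - fst z0) \<bullet> h" for h by (simp add: symE inner_commute)
    ultimately show ?thesis by (simp add: inner_add_left)
  qed
  have d2: "((\<lambda>x. fst g + E (x - fst z0)) has_derivative E) (at x)" for x
    using dE[of x] by (auto intro!: derivative_eq_intros)
  show "grad (\<lambda>x. g \<bullet> ((x, snd z0) - z0) + D ((x, snd z0) - z0) \<bullet> ((x, snd z0) - z0) / 2) (fst z0) = fst g"
    unfolding eq using grad_eqI[OF d1[of "fst z0"]] by (simp add: linear_0[OF linE])
  show "hess (\<lambda>x. g \<bullet> ((x, snd z0) - z0) + D ((x, snd z0) - z0) \<bullet> ((x, snd z0) - z0) / 2) (fst z0) = matrix (\<lambda>h. fst (D (h, 0)))"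
    unfolding eq E_def[symmetric] by (rule hess_eqI[OF d1 d2])
qed

end

text \<open>Only the spatial block of the second-order part of a space-time jet enters the equation.\<close>
lemma space_block:
  fixes D :: "(real^'n) \<times> real \<Rightarrow> (real^'n) \<times> real"
  assumes D: "linear D"
  shows "linear (\<lambda>h. fst (D (h, 0)))" "matrix (\<lambda>h. fst (D (h, 0))) *v h = fst (D (h, 0))"
    "(\<And>x y. D x \<bullet> y = x \<bullet> D y) \<Longrightarrow> matrix (\<lambda>h. fst (D (h, 0))) \<in> sym_matrices"
proof -
  have *: "linear (\<lambda>h. D (h, 0))"
  proof (rule linearI)
    show "D (x + y, 0) = D (x, 0) + D (y, 0)" for x y using linear_add[OF D, of "(x, 0)" "(y, 0)"] by simp
    show "D (c *\<^sub>R x, 0) = c *\<^sub>R D (x, 0)" for c x using linear_scale[OF D, of c "(x, 0)"] by simp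
  qed
  show lin: "linear (\<lambda>h. fst (D (h, 0)))"
    by (rule linearI) (simp_all add: linear_add[OF *] linear_scale[OF *])
  show mat: "matrix (\<lambda>h. fst (D (h, 0))) *v h = fst (D (h, 0))" for h by (rule matrix_works_linear[OF lin])
  assume sym: "\<And>x y. D x \<bullet> y = x \<bullet> D y"
  show "matrix (\<lambda>h. fst (D (h, 0))) \<in> sym_matrices"
  proof (rule sym_matricesI)
    fix x y
    show "(matrix (\<lambda>h. fst (D (h, 0))) *v x) \<bullet> y = x \<bullet> (matrix (\<lambda>h. fst (D (h, 0))) *v y)"
      unfolding mat using sym[of "(x, 0)" "(y, 0)"] by (simp add: inner_prod_def)
  qed
qed

lemma matrix_uminus_mult: "(- A) *v x = - (A *v x)" for A :: "real^'n^'m"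
  by (simp add: vec_eq_iff matrix_vector_mult_def sum_negf)

context
  fixes D :: "(real^'n) \<times> real \<Rightarrow> (real^'n) \<times> real" and z0 :: "(real^'n) \<times> real" and p :: "real^'n" and a T :: real
  assumes D: "linear D" and sym: "\<And>x y. D x \<bullet> y = x \<bullet> D y" and t0: "snd z0 \<in> {0<..<T}"
begin

lemma visc_sub_shifted_jet:
  assumes w: "visc_sub T F w" and jet: "superjet w z0 (p, a) D" and \<kappa>: "0 < \<kappa>"
  shows "a \<le> F p (matrix (\<lambda>h. fst (D (h, 0))) + (2 * \<kappa>) *\<^sub>R mat 1)"
proof -
  define E where "E = (\<lambda>z. D z + (2 * \<kappa>) *\<^sub>R z)"
  define \<phi> where "\<phi> = (\<lambda>z. (p, a) \<bullet> (z - z0) + E (z - z0) \<bullet> (z - z0) / 2)"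
  have E: "linear E" "\<And>x y. E x \<bullet> y = x \<bullet> E y"
    unfolding E_def using linear_add[OF D] linear_scale[OF D]
    by (auto intro!: linearI simp: algebra_simps sym)
  have "smooth_on (UNIV \<times> {0<..<T}) \<phi>"
    unfolding \<phi>_def by (rule smooth_on_quadratic) (use E in \<open>auto simp: linear_conv_bounded_linear\<close>)
  moreover have "eventually (\<lambda>z. w z - \<phi> z \<le> w (fst z0, snd z0) - \<phi> (fst z0, snd z0)) (nhds (fst z0, snd z0))"
    using superjet_quadratic_touch[OF jet \<kappa>] by (simp add: \<phi>_def E_def linear_0[OF D])
  ultimately have "deriv (\<lambda>t. \<phi> (fst z0, t)) (snd z0)
          - F (grad (\<lambda>x. \<phi> (x, snd z0)) (fst z0)) (hess (\<lambda>x. \<phi> (x, snd z0)) (fst z0)) \<le> 0"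
    using w t0 unfolding visc_sub_def by blast
  then have "a \<le> F p (matrix (\<lambda>h. fst (E (h, 0))))"
    unfolding \<phi>_def using spacetime_quadratic_deriv[OF E] spacetime_quadratic_space_derivs[OF E] by simp
  moreover have "matrix (\<lambda>h. fst (E (h, 0))) = matrix (\<lambda>h. fst (D (h, 0))) + (2 * \<kappa>) *\<^sub>R mat 1"
    unfolding matrix_eq using space_block(2)[OF E(1)] space_block(2)[OF D]
    by (simp add: E_def matrix_vector_mult_add_rdistrib scaleR_matrix_vector_assoc[symmetric])
  ultimately show ?thesis by simp
qed

lemma visc_super_shifted_jet:
  assumes v: "visc_super T F v" and jet: "superjet (\<lambda>z. - v z) z0 (p, a) D" and \<kappa>: "0 < \<kappa>"
  shows "F (- p) (- (matrix (\<lambda>h. fst (D (h, 0))) + (2 * \<kappa>) *\<^sub>R mat 1)) \<le> - a"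
proof -
  define E where "E = (\<lambda>z. - D z - (2 * \<kappa>) *\<^sub>R z)"
  define \<phi> where "\<phi> = (\<lambda>z. (- p, - a) \<bullet> (z - z0) + E (z - z0) \<bullet> (z - z0) / 2)"
  have E: "linear E" "\<And>x y. E x \<bullet> y = x \<bullet> E y"
    unfolding E_def using linear_add[OF D] linear_scale[OF D]
    by (auto intro!: linearI simp: algebra_simps sym)
  have "smooth_on (UNIV \<times> {0<..<T}) \<phi>"
    unfolding \<phi>_def by (rule smooth_on_quadratic) (use E in \<open>auto simp: linear_conv_bounded_linear\<close>)
  moreover have "eventually (\<lambda>z. v z - \<phi> z \<ge> v (fst z0, snd z0) - \<phi> (fst z0, snd z0)) (nhds (fst z0, snd z0))"
  proof -
    have neg: "\<phi> z = - ((p, a) \<bullet> (z - z0) + (D (z - z0) + (2 * \<kappa>) *\<^sub>R (z - z0)) \<bullet> (z - z0) / 2)" for z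
    proof -
      have 1: "(- p, - a) = - (p, a)" by simp
      have 2: "E (z - z0) = - (D (z - z0) + (2 * \<kappa>) *\<^sub>R (z - z0))" by (simp add: E_def)
      show ?thesis unfolding \<phi>_def 1 2 inner_minus_left by simp
    qed
    have "\<phi> z0 = 0" by (simp add: neg)
    have "eventually (\<lambda>z. v z0 - \<phi> z0 \<le> v z - \<phi> z) (nhds z0)"
      using superjet_quadratic_touch[OF jet \<kappa>]
    proof eventually_elim
      case (elim z)
      then show ?case using neg[of z] \<open>\<phi> z0 = 0\<close> by simp
    qed
    then show ?thesis by simp
  qed
  ultimately have "deriv (\<lambda>t. \<phi> (fst z0, t)) (snd z0)
          - F (grad (\<lambda>x. \<phi> (x, snd z0)) (fst z0)) (hess (\<lambda>x. \<phi> (x, snd z0)) (fst z0)) \<ge> 0"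
    using v t0 unfolding visc_super_def by blast
  then have "F (- p) (matrix (\<lambda>h. fst (E (h, 0)))) \<le> - a"
    unfolding \<phi>_def using spacetime_quadratic_deriv[OF E] spacetime_quadratic_space_derivs[OF E] by simp
  moreover have "matrix (\<lambda>h. fst (E (h, 0))) = - (matrix (\<lambda>h. fst (D (h, 0))) + (2 * \<kappa>) *\<^sub>R mat 1)"
    unfolding matrix_eq using space_block(2)[OF E(1)] space_block(2)[OF D]
    by (simp add: E_def matrix_vector_mult_add_rdistrib matrix_vector_mult_diff_rdistrib matrix_uminus_mult scaleR_matrix_vector_assoc[symmetric])
  ultimately show ?thesis by simp
qed

end

lemma tendsto_shifted_matrix:
  "((\<lambda>\<kappa>. X + (2 * \<kappa>) *\<^sub>R mat 1) \<longlongrightarrow> (X :: real^'n^'n)) (at_right (0::real))"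
proof -
  have "((\<lambda>\<kappa>. X + (2 * \<kappa>) *\<^sub>R mat 1) \<longlongrightarrow> X + (2 * 0) *\<^sub>R mat 1) (at_right (0::real))"
    by (intro tendsto_intros)
  then show ?thesis by simp
qed

text \<open>Testing with the raised quadratic gives the inequality at \<open>X + 2 * \<kappa> * I\<close>; semicontinuity of \<open>F\<close> lets
  \<open>\<kappa>\<close> tend to zero.\<close>
lemma visc_sub_jet:
  fixes D :: "(real^'n) \<times> real \<Rightarrow> (real^'n) \<times> real"
  assumes D: "linear D" "\<And>x y. D x \<bullet> y = x \<bullet> D y" and t0: "snd z0 \<in> {0<..<T}"
    and F: "usc_on (UNIV \<times> sym_matrices) (\<lambda>(p, X). F p X)"
    and w: "visc_sub T F w" and jet: "superjet w z0 (p, a) D"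
  shows "a \<le> F p (matrix (\<lambda>h. fst (D (h, 0))))"
proof -
  define X where "X = matrix (\<lambda>h. fst (D (h, 0)))"
  have X: "X \<in> sym_matrices" unfolding X_def by (rule space_block(3)[OF D])
  have "a \<le> (\<lambda>(p, X). F p X) (p, X)"
  proof (rule usc_on_tendsto_le[OF F])
    show "((\<lambda>\<kappa>. (p, X + (2 * \<kappa>) *\<^sub>R mat 1)) \<longlongrightarrow> (p, X)) (at_right 0)"
      by (intro tendsto_Pair tendsto_const tendsto_shifted_matrix)
    show "eventually (\<lambda>\<kappa>. (p, X + (2 * \<kappa>) *\<^sub>R mat 1) \<in> UNIV \<times> sym_matrices \<and> a \<le> (\<lambda>(p, X). F p X) (p, X + (2 * \<kappa>) *\<^sub>R mat 1)) (at_right 0)"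
      using eventually_at_right_less[of 0]
      by eventually_elim (use visc_sub_shifted_jet[OF D t0 w jet] in \<open>auto simp: X_def[symmetric] sym_matrices_closed_ops X mat_1_sym\<close>)
  qed (auto simp: X)
  then show ?thesis by (simp add: X_def)
qed

lemma visc_super_jet:
  fixes D :: "(real^'n) \<times> real \<Rightarrow> (real^'n) \<times> real"
  assumes D: "linear D" "\<And>x y. D x \<bullet> y = x \<bullet> D y" and t0: "snd z0 \<in> {0<..<T}"
    and F: "lsc_on (UNIV \<times> sym_matrices) (\<lambda>(p, X). F p X)"
    and v: "visc_super T F v" and jet: "superjet (\<lambda>z. - v z) z0 (p, a) D"
  shows "F (- p) (- matrix (\<lambda>h. fst (D (h, 0)))) \<le> - a"
proof -
  define X where "X = matrix (\<lambda>h. fst (D (h, 0)))"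
  have X: "X \<in> sym_matrices" unfolding X_def by (rule space_block(3)[OF D])
  have neg: "- Z \<in> sym_matrices" if "Z \<in> sym_matrices" for Z :: "real^'n^'n"
    using sym_matrices_closed_ops(3)[OF that, of "-1"] by simp
  have "(\<lambda>(p, X). F p X) (- p, - X) \<le> - a"
  proof (rule lsc_on_tendsto_ge[OF F])
    show "((\<lambda>\<kappa>. (- p, - (X + (2 * \<kappa>) *\<^sub>R mat 1))) \<longlongrightarrow> (- p, - X)) (at_right 0)"
      by (intro tendsto_Pair tendsto_const tendsto_minus tendsto_shifted_matrix)
    show "eventually (\<lambda>\<kappa>. (- p, - (X + (2 * \<kappa>) *\<^sub>R mat 1)) \<in> UNIV \<times> sym_matrices \<and> (\<lambda>(p, X). F p X) (- p, - (X + (2 * \<kappa>) *\<^sub>R mat 1)) \<le> - a) (at_right 0)"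
      using eventually_at_right_less[of 0]
    proof eventually_elim
      case (elim \<kappa>)
      have "F (- p) (- (X + (2 * \<kappa>) *\<^sub>R mat 1)) \<le> - a"
        using visc_super_shifted_jet[OF D t0 v jet elim] by (simp add: X_def)
      moreover have "- (X + (2 * \<kappa>) *\<^sub>R mat 1) \<in> sym_matrices"
        by (intro neg sym_matrices_closed_ops X mat_1_sym)
      ultimately show ?case by simp
    qed
  qed (auto simp: neg X)
  then show ?thesis by (simp add: X_def)
qed

section \<open>The fourth power of a shielding norm\<close>

text \<open>Homogeneous functions are controlled by their values on the unit sphere. For \<open>\<psi> ^ 4\<close> and its derivatives
  this gives the decay at the origin, the only point where \<open>\<psi>\<close> is not smooth.\<close>
lemma homogeneous_bound:
  fixes f :: "'a::euclidean_space \<Rightarrow> 'b::real_normed_vector"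
  assumes hom: "\<And>l q. 0 < l \<Longrightarrow> q \<noteq> 0 \<Longrightarrow> f (l *\<^sub>R q) = l ^ k *\<^sub>R f q" and cont: "continuous_on (sphere 0 1) f"
  obtains K where "0 < K" "\<And>q. q \<noteq> 0 \<Longrightarrow> norm (f q) \<le> K * norm q ^ k"
proof -
  have "bounded (f ` sphere 0 1)" using cont by (intro compact_imp_bounded compact_continuous_image) auto
  then obtain K where K: "K > 0" "\<And>x. x \<in> f ` sphere 0 1 \<Longrightarrow> norm x \<le> K" unfolding bounded_pos by blast
  have "norm (f q) \<le> K * norm q ^ k" if "q \<noteq> 0" for q
  proof -
    have "f q = f (norm q *\<^sub>R ((1 / norm q) *\<^sub>R q))" using that by simp
    also have "\<dots> = norm q ^ k *\<^sub>R f ((1 / norm q) *\<^sub>R q)" using that by (intro hom) auto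
    finally have "norm (f q) = norm q ^ k * norm (f ((1 / norm q) *\<^sub>R q))" by simp
    also have "\<dots> \<le> norm q ^ k * K" using that by (intro mult_left_mono K(2) imageI) auto
    finally show ?thesis by (simp add: mult.commute)
  qed
  then show thesis using that K by blast
qed

lemma has_derivative_zero_at_zero:
  fixes f :: "'a::real_normed_vector \<Rightarrow> 'b::real_normed_vector"
  assumes K: "0 < K" "\<And>h. norm h \<le> 1 \<Longrightarrow> norm (f h) \<le> K * (norm h)\<^sup>2"
  shows "(f has_derivative (\<lambda>h. 0)) (at 0)"
  unfolding has_derivative_at_alt
proof (intro conjI allI impI)
  fix e :: real assume "e > 0"
  have f0: "f 0 = 0" using K(2)[of 0] by simp
  have "norm (f y - f 0 - 0) \<le> e * norm (y - 0)" if "norm (y - 0) < min 1 (e / K)" for y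
  proof -
    have "norm (f y) \<le> K * (norm y)\<^sup>2" using that by (intro K(2)) auto
    also have "\<dots> = (K * norm y) * norm y" by (simp add: power2_eq_square)
    also have "\<dots> \<le> e * norm y" using that K(1) by (intro mult_right_mono) (auto simp: field_simps)
    finally show ?thesis by (simp add: f0)
  qed
  then show "\<exists>d>0. \<forall>y. norm (y - 0) < d \<longrightarrow> norm (f y - f 0 - 0) \<le> e * norm (y - 0)"
    using \<open>e > 0\<close> K(1) by (intro exI[of _ "min 1 (e / K)"]) auto
qed simp

text \<open>The directional description of \<open>C\<^sup>2\<close> yields total derivatives because all directional derivatives of
  \<open>\<psi>\<close> are assumed totally differentiable; these are the components of the gradient.\<close>
lemma Ck_2_has_derivatives:
  fixes \<psi> :: "real^'n \<Rightarrow> real"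
  assumes Ck: "Ck_on 2 S \<psi>" and S: "open S" and q: "q \<in> S"
  shows "(\<psi> has_derivative (\<lambda>h. grad \<psi> q \<bullet> h)) (at q)"
    and "(grad \<psi> has_derivative (\<lambda>h. hess \<psi> q *v h)) (at q)"
    and "continuous_on S (hess \<psi>)"
proof -
  have Ck': "\<And>x. x \<in> S \<Longrightarrow> \<psi> differentiable (at x)"
    "\<And>x h. x \<in> S \<Longrightarrow> (\<lambda>x. frechet_derivative \<psi> (at x) h) differentiable (at x)"
    "\<And>h k. continuous_on S (\<lambda>x. frechet_derivative (\<lambda>x. frechet_derivative \<psi> (at x) h) (at x) k)"
    using Ck by (auto simp: numeral_2_eq_2)
  have d1: "(\<psi> has_derivative (\<lambda>h. grad \<psi> x \<bullet> h)) (at x)" if "x \<in> S" for x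
  proof -
    define f' where "f' = frechet_derivative \<psi> (at x)"
    have f': "(\<psi> has_derivative f') (at x)" using Ck'(1)[OF that] by (simp add: f'_def frechet_derivative_works)
    then have lin: "linear f'" by (rule has_derivative_linear)
    have "f' = (\<lambda>h. adjoint f' 1 \<bullet> h)"
      using adjoint_works[OF lin, of _ 1] by (simp add: inner_commute fun_eq_iff)
    then have "(\<psi> has_derivative (\<lambda>h. adjoint f' 1 \<bullet> h)) (at x)" using f' by simp
    then show ?thesis using grad_eqI by metis
  qed
  have fd: "frechet_derivative \<psi> (at x) h = grad \<psi> x \<bullet> h" if "x \<in> S" for x h
    using frechet_derivative_at[OF d1[OF that]] by metis
  have comp: "(\<lambda>x. grad \<psi> x \<bullet> h) differentiable (at x)" if x: "x \<in> S" for x h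
  proof -
    obtain f' where "((\<lambda>x. frechet_derivative \<psi> (at x) h) has_derivative f') (at x)"
      using Ck'(2)[OF x, of h] unfolding differentiable_def by blast
    then have "((\<lambda>x. grad \<psi> x \<bullet> h) has_derivative f') (at x)"
      by (rule has_derivative_transform_within_open[OF _ S x]) (simp add: fd)
    then show ?thesis unfolding differentiable_def by blast
  qed
  have d2: "(grad \<psi> has_derivative (\<lambda>h. hess \<psi> x *v h)) (at x)" if "x \<in> S" for x
  proof -
    have "grad \<psi> differentiable (at x)"
      using comp[OF that] by (subst differentiable_componentwise_within) simp
    then show ?thesis unfolding hess_def by (simp add: jacobian_works)
  qed
  show "(\<psi> has_derivative (\<lambda>h. grad \<psi> q \<bullet> h)) (at q)" "(grad \<psi> has_derivative (\<lambda>h. hess \<psi> q *v h)) (at q)"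
    using d1 d2 q by auto
  have entry: "hess \<psi> x $ i $ j = frechet_derivative (\<lambda>x. frechet_derivative \<psi> (at x) (axis i 1)) (at x) (axis j 1)"
    if x: "x \<in> S" for x i j
  proof -
    have "((\<lambda>x. grad \<psi> x \<bullet> axis i 1) has_derivative (\<lambda>h. (hess \<psi> x *v h) \<bullet> axis i 1)) (at x)"
      using d2[OF x] by (auto intro!: derivative_eq_intros)
    then have "((\<lambda>x. frechet_derivative \<psi> (at x) (axis i 1)) has_derivative (\<lambda>h. (hess \<psi> x *v h) \<bullet> axis i 1)) (at x)"
      by (rule has_derivative_transform_within_open[OF _ S x]) (simp add: fd)
    then have "frechet_derivative (\<lambda>x. frechet_derivative \<psi> (at x) (axis i 1)) (at x) = (\<lambda>h. (hess \<psi> x *v h) \<bullet> axis i 1)"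
      using frechet_derivative_at by metis
    then show ?thesis by (simp add: inner_axis matrix_vector_mult_basis column_def)
  qed
  have "continuous_on S (\<lambda>x. \<chi> i j. frechet_derivative (\<lambda>x. frechet_derivative \<psi> (at x) (axis i 1)) (at x) (axis j 1))"
    by (intro continuous_on_vec_lambda Ck'(3))
  moreover have "hess \<psi> x = (\<chi> i j. frechet_derivative (\<lambda>x. frechet_derivative \<psi> (at x) (axis i 1)) (at x) (axis j 1))" if "x \<in> S" for x
    using entry[OF that] by (simp add: vec_eq_iff)
  ultimately show "continuous_on S (hess \<psi>)" by (simp cong: continuous_on_cong)
qed

lemma matrix_eq_of_scaled: "(\<And>h. A *v (l *\<^sub>R h) = B *v h) \<Longrightarrow> l \<noteq> 0 \<Longrightarrow> A = (1 / l) *\<^sub>R B" for A B :: "real^'n^'m"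
proof -
  assume *: "\<And>h. A *v (l *\<^sub>R h) = B *v h" "l \<noteq> 0"
  have "A *v h = (1 / l) *\<^sub>R (B *v h)" for h
    using *(1)[of h] *(2) by (simp add: matrix_vector_mult_scaleR flip: *(1))
  then show ?thesis unfolding matrix_eq by (simp add: scaleR_matrix_vector_assoc[symmetric])
qed

text \<open>The kernel for the doubling of variables. Where \<open>\<psi>\<close> is smooth the Hessian of \<open>c * \<psi> ^ 4\<close> is
  \<open>4 c \<psi>\<^sup>3 D\<^sup>2\<psi> + 12 c \<psi>\<^sup>2 D\<psi> D\<psi>\<^sup>T\<close>. The shielding property puts the first term into
  \<open>sym_tang (D\<psi>) \<phi>\<close>, and the second is there because its range is spanned by \<open>D\<psi>\<close>. So the Hessian of
  \<open>\<theta>\<close> satisfies the condition at the gradient of \<open>\<theta>\<close> itself. The fourth power is what makes the function twice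
  continuously differentiable at the origin as well, with both derivatives equal to zero there.\<close>
lemma shielding_quartic:
  fixes \<phi> :: "real^'n \<Rightarrow> real"
  assumes \<phi>: "finsler_norm \<phi>" and shield: "shielding_norm \<psi> \<phi>" and c: "0 < c"
    and m: "0 < m" "\<And>q. m * norm q \<le> \<psi> q"
  obtains \<theta> :: "real^'n \<Rightarrow> real" and g and H
  where "\<And>q. (\<theta> has_derivative (\<lambda>h. g q \<bullet> h)) (at q)" "\<And>q. (g has_derivative (\<lambda>h. H q *v h)) (at q)"
    "continuous_on UNIV H" "\<And>q. H q \<in> sym_tang (g q) \<phi>" "\<And>q. c * m ^ 4 * norm q ^ 4 \<le> \<theta> q" "\<theta> 0 = 0"
proof -
  have \<psi>: "finsler_norm \<psi>" and Ck: "Ck_on 2 (- {0}) \<psi>"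
    and tan: "\<And>q. q \<noteq> 0 \<Longrightarrow> hess \<psi> q \<in> sym_tang (grad \<psi> q) \<phi>"
    using shield by (auto simp: shielding_norm_def)
  have hom: "0 < l \<Longrightarrow> \<psi> (l *\<^sub>R q) = l * \<psi> q" for l q
    using \<psi> by (simp add: finsler_norm_def)
  have \<psi>0: "\<psi> 0 = 0" using hom[of 2 0] by simp
  have op: "open (- {0 :: real^'n})" by auto
  have d1: "(\<psi> has_derivative (\<lambda>h. grad \<psi> q \<bullet> h)) (at q)" and d2: "(grad \<psi> has_derivative (\<lambda>h. hess \<psi> q *v h)) (at q)"
    if "q \<noteq> 0" for q
    using Ck_2_has_derivatives[OF Ck op, of q] that by auto
  have contH: "continuous_on (- {0}) (hess \<psi>)"
    using Ck_2_has_derivatives(3)[OF Ck op, of "axis undefined 1"] by (simp add: axis_eq_0_iff)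
  have contG: "continuous_on (- {0}) (grad \<psi>)"
    unfolding continuous_on_eq_continuous_at[OF op] using has_derivative_continuous[OF d2] by auto
  have cont\<psi>: "continuous_on (- {0}) \<psi>"
    unfolding continuous_on_eq_continuous_at[OF op] using has_derivative_continuous[OF d1] by auto
  have gradhom: "grad \<psi> (l *\<^sub>R q) = grad \<psi> q" if l: "0 < l" and q: "q \<noteq> 0" for l q
  proof -
    have "((\<lambda>x. \<psi> (l *\<^sub>R x)) has_derivative (\<lambda>h. grad \<psi> (l *\<^sub>R q) \<bullet> (l *\<^sub>R h))) (at q)"
      by (rule has_derivative_compose[OF _ d1, where f="\<lambda>x. l *\<^sub>R x"]) (use l q in \<open>auto intro!: derivative_eq_intros\<close>)
    moreover have "((\<lambda>x. \<psi> (l *\<^sub>R x)) has_derivative (\<lambda>h. l * (grad \<psi> q \<bullet> h))) (at q)"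
      unfolding hom[OF l] using d1[OF q] by (auto intro!: derivative_eq_intros)
    ultimately have "(\<lambda>h. grad \<psi> (l *\<^sub>R q) \<bullet> (l *\<^sub>R h)) = (\<lambda>h. l * (grad \<psi> q \<bullet> h))" by (rule has_derivative_unique)
    then have "grad \<psi> (l *\<^sub>R q) \<bullet> h = grad \<psi> q \<bullet> h" for h using l by (auto dest: fun_cong[of _ _ h])
    then show ?thesis using vector_eq_rdot by blast
  qed
  have hesshom: "hess \<psi> (l *\<^sub>R q) = (1 / l) *\<^sub>R hess \<psi> q" if l: "0 < l" and q: "q \<noteq> 0" for l q
  proof -
    have "((\<lambda>x. grad \<psi> (l *\<^sub>R x)) has_derivative (\<lambda>h. hess \<psi> (l *\<^sub>R q) *v (l *\<^sub>R h))) (at q)"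
      by (rule has_derivative_compose[OF _ d2, where f="\<lambda>x. l *\<^sub>R x"]) (use l q in \<open>auto intro!: derivative_eq_intros\<close>)
    moreover have "((\<lambda>x. grad \<psi> (l *\<^sub>R x)) has_derivative (\<lambda>h. hess \<psi> q *v h)) (at q)"
      by (rule has_derivative_transform_within_open[OF d2[OF q] op]) (use l q in \<open>auto simp: gradhom\<close>)
    ultimately have "(\<lambda>h. hess \<psi> (l *\<^sub>R q) *v (l *\<^sub>R h)) = (\<lambda>h. hess \<psi> q *v h)" by (rule has_derivative_unique)
    then have "hess \<psi> (l *\<^sub>R q) *v (l *\<^sub>R h) = hess \<psi> q *v h" for h by (rule fun_cong)
    then show ?thesis using l by (intro matrix_eq_of_scaled) auto
  qed
  define \<theta> where "\<theta> = (\<lambda>q. c * \<psi> q ^ 4)"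
  define g where "g = (\<lambda>q. (4 * c * \<psi> q ^ 3) *\<^sub>R grad \<psi> q)"
  define H where "H = (\<lambda>q. (4 * c * \<psi> q ^ 3) *\<^sub>R hess \<psi> q + (12 * c * (\<psi> q)\<^sup>2) *\<^sub>R outer (grad \<psi> q))"
  have zero: "\<theta> 0 = 0" "g 0 = 0" "H 0 = 0" by (auto simp: \<theta>_def g_def H_def \<psi>0)
  have sph: "sphere 0 1 \<subseteq> - {0 :: real^'n}" by auto
  have contouter: "continuous_on (- {0}) (\<lambda>q. outer (grad \<psi> q))"
    unfolding outer_def by (intro continuous_on_vec_lambda continuous_intros continuous_on_component contG)
  have contHH: "continuous_on (- {0}) H"
    unfolding H_def by (intro continuous_intros contH contouter cont\<psi>)
  have H_hom: "H (l *\<^sub>R q) = l ^ 2 *\<^sub>R H q" if "0 < l" "q \<noteq> 0" for l q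
  proof -
    have "H (l *\<^sub>R q) = (4 * c * (l ^ 3 * \<psi> q ^ 3)) *\<^sub>R ((1 / l) *\<^sub>R hess \<psi> q) + (12 * c * (l\<^sup>2 * (\<psi> q)\<^sup>2)) *\<^sub>R outer (grad \<psi> q)"
      using that by (simp add: H_def hom gradhom hesshom power_mult_distrib)
    also have "(4 * c * (l ^ 3 * \<psi> q ^ 3)) *\<^sub>R ((1 / l) *\<^sub>R hess \<psi> q) = (l\<^sup>2 * (4 * c * \<psi> q ^ 3)) *\<^sub>R hess \<psi> q"
      using that by (simp add: power2_eq_square power3_eq_cube mult_ac)
    finally show ?thesis by (simp add: H_def scaleR_add_right mult_ac)
  qed
  have g_hom: "g (l *\<^sub>R q) = l ^ 3 *\<^sub>R g q" if "0 < l" "q \<noteq> 0" for l q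
    using that by (simp add: g_def hom gradhom power_mult_distrib mult_ac)
  have \<theta>_hom: "\<theta> (l *\<^sub>R q) = l ^ 4 *\<^sub>R \<theta> q" if "0 < l" "q \<noteq> 0" for l q
    using that by (simp add: \<theta>_def hom power_mult_distrib mult_ac)
  have "continuous_on (sphere 0 1) H" by (rule continuous_on_subset[OF contHH sph])
  then obtain KH where KH: "0 < KH" "\<And>q. q \<noteq> 0 \<Longrightarrow> norm (H q) \<le> KH * norm q ^ 2"
    using homogeneous_bound[of H 2] H_hom by blast
  have "continuous_on (- {0}) g" unfolding g_def by (intro continuous_intros contG cont\<psi>)
  then have "continuous_on (sphere 0 1) g" by (rule continuous_on_subset[OF _ sph])
  then obtain Kg where Kg: "0 < Kg" "\<And>q. q \<noteq> 0 \<Longrightarrow> norm (g q) \<le> Kg * norm q ^ 3"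
    using homogeneous_bound[of g 3] g_hom by blast
  have "continuous_on (- {0}) \<theta>" unfolding \<theta>_def by (intro continuous_intros cont\<psi>)
  then have "continuous_on (sphere 0 1) \<theta>" by (rule continuous_on_subset[OF _ sph])
  then obtain Kt where Kt: "0 < Kt" "\<And>q. q \<noteq> 0 \<Longrightarrow> norm (\<theta> q) \<le> Kt * norm q ^ 4"
    using homogeneous_bound[of \<theta> 4] \<theta>_hom by blast
  have D\<theta>: "(\<theta> has_derivative (\<lambda>h. g q \<bullet> h)) (at q)" for q
  proof (cases "q = 0")
    case True
    have "norm (\<theta> h) \<le> Kt * (norm h)\<^sup>2" if "norm h \<le> 1" for h
    proof (cases "h = 0")
      case False
      have "norm (\<theta> h) \<le> Kt * norm h ^ 4" using Kt False by simp
      also have "\<dots> \<le> Kt * (norm h)\<^sup>2" using Kt that by (intro mult_left_mono power_decreasing) auto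
      finally show ?thesis .
    qed (simp add: zero)
    then have "(\<theta> has_derivative (\<lambda>h. 0)) (at 0)" by (rule has_derivative_zero_at_zero[OF Kt(1)])
    then show ?thesis using True by (simp add: zero)
  next
    case False
    have "(\<theta> has_derivative (\<lambda>h. c * (4 * (grad \<psi> q \<bullet> h) * \<psi> q ^ 3))) (at q)"
      unfolding \<theta>_def using d1[OF False] by (auto intro!: derivative_eq_intros)
    moreover have "c * (4 * (grad \<psi> q \<bullet> h) * \<psi> q ^ 3) = g q \<bullet> h" for h by (simp add: g_def mult_ac)
    ultimately show ?thesis by simp
  qed
  have Dg: "(g has_derivative (\<lambda>h. H q *v h)) (at q)" for q
  proof (cases "q = 0")
    case True
    have "norm (g h) \<le> Kg * (norm h)\<^sup>2" if "norm h \<le> 1" for h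
    proof (cases "h = 0")
      case False
      have "norm (g h) \<le> Kg * norm h ^ 3" using Kg False by simp
      also have "\<dots> \<le> Kg * (norm h)\<^sup>2" using Kg that by (intro mult_left_mono power_decreasing) auto
      finally show ?thesis .
    qed (simp add: zero)
    then have "(g has_derivative (\<lambda>h. 0)) (at 0)" by (rule has_derivative_zero_at_zero[OF Kg(1)])
    then show ?thesis using True by (simp add: zero)
  next
    case False
    have "((\<lambda>q. 4 * c * \<psi> q ^ 3) has_derivative (\<lambda>h. 4 * c * (3 * (grad \<psi> q \<bullet> h) * (\<psi> q)\<^sup>2))) (at q)"
      using d1[OF False] by (auto intro!: derivative_eq_intros)
    from has_derivative_scaleR[OF this d2[OF False]]
    have "(g has_derivative (\<lambda>h. (4 * c * \<psi> q ^ 3) *\<^sub>R (hess \<psi> q *v h) + (4 * c * (3 * (grad \<psi> q \<bullet> h) * (\<psi> q)\<^sup>2)) *\<^sub>R grad \<psi> q)) (at q)"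
      unfolding g_def .
    moreover have "(4 * c * \<psi> q ^ 3) *\<^sub>R (hess \<psi> q *v h) + (4 * c * (3 * (grad \<psi> q \<bullet> h) * (\<psi> q)\<^sup>2)) *\<^sub>R grad \<psi> q = H q *v h" for h
      by (simp add: H_def matrix_vector_mult_add_rdistrib scaleR_matrix_vector_assoc[symmetric] outer_mult mult_ac)
    ultimately show ?thesis by simp
  qed
  have HC: "continuous_on UNIV H"
  proof (rule continuous_at_imp_continuous_on, rule ballI)
    fix q :: "real^'n"
    show "isCont H q"
    proof (cases "q = 0")
      case False
      then show ?thesis using contHH op by (simp add: continuous_on_eq_continuous_at)
    next
      case True
      have "norm (H h) \<le> KH * (norm h)\<^sup>2" if "norm h \<le> 1" for h
        using KH(2)[of h] by (cases "h = 0") (auto simp: zero)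
      then have "(H has_derivative (\<lambda>h. 0)) (at 0)" by (rule has_derivative_zero_at_zero[OF KH(1)])
      then show ?thesis using True has_derivative_continuous by blast
    qed
  qed
  have HT: "H q \<in> sym_tang (g q) \<phi>" for q
  proof (cases "q = 0")
    case True
    have "(0 :: real^'n^'n) \<in> sym_matrices" by (simp add: sym_matrices_def transpose_def vec_eq_iff)
    then show ?thesis using True by (simp add: zero sym_tang_iff)
  next
    case False
    have "0 < m * norm q" using m False by simp
    then have "0 < \<psi> q" using m(2)[of q] by linarith
    then have "0 < 4 * c * \<psi> q ^ 3" using c by simp
    then have ts: "tang_space (g q) \<phi> = tang_space (grad \<psi> q) \<phi>" unfolding g_def by (rule tang_space_scale[OF \<phi>])
    have hs: "hess \<psi> q \<in> sym_matrices" and hk: "\<And>h. (\<forall>z\<in>tang_space (grad \<psi> q) \<phi>. h \<bullet> z = 0) \<Longrightarrow> hess \<psi> q *v h = 0"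
      using tan[OF False] by (auto simp: sym_tang_iff)
    have mem: "grad \<psi> q \<in> tang_space (grad \<psi> q) \<phi>"
    proof -
      have "0 \<in> tang (grad \<psi> q) \<phi>" by (simp add: tang_def)
      then show ?thesis unfolding tang_space_def
        by (intro CollectI exI[of _ "grad \<psi> q"] exI[of _ 0]) (auto intro: span_base)
    qed
    have "H q *v h = 0" if "\<forall>z\<in>tang_space (grad \<psi> q) \<phi>. h \<bullet> z = 0" for h
    proof -
      have "h \<bullet> grad \<psi> q = 0" using that mem by blast
      then have "grad \<psi> q \<bullet> h = 0" by (simp add: inner_commute)
      then show ?thesis
        using hk[OF that] by (simp add: H_def matrix_vector_mult_add_rdistrib scaleR_matrix_vector_assoc[symmetric] outer_mult)
    qed
    moreover have "H q \<in> sym_matrices" unfolding H_def by (intro sym_matrices_closed_ops hs outer_sym)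
    ultimately show ?thesis by (simp add: sym_tang_iff ts)
  qed
  have "c * m ^ 4 * norm q ^ 4 \<le> \<theta> q" for q
  proof -
    have "(m * norm q) ^ 4 \<le> \<psi> q ^ 4" using m by (intro power_mono) auto
    then show ?thesis using c by (simp add: \<theta>_def power_mult_distrib mult.assoc)
  qed
  then show thesis using that[of \<theta> g H] D\<theta> Dg HC HT zero by blast
qed

section \<open>Jets at a maximum of the doubled function\<close>

text \<open>The term \<open>\<gamma> / (T - t)\<close> keeps maximum points away from the final time and contributes its
  derivative to the strict inequality between the two equations. The second time derivative is replaced by
  twice its value, which gives a bound valid for all times within half the distance to \<open>T\<close>.\<close>
lemma penalty_superjet:
  fixes z :: "'a::euclidean_space \<times> real"
  assumes "snd z < T" "0 \<le> \<gamma>"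
  shows "superjet (\<lambda>z. \<alpha> * (norm (fst z))\<^sup>2 + \<gamma> / (T - snd z)) z ((2 * \<alpha>) *\<^sub>R fst z, \<gamma> / (T - snd z)\<^sup>2)
    (\<lambda>h. ((2 * \<alpha>) *\<^sub>R fst h, 4 * \<gamma> / (T - snd z) ^ 3 * snd h))"
  unfolding superjet_def
proof (intro allI impI)
  fix \<epsilon> :: real assume "\<epsilon> > 0"
  define e where "e = T - snd z"
  have "e > 0" using assms by (simp add: e_def)
  have "\<alpha> * (norm (fst (z + h)))\<^sup>2 + \<gamma> / (T - snd (z + h)) \<le>
      \<alpha> * (norm (fst z))\<^sup>2 + \<gamma> / e + ((2 * \<alpha>) *\<^sub>R fst z, \<gamma> / e\<^sup>2) \<bullet> h +
      ((2 * \<alpha>) *\<^sub>R fst h, 4 * \<gamma> / e ^ 3 * snd h) \<bullet> h / 2 + \<epsilon> * (norm h)\<^sup>2" if h: "norm h < e / 2" for h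
  proof -
    define k where "k = snd h"
    have "\<bar>k\<bar> < e / 2" using h norm_snd_le[of k "fst h"] by (simp add: k_def)
    then have ek: "e - k > 0" "e - k \<ge> e / 2" using \<open>e > 0\<close> by (auto simp: abs_less_iff)
    have 1: "\<alpha> * (norm (fst (z + h)))\<^sup>2 = \<alpha> * (norm (fst z))\<^sup>2 + (2 * \<alpha>) * (fst z \<bullet> fst h) + \<alpha> * (fst h \<bullet> fst h)"
      by (simp add: power2_norm_eq_inner inner_add_left inner_add_right inner_commute algebra_simps)
    have "\<gamma> / (e - k) = \<gamma> / e + \<gamma> / e\<^sup>2 * k + \<gamma> * k\<^sup>2 / (e\<^sup>2 * (e - k))"
      using ek \<open>e > 0\<close> by (simp add: divide_simps power2_eq_square) (simp add: algebra_simps)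
    also have "\<gamma> * k\<^sup>2 / (e\<^sup>2 * (e - k)) \<le> \<gamma> * k\<^sup>2 / (e\<^sup>2 * (e / 2))"
      using ek \<open>e > 0\<close> assms by (intro divide_left_mono mult_left_mono) auto
    also have "\<dots> = 4 * \<gamma> / e ^ 3 * k * k / 2" using \<open>e > 0\<close> by (simp add: power2_eq_square power3_eq_cube field_simps)
    finally have 2: "\<gamma> / (e - k) \<le> \<gamma> / e + \<gamma> / e\<^sup>2 * k + 4 * \<gamma> / e ^ 3 * k * k / 2" by simp
    have 3: "T - snd (z + h) = e - k" by (simp add: e_def k_def)
    have 4: "((2 * \<alpha>) *\<^sub>R fst z, \<gamma> / e\<^sup>2) \<bullet> h = (2 * \<alpha>) * (fst z \<bullet> fst h) + \<gamma> / e\<^sup>2 * k"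
      "((2 * \<alpha>) *\<^sub>R fst h, 4 * \<gamma> / e ^ 3 * snd h) \<bullet> h / 2 = \<alpha> * (fst h \<bullet> fst h) + 4 * \<gamma> / e ^ 3 * k * k / 2"
      by (simp_all add: inner_prod_def k_def add_divide_distrib)
    have "0 \<le> \<epsilon> * (norm h)\<^sup>2" using \<open>\<epsilon> > 0\<close> by simp
    then show ?thesis unfolding 1 3 4 using 2 by linarith
  qed
  then show "\<exists>r>0. \<forall>h. norm h < r \<longrightarrow> \<alpha> * (norm (fst (z + h)))\<^sup>2 + \<gamma> / (T - snd (z + h)) \<le>
      \<alpha> * (norm (fst z))\<^sup>2 + \<gamma> / (T - snd z) + ((2 * \<alpha>) *\<^sub>R fst z, \<gamma> / (T - snd z)\<^sup>2) \<bullet> h +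
      ((2 * \<alpha>) *\<^sub>R fst h, 4 * \<gamma> / (T - snd z) ^ 3 * snd h) \<bullet> h / 2 + \<epsilon> * (norm h)\<^sup>2"
    unfolding e_def[symmetric] using \<open>e > 0\<close> by (intro exI[of _ "e / 2"]) auto
qed

text \<open>The theorem on sums is applied to a function that has been translated to the origin, freed of its affine
  part \<open>k + b \<bullet> z\<close> and stretched in time by \<open>1 / \<sigma>\<close>. Here the jet is carried back.\<close>
lemma rescaled_superjet:
  fixes W :: "(real^'n) \<times> real \<Rightarrow> real"
  assumes \<sigma>: "0 < \<sigma>"
    and jet: "superjet (\<lambda>z. W (fst c + fst z, snd c + \<sigma> * snd z) + (- k + - b \<bullet> z)) z p X" and X: "linear X"
  obtains D where "linear D" "\<And>x y. D x \<bullet> y = x \<bullet> D y"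
    "superjet W (fst c + fst z, snd c + \<sigma> * snd z) (fst p + fst b, (snd p + snd b) / \<sigma>) D"
    "\<And>h. fst (D (h, 0)) \<bullet> h = X (h, 0) \<bullet> (h, 0)"
proof -
  define A where "A = (\<lambda>z::(real^'n) \<times> real. (fst z, \<sigma> * snd z))"
  define A' where "A' = (\<lambda>z::(real^'n) \<times> real. (fst z, snd z / \<sigma>))"
  have A: "linear A" "linear A'" by (auto intro!: linearI simp: A_def A'_def algebra_simps add_divide_distrib)
  have inv: "A (A' h) = h" for h using \<sigma> by (simp add: A_def A'_def)
  have adj: "adjoint A' = A'"
    by (rule adjoint_unique) (auto simp: A'_def inner_prod_def)
  define Xs where "Xs = (\<lambda>h. (1 / 2) *\<^sub>R (X h + adjoint X h))"
  have Xs: "superjet (\<lambda>z. W (fst c + fst z, snd c + \<sigma> * snd z) + (- k + - b \<bullet> z)) z p Xs" "linear Xs"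
    "Xs h \<bullet> h' = h \<bullet> Xs h'" "Xs h \<bullet> h = X h \<bullet> h" for h h'
    unfolding Xs_def by (rule superjet_symmetrize[OF jet X])+
  have "superjet (\<lambda>z. (W (fst c + fst z, snd c + \<sigma> * snd z) + (- k + - b \<bullet> z)) + (k + b \<bullet> z)) z (p + b) (\<lambda>h. Xs h + 0)"
    by (rule superjet_add[OF Xs(1) superjet_affine])
  then have "superjet (\<lambda>z. W (c + A z)) z (p + b) Xs"
    by (simp add: A_def prod_eq_iff plus_prod_def)
  from superjet_affine_change[OF this A inv]
  have "superjet W (c + A z) (A' (p + b)) (\<lambda>h. A' (Xs (A' h)))" unfolding adj .
  then have J: "superjet W (fst c + fst z, snd c + \<sigma> * snd z) (fst p + fst b, (snd p + snd b) / \<sigma>) (\<lambda>h. A' (Xs (A' h)))"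
    by (simp add: A_def A'_def plus_prod_def)
  have self: "A' x \<bullet> y = x \<bullet> A' y" for x y by (simp add: A'_def inner_prod_def)
  show thesis
  proof (rule that[OF _ _ J])
    show "linear (\<lambda>h. A' (Xs (A' h)))"
      using linear_add[OF A(2)] linear_scale[OF A(2)] linear_add[OF Xs(2)] linear_scale[OF Xs(2)] by (intro linearI) auto
    show "A' (Xs (A' x)) \<bullet> y = x \<bullet> A' (Xs (A' y))" for x y unfolding self Xs(3) ..
    show "fst (A' (Xs (A' (h, 0)))) \<bullet> h = X (h, 0) \<bullet> (h, 0)" for h
      using Xs(4)[of "(h, 0)"] by (simp add: A'_def inner_prod_def)
  qed
qed

text \<open>The theorem on sums at a maximum of \<open>W (x, t) + V (y, s) - \<theta> (x - y) - ((t - s) / \<sigma>)\<^sup>2 / 2\<close>. Time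
  is measured in units of \<open>\<sigma>\<close>, which turns the last term into a quadratic form with coefficient one. This keeps the
  norm of the form \<open>L\<close>, and with it the bounds on the second-order parts, independent of \<open>\<sigma>\<close>.
  The purely temporal entries of the form are lost when the inequality is restricted to spatial directions.\<close>
lemma doubling_jets:
  fixes W V :: "(real^'n) \<times> real \<Rightarrow> real" and \<theta> :: "real^'n \<Rightarrow> real" and g :: "real^'n \<Rightarrow> real^'n" and H :: "real^'n^'n"
    and x\<^sub>0 y\<^sub>0 :: "real^'n" and t\<^sub>0 s\<^sub>0 \<Lambda> \<sigma> \<rho> \<kappa> \<delta> :: real
  assumes \<theta>: "\<And>q. (\<theta> has_derivative (\<lambda>h. g q \<bullet> h)) (at q)" and g: "(g has_derivative (\<lambda>h. H *v h)) (at (x\<^sub>0 - y\<^sub>0))"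
    and H: "H \<in> sym_matrices" and \<Lambda>: "0 \<le> \<Lambda>" "\<And>h. norm (H *v h) \<le> \<Lambda> * norm h"
    and \<sigma>: "0 < \<sigma>" "\<sigma> \<le> 1" and \<rho>: "0 < \<rho>"
    and W: "usc_on (cball x\<^sub>0 \<rho> \<times> cball t\<^sub>0 \<rho>) W" and V: "usc_on (cball y\<^sub>0 \<rho> \<times> cball s\<^sub>0 \<rho>) V"
    and max: "\<And>x t y s. x \<in> cball x\<^sub>0 \<rho> \<Longrightarrow> t \<in> cball t\<^sub>0 \<rho> \<Longrightarrow> y \<in> cball y\<^sub>0 \<rho> \<Longrightarrow> s \<in> cball s\<^sub>0 \<rho> \<Longrightarrow>
       W (x, t) + V (y, s) - \<theta> (x - y) - ((t - s) / \<sigma>)\<^sup>2 / 2 \<le> W (x\<^sub>0, t\<^sub>0) + V (y\<^sub>0, s\<^sub>0) - \<theta> (x\<^sub>0 - y\<^sub>0) - ((t\<^sub>0 - s\<^sub>0) / \<sigma>)\<^sup>2 / 2"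
    and \<kappa>: "0 < \<kappa>" "\<kappa> \<le> 1" and \<delta>: "0 < \<delta>"
  obtains z\<^sub>1 z\<^sub>2 p\<^sub>1 p\<^sub>2 a\<^sub>1 a\<^sub>2 D\<^sub>1 D\<^sub>2 where
    "norm (fst z\<^sub>1 - x\<^sub>0) < \<delta>" "\<bar>snd z\<^sub>1 - t\<^sub>0\<bar> < \<delta>" "norm (fst z\<^sub>2 - y\<^sub>0) < \<delta>" "\<bar>snd z\<^sub>2 - s\<^sub>0\<bar> < \<delta>"
    "norm (p\<^sub>1 - g (x\<^sub>0 - y\<^sub>0)) < \<delta>" "norm (p\<^sub>2 + g (x\<^sub>0 - y\<^sub>0)) < \<delta>" "- \<delta> < a\<^sub>1 + a\<^sub>2"
    "linear D\<^sub>1" "\<And>x y. D\<^sub>1 x \<bullet> y = x \<bullet> D\<^sub>1 y" "superjet W z\<^sub>1 (p\<^sub>1, a\<^sub>1) D\<^sub>1"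
    "linear D\<^sub>2" "\<And>x y. D\<^sub>2 x \<bullet> y = x \<bullet> D\<^sub>2 y" "superjet V z\<^sub>2 (p\<^sub>2, a\<^sub>2) D\<^sub>2"
    "\<And>h. - (16 * (\<Lambda> + 3)) * (norm h)\<^sup>2 \<le> fst (D\<^sub>1 (h, 0)) \<bullet> h"
    "\<And>k. - (16 * (\<Lambda> + 3)) * (norm k)\<^sup>2 \<le> fst (D\<^sub>2 (k, 0)) \<bullet> k"
    "\<And>h k. fst (D\<^sub>1 (h, 0)) \<bullet> h + fst (D\<^sub>2 (k, 0)) \<bullet> k
       \<le> (h - k) \<bullet> (H *v (h - k)) + (norm (H *v (h - k)))\<^sup>2 + \<kappa> * ((norm h)\<^sup>2 + (norm k)\<^sup>2)"
proof -
  define q where "q = x\<^sub>0 - y\<^sub>0"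
  \<comment> \<open>A share of \<open>\<kappa>\<close> that pays for the error of the expansion of \<open>\<theta>\<close>.\<close>
  define \<kappa>' where "\<kappa>' = \<kappa> / 16"
  have \<kappa>': "0 < \<kappa>'" "\<kappa>' \<le> 1 / 16" using \<kappa> by (auto simp: \<kappa>'_def)
  obtain r\<^sub>1 where r\<^sub>1: "r\<^sub>1 > 0" "\<And>h. norm h < r\<^sub>1 \<Longrightarrow> \<bar>\<theta> (q + h) - (\<theta> q + g q \<bullet> h + (H *v h) \<bullet> h / 2)\<bar> \<le> \<kappa>' * (norm h)\<^sup>2"
    using second_order_expansion[OF \<theta> g \<kappa>'(1)] unfolding q_def by blast
  define r where "r = min \<rho> (r\<^sub>1 / 3)"
  have r: "0 < r" "r \<le> \<rho>" "2 * r < r\<^sub>1" using \<rho> r\<^sub>1(1) by (auto simp: r_def)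
  define b where "b = (t\<^sub>0 - s\<^sub>0) / \<sigma>"
  define u where "u = (\<lambda>z. W (fst (x\<^sub>0, t\<^sub>0) + fst z, snd (x\<^sub>0, t\<^sub>0) + \<sigma> * snd z) + (- W (x\<^sub>0, t\<^sub>0) + - (g q, b) \<bullet> z))"
  define v where "v = (\<lambda>z. V (fst (y\<^sub>0, s\<^sub>0) + fst z, snd (y\<^sub>0, s\<^sub>0) + \<sigma> * snd z) + (- V (y\<^sub>0, s\<^sub>0) + - (- g q, - b) \<bullet> z))"
  have in_ball: "c + fst z \<in> cball c \<rho>" "d + \<sigma> * snd z \<in> cball d \<rho>" if "norm z \<le> r" for z :: "(real^'n) \<times> real" and c d
  proof -
    have "norm (fst z) \<le> r" "\<bar>snd z\<bar> \<le> r"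
      using that norm_fst_le[of "fst z" "snd z"] norm_snd_le[of "snd z" "fst z"] by auto
    moreover have "\<sigma> * \<bar>snd z\<bar> \<le> \<bar>snd z\<bar>" using \<sigma> by (simp add: mult_left_le_one_le)
    ultimately show "c + fst z \<in> cball c \<rho>" "d + \<sigma> * snd z \<in> cball d \<rho>"
      using r \<sigma> by (auto simp: dist_norm abs_mult)
  qed
  have uscu: "usc_on (cball 0 r) u"
    unfolding u_def
    by (intro usc_on_add_continuous usc_on_compose[OF W] continuous_intros) (use in_ball in \<open>auto\<close>)
  have uscv: "usc_on (cball 0 r) v"
    unfolding v_def
    by (intro usc_on_add_continuous usc_on_compose[OF V] continuous_intros) (use in_ball in \<open>auto\<close>)
  define C where "C = H + (2 * \<kappa>') *\<^sub>R mat 1"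
  have Ch: "C *v h = H *v h + (2 * \<kappa>') *\<^sub>R h" for h
    by (simp add: C_def matrix_vector_mult_add_rdistrib scaleR_matrix_vector_assoc[symmetric])
  have Csym: "C \<in> sym_matrices" unfolding C_def by (intro sym_matrices_closed_ops H mat_1_sym)
  define B where "B = (\<lambda>d::(real^'n) \<times> real. (C *v fst d, snd d))"
  define L where "L = (\<lambda>z. (B (fst z - snd z), - B (fst z - snd z)))"
  define M where "M = 4 * (\<Lambda> + 3)"
  have M: "12 \<le> M" using \<Lambda> by (simp add: M_def)
  have linB: "linear B"
    by (rule linearI) (simp_all add: B_def matrix_vector_right_distrib matrix_vector_mult_scaleR)
  have linL: "linear L"
  proof (rule linearI)
    fix z w :: "((real^'n) \<times> real) \<times> ((real^'n) \<times> real)" and c :: real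
    have "fst (z + w) - snd (z + w) = (fst z - snd z) + (fst w - snd w)" by simp
    then show "L (z + w) = L z + L w" unfolding L_def by (simp only: linear_add[OF linB]) simp
    have "fst (c *\<^sub>R z) - snd (c *\<^sub>R z) = c *\<^sub>R (fst z - snd z)" by (simp add: scaleR_diff_right)
    then show "L (c *\<^sub>R z) = c *\<^sub>R L z" unfolding L_def by (simp only: linear_scale[OF linB]) simp
  qed
  have symB: "B x \<bullet> y = x \<bullet> B y" for x y
    by (simp add: B_def inner_prod_def sym_matrix_inner[OF Csym])
  have symL: "L z \<bullet> w = z \<bullet> L w" for z w
    by (simp add: L_def inner_prod_def[of "(_, _)"] inner_prod_def[of z] linear_diff[OF linB] inner_diff_left inner_diff_right symB)
  have Lq: "z \<bullet> L z = (fst z - snd z) \<bullet> B (fst z - snd z)" for z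
    by (simp add: L_def inner_prod_def[of z] inner_diff_left)
  have nB: "norm (B d) \<le> (\<Lambda> + 3) * norm d" for d
  proof -
    have "norm (B d) \<le> norm (C *v fst d) + norm (snd d)" unfolding B_def by (rule norm_Pair_le)
    also have "\<dots> \<le> (norm (H *v fst d) + norm ((2 * \<kappa>') *\<^sub>R fst d)) + norm (snd d)"
      unfolding Ch by (intro add_mono norm_triangle_ineq) auto
    also have "\<dots> \<le> (\<Lambda> * norm (fst d) + 1 * norm (fst d)) + norm (snd d)"
    proof -
      have "norm ((2 * \<kappa>') *\<^sub>R fst d) \<le> 1 * norm (fst d)"
        unfolding norm_scaleR using \<kappa>' by (intro mult_right_mono) auto
      then show ?thesis using \<Lambda>(2)[of "fst d"] by simp
    qed
    also have "\<dots> \<le> (\<Lambda> * norm d + 1 * norm d) + norm d"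
      using \<Lambda> norm_fst_le[of "fst d" "snd d"] norm_snd_le[of "snd d" "fst d"]
      by (intro add_mono mult_left_mono) auto
    also have "\<dots> \<le> (\<Lambda> + 3) * norm d" by (simp add: distrib_right)
    finally show ?thesis .
  qed
  have nL: "norm (L z) \<le> M * norm z" for z
  proof -
    define d where "d = fst z - snd z"
    have "norm d \<le> norm (fst z) + norm (snd z)" unfolding d_def by (rule norm_triangle_ineq4)
    then have nd: "norm d \<le> 2 * norm z"
      using norm_fst_le[of "fst z" "snd z"] norm_snd_le[of "snd z" "fst z"] by simp
    have "norm (L z) \<le> norm (B d) + norm (- B d)" by (simp only: L_def d_def norm_Pair_le)
    also have "\<dots> \<le> 2 * ((\<Lambda> + 3) * norm d)" using nB[of d] by simp
    also have "\<dots> \<le> 2 * ((\<Lambda> + 3) * (2 * norm z))" using nd \<Lambda> by (intro mult_left_mono) auto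
    finally show ?thesis by (simp add: M_def algebra_simps)
  qed
  have le: "u x + v y \<le> (x, y) \<bullet> L (x, y) / 2" if xy: "norm x \<le> r" "norm y \<le> r" for x y
  proof -
    define h where "h = fst x - fst y"
    define k where "k = snd x - snd y"
    have "norm (x - y) \<le> norm x + norm y" by (rule norm_triangle_ineq4)
    then have "norm h < r\<^sub>1"
      using xy r norm_fst_le[of "fst x - fst y" "snd x - snd y"] by (simp add: h_def minus_prod_def)
    from r\<^sub>1(2)[OF this] have "\<theta> (q + h) \<le> \<theta> q + g q \<bullet> h + (H *v h) \<bullet> h / 2 + \<kappa>' * (norm h)\<^sup>2" by (simp add: abs_le_iff)
    then have \<theta>h: "\<theta> (q + h) \<le> \<theta> q + g q \<bullet> h + (C *v h) \<bullet> h / 2"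
      by (simp add: Ch inner_add_left power2_norm_eq_inner add_divide_distrib)
    have "W (x\<^sub>0 + fst x, t\<^sub>0 + \<sigma> * snd x) + V (y\<^sub>0 + fst y, s\<^sub>0 + \<sigma> * snd y)
        - \<theta> ((x\<^sub>0 + fst x) - (y\<^sub>0 + fst y)) - (((t\<^sub>0 + \<sigma> * snd x) - (s\<^sub>0 + \<sigma> * snd y)) / \<sigma>)\<^sup>2 / 2
        \<le> W (x\<^sub>0, t\<^sub>0) + V (y\<^sub>0, s\<^sub>0) - \<theta> (x\<^sub>0 - y\<^sub>0) - ((t\<^sub>0 - s\<^sub>0) / \<sigma>)\<^sup>2 / 2"
      using xy by (intro max in_ball)
    moreover have "(x\<^sub>0 + fst x) - (y\<^sub>0 + fst y) = q + h" by (simp add: q_def h_def)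
    moreover have "((t\<^sub>0 + \<sigma> * snd x) - (s\<^sub>0 + \<sigma> * snd y)) / \<sigma> = b + k"
      using \<sigma> by (simp add: b_def k_def field_simps)
    moreover have "(t\<^sub>0 - s\<^sub>0) / \<sigma> = b" "x\<^sub>0 - y\<^sub>0 = q" by (auto simp: b_def q_def)
    ultimately have "W (x\<^sub>0 + fst x, t\<^sub>0 + \<sigma> * snd x) + V (y\<^sub>0 + fst y, s\<^sub>0 + \<sigma> * snd y)
       - W (x\<^sub>0, t\<^sub>0) - V (y\<^sub>0, s\<^sub>0) \<le> \<theta> (q + h) - \<theta> q + ((b + k)\<^sup>2 / 2 - b\<^sup>2 / 2)" by simp
    also have "(b + k)\<^sup>2 / 2 - b\<^sup>2 / 2 = b * k + k * k / 2" by (simp add: power2_eq_square field_simps)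
    finally have "W (x\<^sub>0 + fst x, t\<^sub>0 + \<sigma> * snd x) + V (y\<^sub>0 + fst y, s\<^sub>0 + \<sigma> * snd y)
       - W (x\<^sub>0, t\<^sub>0) - V (y\<^sub>0, s\<^sub>0) \<le> g q \<bullet> h + (C *v h) \<bullet> h / 2 + b * k + k * k / 2" using \<theta>h by linarith
    moreover have "(x, y) \<bullet> L (x, y) / 2 = (C *v h) \<bullet> h / 2 + k * k / 2"
      unfolding Lq by (simp add: B_def h_def k_def inner_prod_def inner_commute add_divide_distrib)
    moreover have "u x + v y = (W (x\<^sub>0 + fst x, t\<^sub>0 + \<sigma> * snd x) + V (y\<^sub>0 + fst y, s\<^sub>0 + \<sigma> * snd y)
       - W (x\<^sub>0, t\<^sub>0) - V (y\<^sub>0, s\<^sub>0)) - g q \<bullet> h - b * k"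
      by (simp add: u_def v_def h_def k_def inner_prod_def inner_diff_right right_diff_distrib)
    ultimately show ?thesis by linarith
  qed
  have u0: "u 0 = 0" and v0: "v 0 = 0" by (auto simp: u_def v_def)
  \<comment> \<open>Two time slopes of this size remain small after division by \<open>\<sigma>\<close>.\<close>
  define \<delta>' where "\<delta>' = min \<delta> (\<delta> * \<sigma> / 2)"
  have \<delta>': "0 < \<delta>'" "\<delta>' \<le> \<delta>" "\<delta>' \<le> \<delta> * \<sigma> / 2" using \<delta> \<sigma> by (auto simp: \<delta>'_def)
  have k2: "0 < \<kappa> / 2" "\<kappa> / 2 \<le> M" using \<kappa> M by auto
  have "0 < M" using M by simp
  obtain x y p p' X Y where xy: "norm x < \<delta>'" "norm y < \<delta>'" "norm p < \<delta>'" "norm p' < \<delta>'"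
    and XY: "linear X" "linear Y" "superjet u x p X" "superjet v y p' Y"
    "\<And>h. - 4 * M * (norm h)\<^sup>2 \<le> X h \<bullet> h" "\<And>k. - 4 * M * (norm k)\<^sup>2 \<le> Y k \<bullet> k"
    "\<And>h k. X h \<bullet> h + Y k \<bullet> k \<le> (h, k) \<bullet> L (h, k) + (norm (L (h, k)))\<^sup>2 / M + \<kappa> / 2 * (norm (h, k))\<^sup>2"
    using theorem_on_sums[OF r(1) uscu uscv u0 v0 linL symL nL \<open>0 < M\<close> le k2 \<delta>'(1)] by blast
  obtain D\<^sub>1 where D\<^sub>1: "linear D\<^sub>1" "\<And>x y. D\<^sub>1 x \<bullet> y = x \<bullet> D\<^sub>1 y"
    "superjet W (fst (x\<^sub>0, t\<^sub>0) + fst x, snd (x\<^sub>0, t\<^sub>0) + \<sigma> * snd x) (fst p + fst (g q, b), (snd p + snd (g q, b)) / \<sigma>) D\<^sub>1"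
    "\<And>h. fst (D\<^sub>1 (h, 0)) \<bullet> h = X (h, 0) \<bullet> (h, 0)"
    using rescaled_superjet[OF \<sigma>(1) XY(3)[unfolded u_def] XY(1)] by blast
  obtain D\<^sub>2 where D\<^sub>2: "linear D\<^sub>2" "\<And>x y. D\<^sub>2 x \<bullet> y = x \<bullet> D\<^sub>2 y"
    "superjet V (fst (y\<^sub>0, s\<^sub>0) + fst y, snd (y\<^sub>0, s\<^sub>0) + \<sigma> * snd y) (fst p' + fst (- g q, - b), (snd p' + snd (- g q, - b)) / \<sigma>) D\<^sub>2"
    "\<And>h. fst (D\<^sub>2 (h, 0)) \<bullet> h = Y (h, 0) \<bullet> (h, 0)"
    using rescaled_superjet[OF \<sigma>(1) XY(4)[unfolded v_def] XY(2)] by blast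
  have comp: "norm (fst z) < \<delta>'" "\<bar>snd z\<bar> < \<delta>'" "\<bar>\<sigma> * snd z\<bar> < \<delta>" if "norm z < \<delta>'" for z :: "(real^'n) \<times> real"
  proof -
    show 1: "norm (fst z) < \<delta>'" "\<bar>snd z\<bar> < \<delta>'"
      using that norm_fst_le[of "fst z" "snd z"] norm_snd_le[of "snd z" "fst z"] by auto
    have "\<sigma> * \<bar>snd z\<bar> \<le> \<bar>snd z\<bar>" using \<sigma> by (simp add: mult_left_le_one_le)
    then show "\<bar>\<sigma> * snd z\<bar> < \<delta>" using 1 \<delta>' \<sigma> by (simp add: abs_mult)
  qed
  have slope: "- \<delta> < (snd p + b) / \<sigma> + (snd p' + - b) / \<sigma>"
  proof -
    have "- (\<delta> * \<sigma>) < snd p + snd p'" using comp(2)[OF xy(3)] comp(2)[OF xy(4)] \<delta>'(3) by (simp add: abs_less_iff field_simps)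
    then have "- \<delta> < (snd p + snd p') / \<sigma>" using \<sigma> by (simp add: less_divide_eq)
    then show ?thesis by (simp add: add_divide_distrib diff_divide_distrib)
  qed
  have ineq: "fst (D\<^sub>1 (h, 0)) \<bullet> h + fst (D\<^sub>2 (k, 0)) \<bullet> k
       \<le> (h - k) \<bullet> (H *v (h - k)) + (norm (H *v (h - k)))\<^sup>2 + \<kappa> * ((norm h)\<^sup>2 + (norm k)\<^sup>2)" for h k
  proof -
    define d where "d = h - k"
    define N where "N = (norm h)\<^sup>2 + (norm k)\<^sup>2"
    have "(norm (h + k))\<^sup>2 + (norm d)\<^sup>2 = 2 * N"
      by (simp add: d_def N_def power2_norm_eq_inner inner_add_left inner_add_right inner_diff_left inner_diff_right inner_commute)
    then have dN: "(norm d)\<^sup>2 \<le> 2 * N" using zero_le_power2[of "norm (h + k)"] by linarith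
    have Bd: "B (fst ((h, 0), (k, 0)) - snd ((h, 0), (k, 0))) = (C *v d, 0)" by (simp add: B_def d_def)
    have 1: "((h, 0), (k, 0)) \<bullet> L ((h, 0), (k, 0)) = d \<bullet> (H *v d) + 2 * \<kappa>' * (norm d)\<^sup>2"
      unfolding Lq Bd by (simp add: d_def[symmetric] Ch inner_prod_def inner_add_right power2_norm_eq_inner)
    have 2: "(norm (L ((h, 0), (k, 0))))\<^sup>2 = 2 * (norm (C *v d))\<^sup>2"
      unfolding L_def Bd by (simp add: norm_prod_def)
    have par: "(norm (a - w))\<^sup>2 + (norm (a + w))\<^sup>2 = 2 * (norm a)\<^sup>2 + 2 * (norm w)\<^sup>2" for a w :: "real^'n"
      by (simp add: power2_norm_eq_inner inner_add_left inner_add_right inner_diff_left inner_diff_right inner_commute)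
    have 3: "(norm (C *v d))\<^sup>2 \<le> 2 * (norm (H *v d))\<^sup>2 + 2 * (2 * \<kappa>')\<^sup>2 * (norm d)\<^sup>2"
    proof -
      have "(norm (H *v d - (2 * \<kappa>') *\<^sub>R d))\<^sup>2 + (norm (C *v d))\<^sup>2 = 2 * (norm (H *v d))\<^sup>2 + 2 * (norm ((2 * \<kappa>') *\<^sub>R d))\<^sup>2"
        using par[of "H *v d" "(2 * \<kappa>') *\<^sub>R d"] unfolding Ch .
      moreover have "(norm ((2 * \<kappa>') *\<^sub>R d))\<^sup>2 = (2 * \<kappa>')\<^sup>2 * (norm d)\<^sup>2" by (simp add: power_mult_distrib)
      ultimately show ?thesis using zero_le_power2[of "norm (H *v d - (2 * \<kappa>') *\<^sub>R d)"] by linarith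
    qed
    have "2 * (norm (C *v d))\<^sup>2 / M \<le> 2 * (norm (C *v d))\<^sup>2 / 4"
      using M by (intro divide_left_mono) auto
    also have "\<dots> \<le> (2 * (norm (H *v d))\<^sup>2 + 2 * (2 * \<kappa>')\<^sup>2 * (norm d)\<^sup>2) / 2"
      using 3 by simp
    also have "\<dots> = (norm (H *v d))\<^sup>2 + 4 * \<kappa>'\<^sup>2 * (norm d)\<^sup>2" by (simp add: power_mult_distrib)
    also have "\<dots> \<le> (norm (H *v d))\<^sup>2 + 1 * \<kappa>' * (norm d)\<^sup>2"
      using \<kappa>' by (intro add_left_mono mult_right_mono) (auto simp: power2_eq_square)
    finally have 4: "2 * (norm (C *v d))\<^sup>2 / M \<le> (norm (H *v d))\<^sup>2 + \<kappa>' * (norm d)\<^sup>2" by simp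
    have 5: "(norm ((h, 0::real), (k, 0::real)))\<^sup>2 = N" by (simp add: norm_prod_def N_def)
    have "fst (D\<^sub>1 (h, 0)) \<bullet> h + fst (D\<^sub>2 (k, 0)) \<bullet> k
      \<le> d \<bullet> (H *v d) + 2 * \<kappa>' * (norm d)\<^sup>2 + 2 * (norm (C *v d))\<^sup>2 / M + \<kappa> / 2 * N"
      using XY(7)[of "(h, 0)" "(k, 0)"] unfolding D\<^sub>1(4) D\<^sub>2(4) 1 2 5 .
    also have "\<dots> \<le> d \<bullet> (H *v d) + (norm (H *v d))\<^sup>2 + 3 * \<kappa>' * (norm d)\<^sup>2 + \<kappa> / 2 * N"
      using 4 by simp
    also have "\<dots> \<le> d \<bullet> (H *v d) + (norm (H *v d))\<^sup>2 + \<kappa> * N"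
    proof -
      have "3 * \<kappa>' * (norm d)\<^sup>2 \<le> 3 * \<kappa>' * (2 * N)" using dN \<kappa>' by (intro mult_left_mono) auto
      moreover have "0 \<le> \<kappa> * N" using \<kappa> by (simp add: N_def)
      ultimately show ?thesis by (simp add: \<kappa>'_def field_simps)
    qed
    finally show ?thesis by (simp add: d_def N_def)
  qed
  have lowM: "- (16 * (\<Lambda> + 3)) * (norm h)\<^sup>2 = - 4 * M * (norm (h, 0::real))\<^sup>2" for h :: "real^'n"
    by (simp add: M_def norm_prod_def)
  show thesis
  proof (rule that[OF _ _ _ _ _ _ _ D\<^sub>1(1,2,3) D\<^sub>2(1,2,3)])
    show "- (16 * (\<Lambda> + 3)) * (norm h)\<^sup>2 \<le> fst (D\<^sub>1 (h, 0)) \<bullet> h" for h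
      unfolding D\<^sub>1(4) lowM by (rule XY(5))
    show "- (16 * (\<Lambda> + 3)) * (norm k)\<^sup>2 \<le> fst (D\<^sub>2 (k, 0)) \<bullet> k" for k
      unfolding D\<^sub>2(4) lowM by (rule XY(6))
    show "norm (fst (fst (x\<^sub>0, t\<^sub>0) + fst x, snd (x\<^sub>0, t\<^sub>0) + \<sigma> * snd x) - x\<^sub>0) < \<delta>"
      "\<bar>snd (fst (x\<^sub>0, t\<^sub>0) + fst x, snd (x\<^sub>0, t\<^sub>0) + \<sigma> * snd x) - t\<^sub>0\<bar> < \<delta>"
      using comp[OF xy(1)] \<delta>'(2) by simp_all
    show "norm (fst (fst (y\<^sub>0, s\<^sub>0) + fst y, snd (y\<^sub>0, s\<^sub>0) + \<sigma> * snd y) - y\<^sub>0) < \<delta>"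
      "\<bar>snd (fst (y\<^sub>0, s\<^sub>0) + fst y, snd (y\<^sub>0, s\<^sub>0) + \<sigma> * snd y) - s\<^sub>0\<bar> < \<delta>"
      using comp[OF xy(2)] \<delta>'(2) by simp_all
    show "norm (fst p + fst (g q, b) - g (x\<^sub>0 - y\<^sub>0)) < \<delta>"
      using comp(1)[OF xy(3)] \<delta>'(2) by (simp add: q_def)
    show "norm (fst p' + fst (- g q, - b) + g (x\<^sub>0 - y\<^sub>0)) < \<delta>"
      using comp(1)[OF xy(4)] \<delta>'(2) by (simp add: q_def)
    show "- \<delta> < (snd p + snd (g q, b)) / \<sigma> + (snd p' + snd (- g q, - b)) / \<sigma>"
      using slope by simp
    show "fst (D\<^sub>1 (h, 0)) \<bullet> h + fst (D\<^sub>2 (k, 0)) \<bullet> k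
       \<le> (h - k) \<bullet> (H *v (h - k)) + (norm (H *v (h - k)))\<^sup>2 + \<kappa> * ((norm h)\<^sup>2 + (norm k)\<^sup>2)" for h k
      by (rule ineq)
  qed
qed

lemma norm_matrix_vector_le:
  fixes A :: "real^'n^'m"
  shows "norm (A *v x) \<le> real CARD('m) * norm A * norm x"
proof -
  have "norm (A *v x) \<le> (\<Sum>i\<in>UNIV. \<bar>(A *v x) $ i\<bar>)" by (rule norm_le_l1_cart)
  also have "\<dots> \<le> (\<Sum>i\<in>(UNIV::'m set). norm A * norm x)"
  proof (rule sum_mono)
    fix i
    have "\<bar>(A *v x) $ i\<bar> = \<bar>A $ i \<bullet> x\<bar>" by (simp add: matrix_vector_mul_component)
    also have "\<dots> \<le> norm (A $ i) * norm x" by (rule Cauchy_Schwarz_ineq2)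
    also have "\<dots> \<le> norm A * norm x" by (rule mult_right_mono[OF Finite_Cartesian_Product.norm_nth_le]) simp
    finally show "\<bar>(A *v x) $ i\<bar> \<le> norm A * norm x" .
  qed
  finally show ?thesis by (simp add: mult.assoc)
qed

text \<open>Polarisation: the entries are values of the form at sums of two unit vectors.\<close>
lemma norm_sym_matrix_le:
  fixes A :: "real^'n^'n"
  assumes A: "A \<in> sym_matrices" and b: "\<And>h. \<bar>h \<bullet> (A *v h)\<bar> \<le> b * (norm h)\<^sup>2"
  shows "norm A \<le> real CARD('n) * (real CARD('n) * (3 * b))"
proof -
  have entry: "\<bar>A $ i $ j\<bar> \<le> 3 * b" for i j
  proof -
    define e f where "e = (axis i 1 :: real^'n)" and "f = (axis j 1 :: real^'n)"
    have ne: "norm e = 1" "norm f = 1" by (auto simp: e_def f_def)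
    have Aij: "A $ i $ j = e \<bullet> (A *v f)"
      by (simp add: e_def f_def inner_axis' matrix_vector_mult_basis column_def)
    have "(e + f) \<bullet> (A *v (e + f)) = e \<bullet> (A *v e) + f \<bullet> (A *v f) + 2 * (e \<bullet> (A *v f))"
      using sym_matrix_inner[OF A, of f e]
      by (simp add: matrix_vector_right_distrib inner_add_left inner_add_right inner_commute)
    moreover have "\<bar>(e + f) \<bullet> (A *v (e + f))\<bar> \<le> 4 * b"
    proof -
      have "norm (e + f) \<le> 2" using norm_triangle_ineq[of e f] ne by simp
      then have "(norm (e + f))\<^sup>2 \<le> 2\<^sup>2" by (intro power_mono) auto
      moreover have "0 \<le> b" using b[of e] ne by simp
      ultimately have "b * (norm (e + f))\<^sup>2 \<le> b * 2\<^sup>2" by (intro mult_left_mono) auto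
      then show ?thesis using b[of "e + f"] by simp
    qed
    moreover have "\<bar>e \<bullet> (A *v e)\<bar> \<le> b" "\<bar>f \<bullet> (A *v f)\<bar> \<le> b" using b[of e] b[of f] ne by auto
    ultimately show ?thesis unfolding Aij by linarith
  qed
  have row: "norm (A $ i) \<le> real CARD('n) * (3 * b)" for i
  proof -
    have "norm (A $ i) \<le> (\<Sum>j\<in>UNIV. \<bar>A $ i $ j\<bar>)" by (rule norm_le_l1_cart)
    also have "\<dots> \<le> (\<Sum>j\<in>(UNIV::'n set). 3 * b)" by (intro sum_mono entry)
    finally show ?thesis by simp
  qed
  have "norm A \<le> (\<Sum>i\<in>UNIV. norm (A $ i))" unfolding norm_vec_def by (rule L2_set_le_sum) auto
  also have "\<dots> \<le> (\<Sum>i\<in>(UNIV::'n set). real CARD('n) * (3 * b))" by (intro sum_mono row)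
  finally show ?thesis by simp
qed

lemma closed_sym_matrices: "closed (sym_matrices :: (real^'n^'n) set)"
proof -
  have eq: "sym_matrices = (\<Inter>i. \<Inter>j. {X :: real^'n^'n. X $ i $ j = X $ j $ i})"
    by (auto simp: sym_matrices_def transpose_def vec_eq_iff)
  have cl: "closed {X :: real^'n^'n. X $ i $ j = X $ j $ i}" for i j
    by (intro closed_Collect_eq continuous_intros)
  show ?thesis unfolding eq by (intro closed_INT ballI cl)
qed

text \<open>A maximum of the doubled function at positive times. Since \<open>\<Phi> \<sigma>\<close> is at least \<open>m\<close> somewhere, it
  attains its maximum, and does so in the compact set \<open>C\<close>, whatever \<open>\<sigma>\<close> is. If the maximum were at time zero for either variable
  along \<open>\<sigma> j \<rightarrow> 0\<close>, both times would tend to zero, as their difference is of order \<open>\<sigma> j\<close>. A cluster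
  point would by semicontinuity satisfy \<open>m \<le> w (x, 0) - v (y, 0) - \<theta> (x - y)\<close>, against the
  assumption on the initial values.\<close>
lemma doubled_maximum:
  fixes w v :: "(real^'n) \<times> real \<Rightarrow> real" and \<theta> :: "real^'n \<Rightarrow> real" and T K \<gamma> \<alpha> m \<sigma>\<^sub>0 :: real
  assumes w: "usc_on (UNIV \<times> {0..<T}) w" and v: "usc_on (UNIV \<times> {0..<T}) (\<lambda>z. - v z)"
    and K: "0 < K" "\<And>x t. t \<in> {0..<T} \<Longrightarrow> \<bar>w (x, t)\<bar> \<le> K" "\<And>x t. t \<in> {0..<T} \<Longrightarrow> \<bar>v (x, t)\<bar> \<le> K"
    and \<theta>: "continuous_on UNIV \<theta>" "\<And>q. 0 \<le> \<theta> q" "\<theta> 0 = 0"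
    and pos: "0 < \<gamma>" "0 < \<alpha>" "0 < m" "0 < \<sigma>\<^sub>0"
    and start: "t\<^sub>0 \<in> {0..<T}" "m \<le> w (x\<^sub>0, t\<^sub>0) - v (x\<^sub>0, t\<^sub>0) - 2 * (\<alpha> * (norm x\<^sub>0)\<^sup>2) - 2 * (\<gamma> / (T - t\<^sub>0))"
    and init: "\<And>x y. \<theta> (x - y) \<le> 2 * K \<Longrightarrow> w (x, 0) - v (y, 0) < m"
  defines "\<Phi> \<equiv> \<lambda>\<sigma> x t y s. w (x, t) - (\<alpha> * (norm x)\<^sup>2 + \<gamma> / (T - t)) - (v (y, s) + (\<alpha> * (norm y)\<^sup>2 + \<gamma> / (T - s)))
       - \<theta> (x - y) - ((t - s) / \<sigma>)\<^sup>2 / 2"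
  obtains \<sigma> x t y s where "0 < \<sigma>" "\<sigma> < \<sigma>\<^sub>0" "t \<in> {0<..<T}" "s \<in> {0<..<T}" "m \<le> \<Phi> \<sigma> x t y s"
    "\<And>x' t' y' s'. t' \<in> {0..<T} \<Longrightarrow> s' \<in> {0..<T} \<Longrightarrow> \<Phi> \<sigma> x' t' y' s' \<le> \<Phi> \<sigma> x t y s"
proof -
  define R where "R = 2 * K / \<alpha> + 1"
  define \<eta> where "\<eta> = \<gamma> / (2 * K)"
  have R: "1 \<le> R" and \<eta>: "0 < \<eta>" using K pos by (auto simp: R_def \<eta>_def)
  \<comment> \<open>The penalties force \<open>\<Phi> < 0\<close> outside this set.\<close>
  define C where "C = (cball (0::real^'n) R \<times> {0..T - \<eta>}) \<times> (cball (0::real^'n) R \<times> {0..T - \<eta>})"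
  have "compact C" unfolding C_def by (intro compact_Times) auto
  have C_time: "snd (fst z) \<in> {0..<T}" "snd (snd z) \<in> {0..<T}" if "z \<in> C" for z
    using that \<eta> by (auto simp: C_def)
  define \<Psi> where "\<Psi> = (\<lambda>\<sigma> z. \<Phi> \<sigma> (fst (fst z)) (snd (fst z)) (fst (snd z)) (snd (snd z)))"
  have w_C: "usc_on C (\<lambda>z. w (fst z))"
    by (rule usc_on_compose[OF w]) (auto intro!: continuous_intros simp: C_time C_def mem_Times_iff, insert \<eta>, auto)
  have v_C: "usc_on C (\<lambda>z. - v (snd z))"
    by (rule usc_on_compose[OF v]) (auto intro!: continuous_intros simp: C_time C_def mem_Times_iff, insert \<eta>, auto)
  have \<theta>_C: "continuous_on C (\<lambda>z. \<theta> (fst (fst z) - fst (snd z)))"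
    by (rule continuous_on_compose2[OF \<theta>(1)]) (auto intro!: continuous_intros)
  have usc\<Psi>: "usc_on C (\<Psi> \<sigma>)" if "0 < \<sigma>" for \<sigma>
  proof -
    have nz: "T - snd (fst z) \<noteq> 0" "T - snd (snd z) \<noteq> 0" if "z \<in> C" for z using C_time[OF that] by auto
    have "continuous_on C (\<lambda>z. - (\<alpha> * (norm (fst (fst z)))\<^sup>2 + \<gamma> / (T - snd (fst z))) - (\<alpha> * (norm (fst (snd z)))\<^sup>2 + \<gamma> / (T - snd (snd z)))
        - \<theta> (fst (fst z) - fst (snd z)) - ((snd (fst z) - snd (snd z)) / \<sigma>)\<^sup>2 / 2)"
      by (intro continuous_intros \<theta>_C) (use nz that in auto)
    from usc_on_add_continuous[OF usc_on_add[OF w_C v_C] this]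
    show ?thesis by (rule back_subst[of "usc_on C"]) (auto simp: \<Psi>_def \<Phi>_def)
  qed
  have \<Phi>_le: "\<Phi> \<sigma> x t y s \<le> 2 * K - \<alpha> * (norm x)\<^sup>2 - \<gamma> / (T - t) - \<alpha> * (norm y)\<^sup>2 - \<gamma> / (T - s) - \<theta> (x - y) - ((t - s) / \<sigma>)\<^sup>2 / 2"
    if "t \<in> {0..<T}" "s \<in> {0..<T}" for \<sigma> x t y s
    using K(2)[OF that(1), of x] K(3)[OF that(2), of y] unfolding \<Phi>_def abs_le_iff by linarith
  have nn: "0 \<le> \<alpha> * (norm x)\<^sup>2" "0 \<le> \<gamma> / (T - t)" "0 \<le> ((t - s) / \<sigma>)\<^sup>2 / 2" if "t \<in> {0..<T}" for x :: "real^'n" and t s \<sigma>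
    using pos that by auto
  have in_C: "((x, t), (y, s)) \<in> C" if t: "t \<in> {0..<T}" "s \<in> {0..<T}" and \<Phi>: "0 \<le> \<Phi> \<sigma> x t y s" for \<sigma> x t y s
  proof -
    note b = \<Phi>_le[OF t, of \<sigma> x y] \<Phi> nn(1)[OF t(1), of x] nn(1)[OF t(1), of y] nn(2)[OF t(1)] nn(2)[OF t(2)] nn(3)[OF t(1), of s \<sigma>] \<theta>(2)[of "x - y"]
    have sp: "norm x \<le> R" if "\<alpha> * (norm x)\<^sup>2 \<le> 2 * K" for x :: "real^'n"
    proof (rule ccontr)
      assume "\<not> norm x \<le> R"
      then have "R \<le> norm x" "1 \<le> norm x" using R by auto
      then have "norm x * 1 \<le> norm x * norm x" by (intro mult_left_mono) auto
      then have "2 * K / \<alpha> + 1 \<le> (norm x)\<^sup>2" using \<open>R \<le> norm x\<close> by (simp add: R_def power2_eq_square)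
      moreover have "(norm x)\<^sup>2 \<le> 2 * K / \<alpha>" using that pos by (simp add: field_simps)
      ultimately show False by simp
    qed
    have tm: "t \<le> T - \<eta>" if "\<gamma> / (T - t) \<le> 2 * K" "t < T" for t
      using that K(1) by (simp add: \<eta>_def field_simps)
    have "\<alpha> * (norm x)\<^sup>2 \<le> 2 * K" "\<alpha> * (norm y)\<^sup>2 \<le> 2 * K" "\<gamma> / (T - t) \<le> 2 * K" "\<gamma> / (T - s) \<le> 2 * K"
      using b by linarith+
    then show ?thesis using t sp tm by (simp add: C_def)
  qed
  define z\<^sub>0 where "z\<^sub>0 = ((x\<^sub>0, t\<^sub>0), (x\<^sub>0, t\<^sub>0))"
  have z0: "m \<le> \<Psi> \<sigma> z\<^sub>0" for \<sigma> using start(2) by (simp add: \<Psi>_def \<Phi>_def z\<^sub>0_def \<theta>(3))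
  have z0C: "z\<^sub>0 \<in> C"
    using in_C[OF start(1,1), of 1 x\<^sub>0 x\<^sub>0] z0[of 1] pos by (simp add: \<Psi>_def z\<^sub>0_def)
  have max_ex: "\<exists>z\<in>C. m \<le> \<Psi> \<sigma> z \<and> (\<forall>x' t' y' s'. t' \<in> {0..<T} \<longrightarrow> s' \<in> {0..<T} \<longrightarrow> \<Phi> \<sigma> x' t' y' s' \<le> \<Psi> \<sigma> z)"
    if \<sigma>: "0 < \<sigma>" for \<sigma>
  proof -
    obtain z where z: "z \<in> C" "\<forall>z'\<in>C. \<Psi> \<sigma> z' \<le> \<Psi> \<sigma> z"
      using usc_on_attains_max[OF \<open>compact C\<close> _ usc\<Psi>[OF \<sigma>]] z0C by blast
    have mz: "m \<le> \<Psi> \<sigma> z" using z(2) z0C z0[of \<sigma>] by fastforce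
    have "\<Phi> \<sigma> x' t' y' s' \<le> \<Psi> \<sigma> z" if "t' \<in> {0..<T}" "s' \<in> {0..<T}" for x' t' y' s'
    proof (cases "0 \<le> \<Phi> \<sigma> x' t' y' s'")
      case True
      then have "((x', t'), (y', s')) \<in> C" by (rule in_C[OF that])
      then have "\<Psi> \<sigma> ((x', t'), (y', s')) \<le> \<Psi> \<sigma> z" using z(2) by blast
      then show ?thesis by (simp add: \<Psi>_def)
    next
      case False
      then show ?thesis using mz pos by linarith
    qed
    then show ?thesis using z(1) mz by blast
  qed
  have "\<exists>\<sigma> z. 0 < \<sigma> \<and> \<sigma> < \<sigma>\<^sub>0 \<and> z \<in> C \<and> 0 < snd (fst z) \<and> 0 < snd (snd z) \<and> m \<le> \<Psi> \<sigma> z \<and>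
     (\<forall>x' t' y' s'. t' \<in> {0..<T} \<longrightarrow> s' \<in> {0..<T} \<longrightarrow> \<Phi> \<sigma> x' t' y' s' \<le> \<Psi> \<sigma> z)"
  proof (rule ccontr)
    assume no: "\<not> ?thesis"
    define \<sigma> where "\<sigma> = (\<lambda>j::nat. \<sigma>\<^sub>0 * inverse (real (Suc (Suc j))))"
    have \<sigma>: "0 < \<sigma> j" "\<sigma> j < \<sigma>\<^sub>0" for j
    proof -
      show "0 < \<sigma> j" unfolding \<sigma>_def by (intro mult_pos_pos pos) simp
      have "inverse (real (Suc (Suc j))) < 1" by (simp add: inverse_less_1_iff)
      from mult_strict_left_mono[OF this pos(4)] show "\<sigma> j < \<sigma>\<^sub>0" unfolding \<sigma>_def mult_1_right .
    qed
    have "\<forall>j. \<exists>z. z \<in> C \<and> m \<le> \<Psi> (\<sigma> j) z \<and> \<not> (0 < snd (fst z) \<and> 0 < snd (snd z))"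
      using max_ex[OF \<sigma>(1)] no \<sigma> by meson
    then obtain Z where Z: "\<And>j. Z j \<in> C" "\<And>j. m \<le> \<Psi> (\<sigma> j) (Z j)" "\<And>j. \<not> (0 < snd (fst (Z j)) \<and> 0 < snd (snd (Z j)))"
      by metis
    obtain z r where z: "z \<in> C" "strict_mono r" "(Z \<circ> r) \<longlonglongrightarrow> z"
      using seq_compactE[OF compact_imp_seq_compact[OF \<open>compact C\<close>], of Z] Z(1) by blast
    have conv: "(\<lambda>j. Z (r j)) \<longlonglongrightarrow> z" using z(3) by (simp add: o_def)
    have times: "0 \<le> snd (fst (Z j))" "0 \<le> snd (snd (Z j))" for j using C_time[OF Z(1)[of j]] by auto
    \<comment> \<open>One of the two times is zero, so their sum is their distance.\<close>
    have gap: "snd (fst (Z j)) + snd (snd (Z j)) \<le> (2 * K + 1) * \<sigma> j" for j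
    proof -
      define a where "a = (snd (fst (Z j)) - snd (snd (Z j))) / \<sigma> j"
      have "\<Psi> (\<sigma> j) (Z j) \<le> 2 * K - a\<^sup>2 / 2"
        using \<Phi>_le[OF C_time[OF Z(1)[of j]], of "\<sigma> j" "fst (fst (Z j))" "fst (snd (Z j))"]
          nn(1)[OF C_time(1)[OF Z(1)[of j]], of "fst (fst (Z j))"] nn(1)[OF C_time(1)[OF Z(1)[of j]], of "fst (snd (Z j))"]
          nn(2)[OF C_time(1)[OF Z(1)[of j]]] nn(2)[OF C_time(2)[OF Z(1)[of j]]] \<theta>(2)[of "fst (fst (Z j)) - fst (snd (Z j))"]
        unfolding \<Psi>_def a_def by linarith
      then have "a\<^sup>2 \<le> 4 * K" using Z(2)[of j] pos by (simp add: field_simps)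
      then have "a\<^sup>2 \<le> (2 * K + 1)\<^sup>2" using K(1) by (simp add: power2_eq_square algebra_simps) (smt (verit) mult_nonneg_nonneg)
      then have "\<bar>a\<bar> \<le> 2 * K + 1" using K(1) by (simp add: abs_le_square_iff[symmetric])
      moreover have "\<bar>snd (fst (Z j)) - snd (snd (Z j))\<bar> = \<bar>a\<bar> * \<sigma> j" using \<sigma>(1)[of j] by (simp add: a_def abs_divide)
      moreover have "snd (fst (Z j)) + snd (snd (Z j)) \<le> \<bar>snd (fst (Z j)) - snd (snd (Z j))\<bar>"
        using Z(3)[of j] times[of j] by linarith
      ultimately show ?thesis using \<sigma>(1)[of j] by (smt (verit) mult_right_mono)
    qed
    have lim\<^sub>\<sigma>: "(\<lambda>j. (2 * K + 1) * \<sigma> (r j)) \<longlonglongrightarrow> (2 * K + 1) * (\<sigma>\<^sub>0 * 0)"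
      unfolding \<sigma>_def
      by (intro tendsto_intros LIMSEQ_subseq_LIMSEQ[OF LIMSEQ_Suc[OF LIMSEQ_inverse_real_of_nat] z(2), unfolded o_def])
    have lim\<^sub>t: "(\<lambda>j. snd (fst (Z (r j))) + snd (snd (Z (r j)))) \<longlonglongrightarrow> snd (fst z) + snd (snd z)"
      by (intro tendsto_intros conv)
    have "snd (fst z) + snd (snd z) \<le> (2 * K + 1) * (\<sigma>\<^sub>0 * 0)"
      by (rule LIMSEQ_le[OF lim\<^sub>t lim\<^sub>\<sigma>]) (use gap in auto)
    then have zt: "snd (fst z) = 0" "snd (snd z) = 0" using C_time[OF z(1)] by auto
    define f where "f = (\<lambda>z. (w (fst z) + - v (snd z)) + - \<theta> (fst (fst z) - fst (snd z)))"
    have "usc_on C f"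
      unfolding f_def by (intro usc_on_add_continuous usc_on_add w_C v_C continuous_intros \<theta>_C)
    moreover have "m \<le> f (Z (r j))" for j
    proof -
      note t = C_time[OF Z(1)[of "r j"]]
      show ?thesis
        using Z(2)[of "r j"] nn(1)[OF t(1), of "fst (fst (Z (r j)))"] nn(1)[OF t(1), of "fst (snd (Z (r j)))"] nn(2)[OF t(1)] nn(2)[OF t(2)]
          nn(3)[OF t(1), of "snd (snd (Z (r j)))" "\<sigma> (r j)"]
        unfolding \<Psi>_def \<Phi>_def f_def prod.collapse by linarith
    qed
    ultimately have "m \<le> f z"
      using Z(1) by (intro usc_on_tendsto_le[OF _ z(1) conv, of f]) auto
    then have mf: "m \<le> w (fst (fst z), 0) - v (fst (snd z), 0) - \<theta> (fst (fst z) - fst (snd z))"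
      unfolding f_def using zt by (metis add_uminus_conv_diff prod.collapse)
    have "0 \<in> {0..<T}" using start(1) by auto
    then have "\<theta> (fst (fst z) - fst (snd z)) \<le> 2 * K"
      using mf K(2)[of 0 "fst (fst z)"] K(3)[of 0 "fst (snd z)"] pos unfolding abs_le_iff by linarith
    from init[OF this] mf \<theta>(2)[of "fst (fst z) - fst (snd z)"] show False by linarith
  qed
  then obtain \<sigma> z where z: "0 < \<sigma>" "\<sigma> < \<sigma>\<^sub>0" "z \<in> C" "0 < snd (fst z)" "0 < snd (snd z)" "m \<le> \<Psi> \<sigma> z"
     "\<And>x' t' y' s'. t' \<in> {0..<T} \<Longrightarrow> s' \<in> {0..<T} \<Longrightarrow> \<Phi> \<sigma> x' t' y' s' \<le> \<Psi> \<sigma> z" by blast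
  show thesis
    by (rule that[of \<sigma> "snd (fst z)" "snd (snd z)" "fst (fst z)" "fst (snd z)"])
       (use z C_time[OF z(3)] in \<open>auto simp: \<Psi>_def\<close>)
qed

text \<open>The two viscosity inequalities at a maximum of the doubled function. Their difference is strict by
  \<open>\<gamma> / T\<^sup>2\<close>: the final-time penalty contributes \<open>\<gamma> / (T - t)\<^sup>2 + \<gamma> / (T - s)\<^sup>2\<close>, and one of the two
  summands pays for the error \<open>\<delta>\<close> in the time slopes. The spatial penalty perturbs slopes and second-order
  parts by at most \<open>\<kappa>\<close>, whereas the bounds on \<open>X\<close> and \<open>Y\<close> do not involve \<open>\<alpha>\<close>, \<open>\<sigma>\<close> or \<open>\<kappa>\<close>.\<close>
lemma viscosity_pair_jets:
  fixes Fup Flo :: "real^'n \<Rightarrow> real^'n^'n \<Rightarrow> real" and w v :: "(real^'n) \<times> real \<Rightarrow> real"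
    and \<theta> :: "real^'n \<Rightarrow> real" and g :: "real^'n \<Rightarrow> real^'n" and H :: "real^'n \<Rightarrow> real^'n^'n"
  assumes Fup: "usc_on (UNIV \<times> sym_matrices) (\<lambda>(p, X). Fup p X)"
    and Flo: "lsc_on (UNIV \<times> sym_matrices) (\<lambda>(p, X). Flo p X)"
    and w: "usc_on (UNIV \<times> {0..<T}) w" "visc_sub T Fup w"
    and v: "lsc_on (UNIV \<times> {0..<T}) v" "visc_super T Flo v"
    and \<theta>: "\<And>q. (\<theta> has_derivative (\<lambda>h. g q \<bullet> h)) (at q)" "\<And>q. (g has_derivative (\<lambda>h. H q *v h)) (at q)"
    and H: "\<And>q. H q \<in> sym_matrices" "0 \<le> \<Lambda>" "\<And>h. norm (H (x - y) *v h) \<le> \<Lambda> * norm h"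
    and \<sigma>: "0 < \<sigma>" "\<sigma> \<le> 1" and \<gamma>: "0 < \<gamma>" and \<alpha>: "0 < \<alpha>" and ts: "t \<in> {0<..<T}" "s \<in> {0<..<T}"
    and max: "\<And>x' t' y' s'. t' \<in> {0..<T} \<Longrightarrow> s' \<in> {0..<T} \<Longrightarrow>
       w (x', t') - (\<alpha> * (norm x')\<^sup>2 + \<gamma> / (T - t')) - (v (y', s') + (\<alpha> * (norm y')\<^sup>2 + \<gamma> / (T - s'))) - \<theta> (x' - y') - ((t' - s') / \<sigma>)\<^sup>2 / 2
       \<le> w (x, t) - (\<alpha> * (norm x)\<^sup>2 + \<gamma> / (T - t)) - (v (y, s) + (\<alpha> * (norm y)\<^sup>2 + \<gamma> / (T - s))) - \<theta> (x - y) - ((t - s) / \<sigma>)\<^sup>2 / 2"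
    and \<kappa>: "0 < \<kappa>" "\<kappa> \<le> 1" "2 * \<alpha> \<le> \<kappa> / 4" "2 * \<alpha> * norm x \<le> \<kappa> / 4" "2 * \<alpha> * norm y \<le> \<kappa> / 4"
  obtains p p' X Y where "norm (p - g (x - y)) \<le> \<kappa>" "norm (p' - g (x - y)) \<le> \<kappa>" "X \<in> sym_matrices" "Y \<in> sym_matrices"
    "\<gamma> / T\<^sup>2 \<le> Fup p X - Flo p' Y"
    "\<And>h. - (16 * (\<Lambda> + 3)) * (norm h)\<^sup>2 \<le> h \<bullet> (X *v h)" "\<And>k. k \<bullet> (Y *v k) \<le> 16 * (\<Lambda> + 3) * (norm k)\<^sup>2"
    "\<And>h k. h \<bullet> (X *v h) - k \<bullet> (Y *v k) \<le> (h - k) \<bullet> (H (x - y) *v (h - k)) + (norm (H (x - y) *v (h - k)))\<^sup>2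
        + \<kappa> * ((norm h)\<^sup>2 + (norm k)\<^sup>2)"
proof -
  have T: "0 < T" using ts by auto
  define P where "P = (\<lambda>z::(real^'n) \<times> real. \<alpha> * (norm (fst z))\<^sup>2 + \<gamma> / (T - snd z))"
  define W where "W = (\<lambda>z. w z + - P z)"
  define V where "V = (\<lambda>z. - v z + - P z)"
  \<comment> \<open>A neighbourhood of the maximum in which both times stay inside \<open>(0, T)\<close>.\<close>
  define \<rho> where "\<rho> = Min {t, T - t, s, T - s} / 2"
  have \<rho>: "0 < \<rho>" "2 * \<rho> \<le> t" "2 * \<rho> \<le> T - t" "2 * \<rho> \<le> s" "2 * \<rho> \<le> T - s"
    using ts by (auto simp: \<rho>_def)
  have ball_t: "t' \<in> {0<..<T}" if "t' \<in> cball t \<rho>" for t' using that \<rho> by (auto simp: dist_real_def abs_le_iff)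
  have ball_s: "s' \<in> {0<..<T}" if "s' \<in> cball s \<rho>" for s' using that \<rho> by (auto simp: dist_real_def abs_le_iff)
  have contP: "continuous_on (UNIV \<times> {0..<T}) P"
    unfolding P_def by (intro continuous_intros) auto
  have uscW: "usc_on (UNIV \<times> {0..<T}) W" unfolding W_def
    by (intro usc_on_add_continuous w continuous_intros contP)
  have uscV: "usc_on (UNIV \<times> {0..<T}) V" unfolding V_def
    by (intro usc_on_add_continuous usc_on_uminus_lsc v continuous_intros contP)
  define \<delta> where "\<delta> = min (\<kappa> / 4) (min \<rho> (\<gamma> / T\<^sup>2))"
  have "0 < \<gamma> / T\<^sup>2" using \<gamma> T by simp
  then have \<delta>pos: "0 < \<delta>" using \<kappa>(1) \<rho>(1) by (simp add: \<delta>_def)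
  have \<delta>le: "\<delta> \<le> \<kappa> / 4" unfolding \<delta>_def by (rule min.cobounded1)
  have \<delta>\<rho>: "\<delta> \<le> \<rho>" unfolding \<delta>_def by (rule order_trans[OF min.cobounded2 min.cobounded1])
  have \<delta>\<gamma>: "\<delta> \<le> \<gamma> / T\<^sup>2" unfolding \<delta>_def by (rule order_trans[OF min.cobounded2 min.cobounded2])
  note \<delta> = \<delta>pos \<delta>le \<delta>\<rho> \<delta>\<gamma>
  have max': "W (x', t') + V (y', s') - \<theta> (x' - y') - ((t' - s') / \<sigma>)\<^sup>2 / 2 \<le> W (x, t) + V (y, s) - \<theta> (x - y) - ((t - s) / \<sigma>)\<^sup>2 / 2"
    if "t' \<in> cball t \<rho>" "s' \<in> cball s \<rho>" for x' t' y' s'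
  proof -
    have "t' \<in> {0..<T}" "s' \<in> {0..<T}" using ball_t[OF that(1)] ball_s[OF that(2)] by auto
    from max[OF this, of x' y'] show ?thesis by (simp add: W_def V_def P_def)
  qed
  have W': "usc_on (cball x \<rho> \<times> cball t \<rho>) W" and V': "usc_on (cball y \<rho> \<times> cball s \<rho>) V"
    using ball_t ball_s by (auto intro!: usc_on_subset[OF uscW] usc_on_subset[OF uscV] simp: less_imp_le)
  have k2: "0 < \<kappa> / 2" "\<kappa> / 2 \<le> 1" using \<kappa> by auto
  obtain z\<^sub>1 z\<^sub>2 p\<^sub>1 p\<^sub>2 a\<^sub>1 a\<^sub>2 D\<^sub>1 D\<^sub>2 where
    z: "norm (fst z\<^sub>1 - x) < \<delta>" "\<bar>snd z\<^sub>1 - t\<bar> < \<delta>" "norm (fst z\<^sub>2 - y) < \<delta>" "\<bar>snd z\<^sub>2 - s\<bar> < \<delta>"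
    and p: "norm (p\<^sub>1 - g (x - y)) < \<delta>" "norm (p\<^sub>2 + g (x - y)) < \<delta>" "- \<delta> < a\<^sub>1 + a\<^sub>2"
    and D\<^sub>1: "linear D\<^sub>1" "\<And>x y. D\<^sub>1 x \<bullet> y = x \<bullet> D\<^sub>1 y" "superjet W z\<^sub>1 (p\<^sub>1, a\<^sub>1) D\<^sub>1"
    and D\<^sub>2: "linear D\<^sub>2" "\<And>x y. D\<^sub>2 x \<bullet> y = x \<bullet> D\<^sub>2 y" "superjet V z\<^sub>2 (p\<^sub>2, a\<^sub>2) D\<^sub>2"
    and low: "\<And>h. - (16 * (\<Lambda> + 3)) * (norm h)\<^sup>2 \<le> fst (D\<^sub>1 (h, 0)) \<bullet> h"
      "\<And>k. - (16 * (\<Lambda> + 3)) * (norm k)\<^sup>2 \<le> fst (D\<^sub>2 (k, 0)) \<bullet> k"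
    and up: "\<And>h k. fst (D\<^sub>1 (h, 0)) \<bullet> h + fst (D\<^sub>2 (k, 0)) \<bullet> k
       \<le> (h - k) \<bullet> (H (x - y) *v (h - k)) + (norm (H (x - y) *v (h - k)))\<^sup>2 + \<kappa> / 2 * ((norm h)\<^sup>2 + (norm k)\<^sup>2)"
    by (rule doubling_jets[OF \<theta> H \<sigma> \<rho>(1) W' V' max' k2 \<delta>(1)]) (assumption | rule that)+
  have tz: "snd z\<^sub>1 \<in> {0<..<T}" "snd z\<^sub>2 \<in> {0<..<T}"
  proof -
    have c: "snd z\<^sub>1 \<in> cball t \<rho>" "snd z\<^sub>2 \<in> cball s \<rho>"
      using z(2,4) \<delta>(3) unfolding mem_cball dist_real_def by linarith+
    from ball_t[OF c(1)] show "snd z\<^sub>1 \<in> {0<..<T}" .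
    from ball_s[OF c(2)] show "snd z\<^sub>2 \<in> {0<..<T}" .
  qed
  define E where "E = (\<lambda>(z::(real^'n) \<times> real) (h::(real^'n) \<times> real). ((2 * \<alpha>) *\<^sub>R fst h, 4 * \<gamma> / (T - snd z) ^ 3 * snd h))"
  have penalty: "superjet P z ((2 * \<alpha>) *\<^sub>R fst z, \<gamma> / (T - snd z)\<^sup>2) (E z)" if "snd z \<in> {0<..<T}" for z
    unfolding P_def E_def using that \<gamma> by (intro penalty_superjet) auto
  have linE: "linear (E z)" for z
  proof -
    define k where "k = 4 * \<gamma> / (T - snd z) ^ 3"
    have E: "E z h = ((2 * \<alpha>) *\<^sub>R fst h, k * snd h)" for h by (simp add: E_def k_def)
    show ?thesis by (rule linearI) (simp_all add: E scaleR_add_right distrib_left mult.left_commute)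
  qed
  have symE: "E z h \<bullet> k = h \<bullet> E z k" for z h k by (simp add: E_def inner_prod_def)
  have rate: "\<gamma> / T\<^sup>2 \<le> \<gamma> / (T - r)\<^sup>2" if "r \<in> {0<..<T}" for r
    using that \<gamma> by (intro divide_left_mono mult_pos_pos power_mono) auto
  define X where "X = matrix (\<lambda>h. fst (D\<^sub>1 (h, 0) + E z\<^sub>1 (h, 0)))"
  define Y where "Y = matrix (\<lambda>h. fst (D\<^sub>2 (h, 0) + E z\<^sub>2 (h, 0)))"
  have "(D\<^sub>1 h + E z\<^sub>1 h) \<bullet> k = h \<bullet> (D\<^sub>1 k + E z\<^sub>1 k)" for h k
    by (simp add: inner_add_left inner_add_right D\<^sub>1(2) symE)
  note DE1 = linear_compose_add[OF D\<^sub>1(1) linE[of z\<^sub>1]] this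
  have "(D\<^sub>2 h + E z\<^sub>2 h) \<bullet> k = h \<bullet> (D\<^sub>2 k + E z\<^sub>2 k)" for h k
    by (simp add: inner_add_left inner_add_right D\<^sub>2(2) symE)
  note DE2 = linear_compose_add[OF D\<^sub>2(1) linE[of z\<^sub>2]] this
  have sub: "a\<^sub>1 + \<gamma> / (T - snd z\<^sub>1)\<^sup>2 \<le> Fup (p\<^sub>1 + (2 * \<alpha>) *\<^sub>R fst z\<^sub>1) X"
  proof -
    have "superjet (\<lambda>z. W z + P z) z\<^sub>1 ((p\<^sub>1, a\<^sub>1) + ((2 * \<alpha>) *\<^sub>R fst z\<^sub>1, \<gamma> / (T - snd z\<^sub>1)\<^sup>2)) (\<lambda>h. D\<^sub>1 h + E z\<^sub>1 h)"
      by (rule superjet_add[OF D\<^sub>1(3) penalty[OF tz(1)]])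
    then have "superjet w z\<^sub>1 (p\<^sub>1 + (2 * \<alpha>) *\<^sub>R fst z\<^sub>1, a\<^sub>1 + \<gamma> / (T - snd z\<^sub>1)\<^sup>2) (\<lambda>h. D\<^sub>1 h + E z\<^sub>1 h)"
      by (simp add: W_def)
    from visc_sub_jet[OF DE1 tz(1) Fup w(2) this] show ?thesis by (simp add: X_def)
  qed
  have super: "Flo (- (p\<^sub>2 + (2 * \<alpha>) *\<^sub>R fst z\<^sub>2)) (- Y) \<le> - (a\<^sub>2 + \<gamma> / (T - snd z\<^sub>2)\<^sup>2)"
  proof -
    have "superjet (\<lambda>z. V z + P z) z\<^sub>2 ((p\<^sub>2, a\<^sub>2) + ((2 * \<alpha>) *\<^sub>R fst z\<^sub>2, \<gamma> / (T - snd z\<^sub>2)\<^sup>2)) (\<lambda>h. D\<^sub>2 h + E z\<^sub>2 h)"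
      by (rule superjet_add[OF D\<^sub>2(3) penalty[OF tz(2)]])
    then have "superjet (\<lambda>z. - v z) z\<^sub>2 (p\<^sub>2 + (2 * \<alpha>) *\<^sub>R fst z\<^sub>2, a\<^sub>2 + \<gamma> / (T - snd z\<^sub>2)\<^sup>2) (\<lambda>h. D\<^sub>2 h + E z\<^sub>2 h)"
      by (simp add: V_def)
    from visc_super_jet[OF DE2 tz(2) Flo v(2) this] show ?thesis by (simp add: Y_def)
  qed
  have Xh: "h \<bullet> (X *v h) = fst (D\<^sub>1 (h, 0)) \<bullet> h + 2 * \<alpha> * (norm h)\<^sup>2" for h
    unfolding X_def space_block(2)[OF DE1(1)]
    by (simp add: E_def inner_add_right inner_commute power2_norm_eq_inner)
  have Yh: "h \<bullet> (Y *v h) = fst (D\<^sub>2 (h, 0)) \<bullet> h + 2 * \<alpha> * (norm h)\<^sup>2" for h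
    unfolding Y_def space_block(2)[OF DE2(1)]
    by (simp add: E_def inner_add_right inner_commute power2_norm_eq_inner)
  have nYh: "h \<bullet> (- Y *v h) = - (h \<bullet> (Y *v h))" for h by (simp add: matrix_uminus_mult)
  have X: "X \<in> sym_matrices" unfolding X_def by (rule space_block(3)[OF DE1])
  have Y: "Y \<in> sym_matrices" unfolding Y_def by (rule space_block(3)[OF DE2])
  have shift: "norm ((2 * \<alpha>) *\<^sub>R z) \<le> \<kappa> / 2" if "norm (z - c) < \<delta>" "2 * \<alpha> * norm c \<le> \<kappa> / 4" for z c :: "real^'n"
  proof -
    have "norm z \<le> norm c + norm (z - c)" using norm_triangle_ineq[of c "z - c"] by simp
    then have "norm z \<le> norm c + 1" using that(1) \<delta>(2) \<kappa> by linarith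
    then have "2 * \<alpha> * norm z \<le> 2 * \<alpha> * (norm c + 1)" using \<alpha> by (intro mult_left_mono) auto
    then show ?thesis using that(2) \<kappa> \<alpha> by (simp add: distrib_left)
  qed
  show thesis
  proof (rule that[of "p\<^sub>1 + (2 * \<alpha>) *\<^sub>R fst z\<^sub>1" "- (p\<^sub>2 + (2 * \<alpha>) *\<^sub>R fst z\<^sub>2)" X "- Y"])
    have "norm (p\<^sub>1 + (2 * \<alpha>) *\<^sub>R fst z\<^sub>1 - g (x - y)) \<le> norm (p\<^sub>1 - g (x - y)) + norm ((2 * \<alpha>) *\<^sub>R fst z\<^sub>1)"
      using norm_triangle_ineq[of "p\<^sub>1 - g (x - y)" "(2 * \<alpha>) *\<^sub>R fst z\<^sub>1"] by (simp add: algebra_simps)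
    also have "\<dots> \<le> \<kappa> / 4 + \<kappa> / 2" using p(1) \<delta>(2) shift[OF z(1) \<kappa>(4)] by (intro add_mono) auto
    also have "\<dots> \<le> \<kappa>" using \<kappa> by simp
    finally show "norm (p\<^sub>1 + (2 * \<alpha>) *\<^sub>R fst z\<^sub>1 - g (x - y)) \<le> \<kappa>" .
    have "norm (- (p\<^sub>2 + (2 * \<alpha>) *\<^sub>R fst z\<^sub>2) - g (x - y)) = norm ((p\<^sub>2 + g (x - y)) + (2 * \<alpha>) *\<^sub>R fst z\<^sub>2)"
      by (subst norm_minus_cancel[symmetric]) (simp add: algebra_simps)
    also have "\<dots> \<le> norm (p\<^sub>2 + g (x - y)) + norm ((2 * \<alpha>) *\<^sub>R fst z\<^sub>2)" by (rule norm_triangle_ineq)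
    also have "\<dots> \<le> \<kappa> / 4 + \<kappa> / 2" using p(2) \<delta>(2) shift[OF z(3) \<kappa>(5)] by (intro add_mono) auto
    also have "\<dots> \<le> \<kappa>" using \<kappa> by simp
    finally show "norm (- (p\<^sub>2 + (2 * \<alpha>) *\<^sub>R fst z\<^sub>2) - g (x - y)) \<le> \<kappa>" .
    show "X \<in> sym_matrices" by (rule X)
    show "- Y \<in> sym_matrices" using sym_matrices_closed_ops(3)[OF Y, of "- 1"] by simp
    show "\<gamma> / T\<^sup>2 \<le> Fup (p\<^sub>1 + (2 * \<alpha>) *\<^sub>R fst z\<^sub>1) X - Flo (- (p\<^sub>2 + (2 * \<alpha>) *\<^sub>R fst z\<^sub>2)) (- Y)"
      using sub super p(3) \<delta>(4) rate[OF tz(1)] rate[OF tz(2)] by linarith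
    show "- (16 * (\<Lambda> + 3)) * (norm h)\<^sup>2 \<le> h \<bullet> (X *v h)" for h
      using low(1)[of h] \<alpha> unfolding Xh by (smt (verit) mult_nonneg_nonneg zero_le_power2)
    show "k \<bullet> (- Y *v k) \<le> 16 * (\<Lambda> + 3) * (norm k)\<^sup>2" for k
    proof -
      have "0 \<le> 2 * \<alpha> * (norm k)\<^sup>2" using \<alpha> by simp
      moreover have "- (16 * (\<Lambda> + 3)) * (norm k)\<^sup>2 = - (16 * (\<Lambda> + 3) * (norm k)\<^sup>2)" by (rule minus_mult_left[symmetric])
      ultimately show ?thesis using low(2)[of k] unfolding nYh Yh by linarith
    qed
    show "h \<bullet> (X *v h) - k \<bullet> (- Y *v k) \<le> (h - k) \<bullet> (H (x - y) *v (h - k)) + (norm (H (x - y) *v (h - k)))\<^sup>2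
        + \<kappa> * ((norm h)\<^sup>2 + (norm k)\<^sup>2)" for h k
    proof -
      define N where "N = (norm h)\<^sup>2 + (norm k)\<^sup>2"
      have N: "0 \<le> N" by (simp add: N_def)
      have "2 * \<alpha> * N \<le> \<kappa> / 4 * N" using \<kappa>(3) N by (rule mult_right_mono)
      moreover have "2 * \<alpha> * N = 2 * \<alpha> * (norm h)\<^sup>2 + 2 * \<alpha> * (norm k)\<^sup>2" by (simp add: N_def distrib_left)
      moreover have "\<kappa> / 2 * N + \<kappa> / 4 * N \<le> \<kappa> * N" using N \<kappa>(1) by simp
      ultimately show ?thesis
        using up[of h k] unfolding Xh nYh Yh N_def[symmetric] by linarith
    qed
  qed
qed

section \<open>The comparison principle\<close>

text \<open>The limit in which the penalty disappears while the kernel stays fixed. The differences \<open>q\<close> are bounded by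
  \<open>R\<close> and the matrices are bounded from one side each; the coupling inequality, with \<open>k = 0\<close> or \<open>h = 0\<close>,
  supplies the other sides. In a convergent subsequence \<open>p\<close> and \<open>p'\<close> both tend to \<open>g q'\<close>, and the
  limit matrices satisfy the exact coupling inequality with \<open>H q'\<close>, which lies in \<open>sym_tang (g q') \<phi>\<close>. Compatibility
  then contradicts the gap \<open>c\<close>, which survives by semicontinuity.\<close>
lemma no_persistent_gap:
  fixes Fup Flo :: "real^'n \<Rightarrow> real^'n^'n \<Rightarrow> real" and g :: "real^'n \<Rightarrow> real^'n" and H :: "real^'n \<Rightarrow> real^'n^'n"
  assumes mono: "\<forall>p. \<forall>X\<in>sym_matrices. \<forall>Y\<in>sym_matrices. psd Y \<longrightarrow> Fup p (X + Y) \<ge> Fup p X \<and> Flo p (X + Y) \<ge> Flo p X"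
    and Fup: "usc_on (UNIV \<times> sym_matrices) (\<lambda>(p, X). Fup p X)"
    and Flo: "lsc_on (UNIV \<times> sym_matrices) (\<lambda>(p, X). Flo p X)"
    and comp: "compatible Fup Flo \<phi>"
    and H: "continuous_on UNIV H" "\<And>q. H q \<in> sym_tang (g q) \<phi>" and g: "continuous_on UNIV g"
    and \<Lambda>: "0 \<le> \<Lambda>" "\<And>q h. norm q \<le> R \<Longrightarrow> norm (H q *v h) \<le> \<Lambda> * norm h" and c: "0 < c"
    and approx: "\<And>\<kappa>. 0 < \<kappa> \<Longrightarrow> \<kappa> \<le> 1 \<Longrightarrow> \<exists>q p p' X Y. norm q \<le> R \<and> norm (p - g q) \<le> \<kappa> \<and> norm (p' - g q) \<le> \<kappa>
       \<and> X \<in> sym_matrices \<and> Y \<in> sym_matrices \<and> c \<le> Fup p X - Flo p' Y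
       \<and> (\<forall>h. - \<Lambda>' * (norm h)\<^sup>2 \<le> h \<bullet> (X *v h)) \<and> (\<forall>k. k \<bullet> (Y *v k) \<le> \<Lambda>' * (norm k)\<^sup>2)
       \<and> (\<forall>h k. h \<bullet> (X *v h) - k \<bullet> (Y *v k) \<le> (h - k) \<bullet> (H q *v (h - k)) + (norm (H q *v (h - k)))\<^sup>2
            + \<kappa> * ((norm h)\<^sup>2 + (norm k)\<^sup>2))"
  shows False
proof -
  define \<kappa> where "\<kappa> = (\<lambda>j::nat. inverse (real (Suc j)))"
  have \<kappa>: "0 < \<kappa> j" "\<kappa> j \<le> 1" for j by (auto simp: \<kappa>_def field_simps)
  have \<kappa>0: "\<kappa> \<longlonglongrightarrow> 0" unfolding \<kappa>_def by (rule LIMSEQ_inverse_real_of_nat)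
  have "\<forall>j. \<exists>q p p' X Y. norm q \<le> R \<and> norm (p - g q) \<le> \<kappa> j \<and> norm (p' - g q) \<le> \<kappa> j
       \<and> X \<in> sym_matrices \<and> Y \<in> sym_matrices \<and> c \<le> Fup p X - Flo p' Y
       \<and> (\<forall>h. - \<Lambda>' * (norm h)\<^sup>2 \<le> h \<bullet> (X *v h)) \<and> (\<forall>k. k \<bullet> (Y *v k) \<le> \<Lambda>' * (norm k)\<^sup>2)
       \<and> (\<forall>h k. h \<bullet> (X *v h) - k \<bullet> (Y *v k) \<le> (h - k) \<bullet> (H q *v (h - k)) + (norm (H q *v (h - k)))\<^sup>2
            + \<kappa> j * ((norm h)\<^sup>2 + (norm k)\<^sup>2))"
    using approx \<kappa> by blast
  then obtain q p p' X Y where q: "\<And>j. norm (q j) \<le> R"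
    and p: "\<And>j. norm (p j - g (q j)) \<le> \<kappa> j" and p': "\<And>j. norm (p' j - g (q j)) \<le> \<kappa> j"
    and X: "\<And>j. X j \<in> sym_matrices" and Y: "\<And>j. Y j \<in> sym_matrices" and gap: "\<And>j. c \<le> Fup (p j) (X j) - Flo (p' j) (Y j)"
    and lowX: "\<And>j h. - \<Lambda>' * (norm h)\<^sup>2 \<le> h \<bullet> (X j *v h)" and upY: "\<And>j k. k \<bullet> (Y j *v k) \<le> \<Lambda>' * (norm k)\<^sup>2"
    and up: "\<And>j h k. h \<bullet> (X j *v h) - k \<bullet> (Y j *v k) \<le> (h - k) \<bullet> (H (q j) *v (h - k)) + (norm (H (q j) *v (h - k)))\<^sup>2
            + \<kappa> j * ((norm h)\<^sup>2 + (norm k)\<^sup>2)"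
    unfolding choice_iff by blast
  define b where "b = \<bar>\<Lambda>'\<bar> + (\<Lambda> + \<Lambda>\<^sup>2 + 1)"
  have form: "h \<bullet> (H (q j) *v h) + (norm (H (q j) *v h))\<^sup>2 + \<kappa> j * (norm h)\<^sup>2 \<le> (\<Lambda> + \<Lambda>\<^sup>2 + 1) * (norm h)\<^sup>2" for j h
  proof -
    note n = \<Lambda>(2)[OF q[of j], of h]
    have "h \<bullet> (H (q j) *v h) \<le> norm h * norm (H (q j) *v h)" by (rule norm_cauchy_schwarz)
    also have "\<dots> \<le> norm h * (\<Lambda> * norm h)" by (intro mult_left_mono n) auto
    finally have 1: "h \<bullet> (H (q j) *v h) \<le> \<Lambda> * (norm h)\<^sup>2" by (simp add: power2_eq_square mult_ac)
    have "(norm (H (q j) *v h))\<^sup>2 \<le> (\<Lambda> * norm h)\<^sup>2" by (intro power_mono n) auto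
    then have 2: "(norm (H (q j) *v h))\<^sup>2 \<le> \<Lambda>\<^sup>2 * (norm h)\<^sup>2" by (simp add: power_mult_distrib)
    have 3: "\<kappa> j * (norm h)\<^sup>2 \<le> 1 * (norm h)\<^sup>2" using \<kappa> by (intro mult_right_mono) auto
    show ?thesis using 1 2 3 by (simp add: distrib_right)
  qed
  have bX: "\<bar>h \<bullet> (X j *v h)\<bar> \<le> b * (norm h)\<^sup>2" for j h
  proof -
    have "h \<bullet> (X j *v h) \<le> (\<Lambda> + \<Lambda>\<^sup>2 + 1) * (norm h)\<^sup>2" using up[of h j 0] form[of h j] by simp
    also have "\<dots> \<le> b * (norm h)\<^sup>2" by (intro mult_right_mono) (auto simp: b_def)
    finally have 1: "h \<bullet> (X j *v h) \<le> b * (norm h)\<^sup>2" .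
    have "\<Lambda>' * (norm h)\<^sup>2 \<le> b * (norm h)\<^sup>2" using \<Lambda>(1) by (intro mult_right_mono) (auto simp: b_def add_nonneg_nonneg intro: order_trans[OF abs_ge_self])
    then show ?thesis using 1 lowX[of h j] by (simp add: abs_le_iff)
  qed
  have bY: "\<bar>k \<bullet> (Y j *v k)\<bar> \<le> b * (norm k)\<^sup>2" for j k
  proof -
    have "- (k \<bullet> (Y j *v k)) \<le> (\<Lambda> + \<Lambda>\<^sup>2 + 1) * (norm k)\<^sup>2" using up[of 0 j k] form[of "- k" j] by simp
    also have "\<dots> \<le> b * (norm k)\<^sup>2" by (intro mult_right_mono) (auto simp: b_def)
    finally have 1: "- (k \<bullet> (Y j *v k)) \<le> b * (norm k)\<^sup>2" .
    have "\<Lambda>' * (norm k)\<^sup>2 \<le> b * (norm k)\<^sup>2" using \<Lambda>(1) by (intro mult_right_mono) (auto simp: b_def add_nonneg_nonneg intro: order_trans[OF abs_ge_self])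
    then show ?thesis using 1 upY[of k j] by (simp add: abs_le_iff)
  qed
  define B where "B = real CARD('n) * (real CARD('n) * (3 * b))"
  have "norm (X j) \<le> B" "norm (Y j) \<le> B" for j
    unfolding B_def by (intro norm_sym_matrix_le X bX, intro norm_sym_matrix_le Y bY)
  then have mem: "(q j, X j, Y j) \<in> cball 0 R \<times> cball 0 B \<times> cball 0 B" for j using q by simp
  have sc: "seq_compact (cball (0::real^'n) R \<times> cball (0::real^'n^'n) B \<times> cball (0::real^'n^'n) B)"
    by (intro compact_imp_seq_compact compact_Times compact_cball)
  obtain l r where "l \<in> cball (0::real^'n) R \<times> cball (0::real^'n^'n) B \<times> cball (0::real^'n^'n) B"
    and r: "strict_mono r" and l: "((\<lambda>j. (q j, X j, Y j)) \<circ> r) \<longlonglongrightarrow> l"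
    using seq_compactE[OF sc, of "\<lambda>j. (q j, X j, Y j)"] mem by blast
  define q' X' Y' where "q' = fst l" and "X' = fst (snd l)" and "Y' = snd (snd l)"
  have lq: "(\<lambda>j. q (r j)) \<longlonglongrightarrow> q'" using tendsto_fst[OF l] by (simp add: o_def q'_def)
  have lX: "(\<lambda>j. X (r j)) \<longlonglongrightarrow> X'" using tendsto_fst[OF tendsto_snd[OF l]] by (simp add: o_def X'_def)
  have lY: "(\<lambda>j. Y (r j)) \<longlonglongrightarrow> Y'" using tendsto_snd[OF tendsto_snd[OF l]] by (simp add: o_def Y'_def)
  have l\<kappa>: "(\<lambda>j. \<kappa> (r j)) \<longlonglongrightarrow> 0" using LIMSEQ_subseq_LIMSEQ[OF \<kappa>0 r] by (simp add: o_def)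
  have lg: "(\<lambda>j. g (q (r j))) \<longlonglongrightarrow> g q'" using g lq by (auto simp: continuous_on_eq_continuous_at intro: isCont_tendsto_compose)
  have lH: "(\<lambda>j. H (q (r j))) \<longlonglongrightarrow> H q'" using H(1) lq by (auto simp: continuous_on_eq_continuous_at intro: isCont_tendsto_compose)
  have near: "(\<lambda>j. f (r j)) \<longlonglongrightarrow> g q'" if "\<And>j. norm (f j - g (q j)) \<le> \<kappa> j" for f
  proof -
    have "(\<lambda>j. f (r j) - g (q (r j))) \<longlonglongrightarrow> 0"
      by (rule Lim_null_comparison[OF _ l\<kappa>]) (use that in auto)
    from tendsto_add[OF this lg] show ?thesis by simp
  qed
  have X': "X' \<in> sym_matrices" using closed_sequentially[OF closed_sym_matrices _ lX] X by blast
  have Y': "Y' \<in> sym_matrices" using closed_sequentially[OF closed_sym_matrices _ lY] Y by blast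
  have mv: "(\<lambda>j. A j *v h) \<longlonglongrightarrow> A' *v h" if "A \<longlonglongrightarrow> A'" for A and A' :: "real^'n^'n" and h
    unfolding matrix_vector_mult_def by (intro tendsto_intros tendsto_vec_lambda that)
  have le: "h \<bullet> (X' *v h) - k \<bullet> (Y' *v k) \<le> (h - k) \<bullet> (H q' *v (h - k)) + (norm (H q' *v (h - k)))\<^sup>2" for h k
  proof -
    have "(\<lambda>j. h \<bullet> (X (r j) *v h) - k \<bullet> (Y (r j) *v k)) \<longlonglongrightarrow> h \<bullet> (X' *v h) - k \<bullet> (Y' *v k)"
      by (intro tendsto_intros mv lX lY)
    moreover have "(\<lambda>j. (h - k) \<bullet> (H (q (r j)) *v (h - k)) + (norm (H (q (r j)) *v (h - k)))\<^sup>2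
            + \<kappa> (r j) * ((norm h)\<^sup>2 + (norm k)\<^sup>2)) \<longlonglongrightarrow> (h - k) \<bullet> (H q' *v (h - k)) + (norm (H q' *v (h - k)))\<^sup>2 + 0 * ((norm h)\<^sup>2 + (norm k)\<^sup>2)"
      by (intro tendsto_intros mv lH l\<kappa>)
    ultimately have "h \<bullet> (X' *v h) - k \<bullet> (Y' *v k) \<le> (h - k) \<bullet> (H q' *v (h - k)) + (norm (H q' *v (h - k)))\<^sup>2 + 0 * ((norm h)\<^sup>2 + (norm k)\<^sup>2)"
      by (rule LIMSEQ_le) (use up in blast)
    then show ?thesis by simp
  qed
  have "c \<le> Fup (g q') X' - Flo (g q') Y'"
  proof -
    define S where "S = (UNIV :: (real^'n) set) \<times> (sym_matrices :: (real^'n^'n) set)"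
    define f where "f = (\<lambda>z. (\<lambda>(p, X). Fup p X) (fst z) + - (\<lambda>(p, X). Flo p X) (snd z))"
    have "usc_on (S \<times> S) f"
      unfolding f_def
    proof (rule usc_on_add)
      show "usc_on (S \<times> S) (\<lambda>z. (\<lambda>(p, X). Fup p X) (fst z))"
        by (rule usc_on_compose[OF Fup]) (auto simp: S_def intro!: continuous_intros)
      show "usc_on (S \<times> S) (\<lambda>z. - (\<lambda>(p, X). Flo p X) (snd z))"
        by (rule usc_on_compose[OF usc_on_uminus_lsc[OF Flo]]) (auto simp: S_def intro!: continuous_intros)
    qed
    moreover have "((g q', X'), (g q', Y')) \<in> S \<times> S" using X' Y' by (simp add: S_def)
    moreover have "(\<lambda>j. ((p (r j), X (r j)), (p' (r j), Y (r j)))) \<longlonglongrightarrow> ((g q', X'), (g q', Y'))"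
      by (intro tendsto_Pair near p p' lX lY)
    ultimately have "c \<le> f ((g q', X'), (g q', Y'))"
      by (rule usc_on_tendsto_le) (use gap X Y in \<open>auto simp: f_def S_def\<close>)
    then show ?thesis by (simp add: f_def)
  qed
  moreover have "Fup (g q') X' \<le> Flo (g q') Y'"
    by (rule F_le_of_form_inequality[OF mono comp X' Y' H(2) le])
  ultimately show False using c by linarith
qed

theorem theorem1:
  fixes \<phi> :: "real^'n \<Rightarrow> real"
    and Fup Flo :: "real^'n \<Rightarrow> real^'n^'n \<Rightarrow> real"
    and T :: real
    and w v :: "(real^'n) \<times> real \<Rightarrow> real"
  assumes "finsler_norm \<phi>"
    and "\<exists>\<psi>. shielding_norm \<psi> \<phi>"
    and "\<forall>p. \<forall>X\<in>sym_matrices. \<forall>Y\<in>sym_matrices. psd Y \<longrightarrow>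
           Fup p (X + Y) \<ge> Fup p X \<and> Flo p (X + Y) \<ge> Flo p X"
    and "usc_on (UNIV \<times> sym_matrices) (\<lambda>(p, X). Fup p X)"
    and "lsc_on (UNIV \<times> sym_matrices) (\<lambda>(p, X). Flo p X)"
    and "compatible Fup Flo \<phi>"
    and "T > 0"
    and "usc_on (UNIV \<times> {0..<T}) w" and "bounded (w ` (UNIV \<times> {0..<T}))"
    and "lsc_on (UNIV \<times> {0..<T}) v" and "bounded (v ` (UNIV \<times> {0..<T}))"
    and "visc_sub T Fup w"
    and "visc_super T Flo v"
    and "\<exists>L\<le>0. ((\<lambda>\<delta>. Sup {w (x, 0) - v (y, 0) |x y. norm (x - y) \<le> \<delta>}) \<longlongrightarrow> L) (at_right 0)"
  shows "\<forall>x. \<forall>t\<in>{0..<T}. w (x, t) \<le> v (x, t)"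
proof (rule ccontr)
  assume "\<not> (\<forall>x. \<forall>t\<in>{0..<T}. w (x, t) \<le> v (x, t))"
  then obtain x\<^sub>0 t\<^sub>0 where t0: "t\<^sub>0 \<in> {0..<T}" and wv: "v (x\<^sub>0, t\<^sub>0) < w (x\<^sub>0, t\<^sub>0)"
    by (auto simp: not_le)
  define d where "d = w (x\<^sub>0, t\<^sub>0) - v (x\<^sub>0, t\<^sub>0)"
  have d: "0 < d" using wv by (simp add: d_def)
  \<comment> \<open>Half of the excess \<open>d\<close> survives both penalties at \<open>(x\<^sub>0, t\<^sub>0)\<close>, each of which costs at most a quarter.\<close>
  define m where "m = d / 2"
  define \<gamma> where "\<gamma> = d * (T - t\<^sub>0) / 8"
  have m: "0 < m" and \<gamma>: "0 < \<gamma>" using d t0 by (auto simp: m_def \<gamma>_def)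
  have \<gamma>0: "\<gamma> / (T - t\<^sub>0) = d / 8" 
  proof -
    have "T - t\<^sub>0 \<noteq> 0" using t0 by auto
    then have "d * (T - t\<^sub>0) / (T - t\<^sub>0) = d" by (rule nonzero_mult_div_cancel_right)
    then show ?thesis unfolding \<gamma>_def by (metis divide_divide_eq_left mult.commute)
  qed
  obtain Kw where Kw: "\<And>z. z \<in> UNIV \<times> {0..<T} \<Longrightarrow> \<bar>w z\<bar> \<le> Kw" using assms(9) by (auto simp: bounded_iff)
  obtain Kv where Kv: "\<And>z. z \<in> UNIV \<times> {0..<T} \<Longrightarrow> \<bar>v z\<bar> \<le> Kv" using assms(11) by (auto simp: bounded_iff)
  define K where "K = max 1 (max Kw Kv)"
  have K: "0 < K" "\<And>x t. t \<in> {0..<T} \<Longrightarrow> \<bar>w (x, t)\<bar> \<le> K" "\<And>x t. t \<in> {0..<T} \<Longrightarrow> \<bar>v (x, t)\<bar> \<le> K"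
    using Kw Kv by (auto simp: K_def le_max_iff_disj)
  obtain \<delta>\<^sub>0 where \<delta>0: "0 < \<delta>\<^sub>0" "\<And>x y. norm (x - y) \<le> \<delta>\<^sub>0 \<Longrightarrow> w (x, 0) - v (y, 0) < m"
  proof -
    define S where "S = (\<lambda>\<delta>. {w (x, 0) - v (y, 0) |x y. norm (x - y) \<le> \<delta>})"
    obtain L where L: "L \<le> 0" "((\<lambda>\<delta>. Sup (S \<delta>)) \<longlongrightarrow> L) (at_right 0)" using assms(14) by (auto simp: S_def)
    have "eventually (\<lambda>\<delta>. Sup (S \<delta>) < m) (at_right 0)" by (rule order_tendstoD(2)[OF L(2)]) (use L(1) m in simp)
    then obtain e where e: "0 < e" "\<And>\<delta>. 0 < \<delta> \<Longrightarrow> \<delta> < e \<Longrightarrow> Sup (S \<delta>) < m"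
      by (auto simp: eventually_at_right_field)
    have "w (x, 0) - v (y, 0) < m" if "norm (x - y) \<le> e / 2" for x y
    proof -
      have "0 \<in> {0..<T}" using assms(7) by simp
      have "bdd_above (S (e / 2))"
      proof (rule bdd_aboveI[of _ "2 * K"])
        fix a assume "a \<in> S (e / 2)"
        then obtain x y where a: "a = w (x, 0) - v (y, 0)" by (auto simp: S_def)
        have "w (x, 0) \<le> K" "- v (y, 0) \<le> K"
          using K(2)[OF \<open>0 \<in> {0..<T}\<close>, of x] K(3)[OF \<open>0 \<in> {0..<T}\<close>, of y] by (simp_all add: abs_le_iff)
        then show "a \<le> 2 * K" by (simp add: a)
      qed
      moreover have "w (x, 0) - v (y, 0) \<in> S (e / 2)" using that by (auto simp: S_def)
      ultimately have "w (x, 0) - v (y, 0) \<le> Sup (S (e / 2))" by (intro cSup_upper)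
      also have "\<dots> < m" using e(1) by (intro e(2)) auto
      finally show ?thesis .
    qed
    then show ?thesis using that[of "e / 2"] e(1) by auto
  qed
  obtain \<psi> where shield: "shielding_norm \<psi> \<phi>" using assms(2) by blast
  then have "finsler_norm \<psi>" by (simp add: shielding_norm_def)
  then obtain n where n: "0 < n" "\<And>q. n * norm q \<le> \<psi> q" by (rule finsler_norm_lower_bound) blast
  \<comment> \<open>The kernel exceeds \<open>2 * K\<close> at distance \<open>\<delta>\<^sub>0\<close>, so the points of a doubled maximum are closer than that.\<close>
  define c where "c = (2 * K + 1) / (n ^ 4 * \<delta>\<^sub>0 ^ 4)"
  have c: "0 < c" using K n \<delta>0 by (simp add: c_def)
  obtain \<theta> g H where \<theta>: "\<And>q. (\<theta> has_derivative (\<lambda>h. g q \<bullet> h)) (at q)" "\<And>q. (g has_derivative (\<lambda>h. H q *v h)) (at q)"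
    and H: "continuous_on UNIV H" "\<And>q. H q \<in> sym_tang (g q) \<phi>"
    and \<theta>low: "\<And>q. c * n ^ 4 * norm q ^ 4 \<le> \<theta> q" and \<theta>zero: "\<theta> 0 = 0"
    using shielding_quartic[OF assms(1) shield c n] by metis
  have \<theta>nonneg: "0 \<le> \<theta> q" for q
  proof -
    have "0 \<le> c * n ^ 4 * norm q ^ 4" using c n by simp
    then show ?thesis using \<theta>low[of q] by linarith
  qed
  have \<theta>cont: "continuous_on UNIV \<theta>"
    using \<theta>(1) by (meson continuous_at_imp_continuous_on has_derivative_continuous)
  have gcont: "continuous_on UNIV g"
    using \<theta>(2) by (meson continuous_at_imp_continuous_on has_derivative_continuous)
  have close: "norm q \<le> \<delta>\<^sub>0" if "\<theta> q \<le> 2 * K" for q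
  proof (rule ccontr)
    assume "\<not> norm q \<le> \<delta>\<^sub>0"
    then have "\<delta>\<^sub>0 ^ 4 \<le> norm q ^ 4" using \<delta>0 by (intro power_mono) auto
    then have "c * n ^ 4 * \<delta>\<^sub>0 ^ 4 \<le> c * n ^ 4 * norm q ^ 4" using c n by (intro mult_left_mono) auto
    moreover have "c * n ^ 4 * \<delta>\<^sub>0 ^ 4 = 2 * K + 1" using n \<delta>0 by (simp add: c_def)
    ultimately show False using \<theta>low[of q] that by linarith
  qed
  have init: "w (x, 0) - v (y, 0) < m" if "\<theta> (x - y) \<le> 2 * K" for x y
    using \<delta>0(2) close[OF that] by blast
  have Hsym: "H q \<in> sym_matrices" for q using H(2)[of q] by (simp add: sym_tang_iff)
  obtain \<Lambda> where \<Lambda>: "0 \<le> \<Lambda>" "\<And>q h. norm q \<le> \<delta>\<^sub>0 \<Longrightarrow> norm (H q *v h) \<le> \<Lambda> * norm h"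
  proof -
    have "compact (H ` cball 0 \<delta>\<^sub>0)"
      using H(1) by (intro compact_continuous_image) (auto intro: continuous_on_subset)
    then have "bounded (H ` cball 0 \<delta>\<^sub>0)" by (rule compact_imp_bounded)
    then obtain b where "\<forall>A\<in>H ` cball 0 \<delta>\<^sub>0. norm A \<le> b" unfolding bounded_iff by blast
    then have b: "norm (H q) \<le> b" if "norm q \<le> \<delta>\<^sub>0" for q using that by simp
    have "norm (H 0) \<le> b" using \<delta>0(1) by (intro b) simp
    then have "0 \<le> b" using norm_ge_zero order_trans by blast
    moreover have "norm (H q *v h) \<le> (real CARD('n) * b) * norm h" if "norm q \<le> \<delta>\<^sub>0" for q h
    proof -
      have "norm (H q *v h) \<le> real CARD('n) * norm (H q) * norm h" by (rule norm_matrix_vector_le)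
      also have "\<dots> \<le> (real CARD('n) * b) * norm h" using b[OF that] by (intro mult_right_mono mult_left_mono) auto
      finally show ?thesis .
    qed
    ultimately show thesis using that[of "real CARD('n) * b"] by simp
  qed
  have wneg: "usc_on (UNIV \<times> {0..<T}) (\<lambda>z. - v z)" by (rule usc_on_uminus_lsc[OF assms(10)])
  show False
  proof (rule no_persistent_gap[OF assms(3,4,5,6) H gcont \<Lambda>])
    show "0 < \<gamma> / T\<^sup>2" using \<gamma> assms(7) by simp
    fix \<kappa> :: real assume \<kappa>: "0 < \<kappa>" "\<kappa> \<le> 1"
    \<comment> \<open>The second entry makes the slope \<open>2 * \<alpha> * norm x\<close> of the penalty small, as \<open>\<alpha> * (norm x)\<^sup>2 \<le> 2 * K\<close>;
      the third keeps the penalty at \<open>x\<^sub>0\<close> below its share of \<open>d\<close>.\<close>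
    define \<alpha> where "\<alpha> = min (\<kappa> / 8) (min (\<kappa>\<^sup>2 / (128 * K)) (d / (8 * ((norm x\<^sub>0)\<^sup>2 + 1))))"
    have nx: "0 < (norm x\<^sub>0)\<^sup>2 + 1" by (simp add: add_nonneg_pos)
    have "0 < \<kappa>\<^sup>2 / (128 * K)" "0 < d / (8 * ((norm x\<^sub>0)\<^sup>2 + 1))" using \<kappa>(1) K(1) d nx by simp_all
    then have \<alpha>pos: "0 < \<alpha>" using \<kappa>(1) by (simp add: \<alpha>_def)
    have \<alpha>\<^sub>1: "\<alpha> \<le> \<kappa> / 8" unfolding \<alpha>_def by (rule min.cobounded1)
    have \<alpha>\<^sub>2: "\<alpha> \<le> \<kappa>\<^sup>2 / (128 * K)" unfolding \<alpha>_def by (rule order_trans[OF min.cobounded2 min.cobounded1])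
    have \<alpha>\<^sub>3: "\<alpha> \<le> d / (8 * ((norm x\<^sub>0)\<^sup>2 + 1))" unfolding \<alpha>_def by (rule order_trans[OF min.cobounded2 min.cobounded2])
    note \<alpha> = \<alpha>pos \<alpha>\<^sub>1 \<alpha>\<^sub>2 \<alpha>\<^sub>3
    have "\<alpha> * (norm x\<^sub>0)\<^sup>2 \<le> \<alpha> * ((norm x\<^sub>0)\<^sup>2 + 1)" using \<alpha> by (intro mult_left_mono) auto
    also have "\<dots> \<le> d / (8 * ((norm x\<^sub>0)\<^sup>2 + 1)) * ((norm x\<^sub>0)\<^sup>2 + 1)" using \<alpha>(4) nx by (intro mult_right_mono) auto
    also have "\<dots> = d / 8" using nx by (simp add: field_simps)
    finally have start: "m \<le> w (x\<^sub>0, t\<^sub>0) - v (x\<^sub>0, t\<^sub>0) - 2 * (\<alpha> * (norm x\<^sub>0)\<^sup>2) - 2 * (\<gamma> / (T - t\<^sub>0))"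
      unfolding \<gamma>0 m_def d_def by (simp add: field_simps)
    obtain \<sigma> x t y s where \<sigma>: "0 < \<sigma>" "\<sigma> < 1" and ts: "t \<in> {0<..<T}" "s \<in> {0<..<T}"
      and ge: "m \<le> w (x, t) - (\<alpha> * (norm x)\<^sup>2 + \<gamma> / (T - t)) - (v (y, s) + (\<alpha> * (norm y)\<^sup>2 + \<gamma> / (T - s))) - \<theta> (x - y) - ((t - s) / \<sigma>)\<^sup>2 / 2"
      and max: "\<And>x' t' y' s'. t' \<in> {0..<T} \<Longrightarrow> s' \<in> {0..<T} \<Longrightarrow>
       w (x', t') - (\<alpha> * (norm x')\<^sup>2 + \<gamma> / (T - t')) - (v (y', s') + (\<alpha> * (norm y')\<^sup>2 + \<gamma> / (T - s'))) - \<theta> (x' - y') - ((t' - s') / \<sigma>)\<^sup>2 / 2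
       \<le> w (x, t) - (\<alpha> * (norm x)\<^sup>2 + \<gamma> / (T - t)) - (v (y, s) + (\<alpha> * (norm y)\<^sup>2 + \<gamma> / (T - s))) - \<theta> (x - y) - ((t - s) / \<sigma>)\<^sup>2 / 2"
      using doubled_maximum[OF assms(8) wneg K \<theta>cont \<theta>nonneg \<theta>zero \<gamma> \<alpha>(1) m zero_less_one t0 start init] by metis
    have bnd: "\<theta> (x - y) \<le> 2 * K" "\<alpha> * (norm x)\<^sup>2 \<le> 2 * K" "\<alpha> * (norm y)\<^sup>2 \<le> 2 * K"
    proof -
      have "t \<in> {0..<T}" "s \<in> {0..<T}" using ts by auto
      then have wvK: "w (x, t) - v (y, s) \<le> 2 * K" using K(2)[of t x] K(3)[of s y] by (simp add: abs_le_iff)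
      have nn: "0 \<le> \<alpha> * (norm x)\<^sup>2" "0 \<le> \<alpha> * (norm y)\<^sup>2" "0 \<le> \<gamma> / (T - t)" "0 \<le> \<gamma> / (T - s)" "0 \<le> ((t - s) / \<sigma>)\<^sup>2 / 2"
        using \<alpha> \<gamma> ts by auto
      show "\<theta> (x - y) \<le> 2 * K" "\<alpha> * (norm x)\<^sup>2 \<le> 2 * K" "\<alpha> * (norm y)\<^sup>2 \<le> 2 * K"
        using ge wvK nn \<theta>nonneg[of "x - y"] m by linarith+
    qed
    have small: "2 * \<alpha> * norm x \<le> \<kappa> / 4" if "\<alpha> * (norm x)\<^sup>2 \<le> 2 * K" for x :: "real^'n"
    proof -
      have "(2 * \<alpha> * norm x)\<^sup>2 = 4 * \<alpha> * (\<alpha> * (norm x)\<^sup>2)" by (simp add: power2_eq_square)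
      also have "\<dots> \<le> 4 * \<alpha> * (2 * K)" using that \<alpha>(1) by (intro mult_left_mono) auto
      also have "\<dots> \<le> 4 * (\<kappa>\<^sup>2 / (128 * K)) * (2 * K)" using \<alpha>(3) K(1) by (intro mult_right_mono mult_left_mono) auto
      also have "\<dots> = (\<kappa> / 4)\<^sup>2" using K(1) by (simp add: power2_eq_square)
      finally show ?thesis by (rule power2_le_imp_le) (use \<kappa> in simp)
    qed
    have q: "norm (x - y) \<le> \<delta>\<^sub>0" by (rule close[OF bnd(1)])
    have "2 * \<alpha> \<le> \<kappa> / 4" using \<alpha>(2) by simp
    obtain p p' X Y where "norm (p - g (x - y)) \<le> \<kappa>" "norm (p' - g (x - y)) \<le> \<kappa>" "X \<in> sym_matrices" "Y \<in> sym_matrices"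
      "\<gamma> / T\<^sup>2 \<le> Fup p X - Flo p' Y"
      "\<And>h. - (16 * (\<Lambda> + 3)) * (norm h)\<^sup>2 \<le> h \<bullet> (X *v h)" "\<And>k. k \<bullet> (Y *v k) \<le> 16 * (\<Lambda> + 3) * (norm k)\<^sup>2"
      "\<And>h k. h \<bullet> (X *v h) - k \<bullet> (Y *v k) \<le> (h - k) \<bullet> (H (x - y) *v (h - k)) + (norm (H (x - y) *v (h - k)))\<^sup>2
        + \<kappa> * ((norm h)\<^sup>2 + (norm k)\<^sup>2)"
      by (rule viscosity_pair_jets[OF assms(4,5,8,12,10,13) \<theta> Hsym \<Lambda>(1) \<Lambda>(2)[OF q] \<sigma>(1) less_imp_le[OF \<sigma>(2)] \<gamma> \<alpha>(1) ts max \<kappa>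
            \<open>2 * \<alpha> \<le> \<kappa> / 4\<close> small[OF bnd(2)] small[OF bnd(3)]]) (assumption | rule that)+
    with q show "\<exists>q p p' X Y. norm q \<le> \<delta>\<^sub>0 \<and> norm (p - g q) \<le> \<kappa> \<and> norm (p' - g q) \<le> \<kappa>
       \<and> X \<in> sym_matrices \<and> Y \<in> sym_matrices \<and> \<gamma> / T\<^sup>2 \<le> Fup p X - Flo p' Y
       \<and> (\<forall>h. - (16 * (\<Lambda> + 3)) * (norm h)\<^sup>2 \<le> h \<bullet> (X *v h)) \<and> (\<forall>k. k \<bullet> (Y *v k) \<le> 16 * (\<Lambda> + 3) * (norm k)\<^sup>2)
       \<and> (\<forall>h k. h \<bullet> (X *v h) - k \<bullet> (Y *v k) \<le> (h - k) \<bullet> (H q *v (h - k)) + (norm (H q *v (h - k)))\<^sup>2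
            + \<kappa> * ((norm h)\<^sup>2 + (norm k)\<^sup>2))"
      by (intro exI[of _ "x - y"] exI[of _ p] exI[of _ p'] exI[of _ X] exI[of _ Y]) blast
  qed
qed

end
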